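(* Let $Q$ be a smooth manifold, $\mathcal{D}$ a distribution on $Q$ and $L:TQ\to\mathbb{R}$ a Lagrangian which is regular and regular with respect to $\mathcal{D}$. Let $\Gamma_L$ be the Lagrangian vector field of $L$, and let $p:\mathcal{X}(TQ)\to\mathcal{X}^T(TQ)$ be the projector associated with the decomposition $\mathcal{X}(TQ)=\mathcal{X}^T(TQ)\oplus(\mathcal{X}^g(\tau,\mathcal{D}))^V$. Then the vector field $\Gamma^1=p(\Gamma_L)$ is a second-order (SODE) extension of the nonholonomic vector field $\Gamma_{(L,\mathcal{D})}$. Equivalently, $\Gamma^1$ can be defined as the unique SODE on $TQ$ which is tangent to the constraints (i.e. $\Gamma^1\in\mathcal{X}^T(TQ)$) and whose difference from $\Gamma_L$ is $g$-orthogonal (i.e. $\Gamma^1-\Gamma_L\in(\mathcal{X}^g(\tau,\mathcal{D}))^V$).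
   Context: All objects are smooth and repeated indices are summed. $Q$ is an $n$-dimensional manifold, $\tau:TQ\to Q$ the tangent bundle, $\mathcal{D}$ a rank $m$ distribution, $k=n-m$; indices $\alpha,\beta,\gamma$ run over $1,\dots,n$; $a,b,c$ over $1,\dots,m$; $i,j$ over $1,\dots,k$. A frame $\{X_\alpha\}=\{X_a,X_i\}$ of vector fields on $Q$ is fixed, globally defined, such that $\{X_a\}$ spans $\mathcal{D}$; $[X_\alpha,X_\beta]=R^\gamma_{\alpha\beta}X_\gamma$. The quasi-velocities $v^\alpha=(v^a,v^i)$ are the functions on $TQ$ given by $v_q=v^\alpha X_\alpha(q)$. $\mathcal{C}$ denotes $\mathcal{D}$ viewed as the submanifold $\{v^i=0\}$ of $TQ$. For $X=X^\alpha\partial/\partial q^\alpha$ on $Q$, the complete and vertical lifts are $X^C=X^\alpha\frac{\partial}{\partial q^\alpha}+\dot q^\beta\frac{\partial X^\alpha}{\partial q^\beta}\frac{\partial}{\partial\dot q^\alpha}$ and $X^V=X^\alpha\frac{\partial}{\partial\dot q^\alpha}$. $\mathcal{X}(\tau)$ is the set of sections of $\tau^*TQ\to TQ$ (vector fields along $\tau$); $X=\xi^\alpha X_\alpha\in\mathcal{X}(\tau)$ with $\xi^\alpha\in C^\infty(TQ)$ has vertical lift $X^V=\xi^\alpha X_\alpha^V$. A SODE is a vector field on $TQ$ of the form $\Gamma=v^\alpha X_\alpha^C+F^\alpha X_\alpha^V$; its base integral curves are the curves $c$ in $Q$ such that $\dot c$ is an integral curve of $\Gamma$. $L$ is regular if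 its fibre Hessian is non-singular; then $\Gamma_L$ is the unique SODE with $\Gamma_L(X^V(L))-X^C(L)=0$ for all $X\in\mathcal{X}(Q)$. $L$ is regular with respect to $\mathcal{D}$ if the matrix $(X_a^V(X_b^V(L)))$ is non-singular everywhere on $TQ$; then the nonholonomic vector field $\Gamma_{(L,\mathcal{D})}$ is the unique vector field on $\mathcal{C}$ of the form $v^aX_a^C+f^aX_a^V$ satisfying $\Gamma_{(L,\mathcal{D})}(X^V(L))-X^C(L)=0$ on $\mathcal{C}$ for all $X\in\mathrm{Sec}(\mathcal{D})$. Its base integral curves are the nonholonomic trajectories. A SODE $\Gamma$ is a SODE extension of $\Gamma_{(L,\mathcal{D})}$ if each nonholonomic trajectory is a base integral curve of $\Gamma$; equivalently $\Gamma|_{\mathcal{C}}=\Gamma_{(L,\mathcal{D})}$. The Hessian $g$ of $L$ is the $C^\infty(TQ)$-bilinear form on $\mathcal{X}(\tau)$ determined by $g(X,Y)=X^V(Y^V(L))$ for $X,Y\in\mathcal{X}(Q)$. $\mathcal{X}(\tau,\mathcal{D})$ is the set of sections of $\tau^*\mathcal{D}\to TQ$, and $\mathcal{X}^g(\tau,\mathcal{D})$ is the set of $X\in\mathcal{X}(\tau)$ with $g(X,Y)=0$ for all $Y\in\mathcal{X}(\tau,\mathcal{D})$; it is spanned over $C^\infty(TQ)$ by $\tilde X_i=X_i-g^{ab}g_{bi}X_a$, where $g_{ab}=g(X_a,X_b)$, $g_{bi}=g(X_b,X_i)$ and $(g^{ab})=(g_{ab})^{-1}$. $(\mathcal{X}^g(\tau,\mathcal{D}))^V$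 is the set of vertical lifts of its elements. $\mathcal{X}^T(TQ)=\{Z\in\mathcal{X}(TQ)\mid Z(v^i)=0 \text{ for all } i\}$. One has $\mathcal{X}(TQ)=\mathcal{X}^T(TQ)\oplus(\mathcal{X}^g(\tau,\mathcal{D}))^V$. *)

theory Defs
  imports "HOL-Analysis.Analysis"
begin

section \<open>Smooth maps between normed spaces\<close>

text \<open>For an open set \<open>S\<close> of a finite-dimensional space this is the usual notion of a
  \<open>k\<close> times continuously differentiable map: all directional derivatives of order at most \<open>k\<close>
  exist and are continuous.\<close>

primrec Ck_on :: "nat \<Rightarrow> 'a::real_normed_vector set \<Rightarrow> ('a \<Rightarrow> 'b::real_normed_vector) \<Rightarrow> bool" where
  "Ck_on 0 S f \<longleftrightarrow> continuous_on S f"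
| "Ck_on (Suc k) S f \<longleftrightarrow>
     (\<forall>x\<in>S. f differentiable (at x)) \<and> (\<forall>v. Ck_on k S (\<lambda>x. frechet_derivative f (at x) v))"

definition smooth_on :: "'a::real_normed_vector set \<Rightarrow> ('a \<Rightarrow> 'b::real_normed_vector) \<Rightarrow> bool" where
  "smooth_on S f \<longleftrightarrow> (\<forall>k. Ck_on k S f)"


section \<open>Smooth manifolds\<close>

text \<open>A manifold is given by an indexed family of charts \<open>chart M \<kappa> : cdom M \<kappa> \<rightarrow> 'e\<close>; the index
  runs over a whole type, since charts may be repeated and may have empty domain. The underlying
  set is the union of the chart domains and the topology is the one induced by the charts.\<close>

record ('p, 'i, 'e) atlas =
  cdom :: "'i \<Rightarrow> 'p set"
  chart :: "'i \<Rightarrow> 'p \<Rightarrow> 'e"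

definition carrier :: "('p, 'i, 'e) atlas \<Rightarrow> 'p set" where
  "carrier M = (\<Union>\<kappa>. cdom M \<kappa>)"

definition cinv :: "('p, 'i, 'e) atlas \<Rightarrow> 'i \<Rightarrow> 'e \<Rightarrow> 'p" where
  "cinv M \<kappa> = inv_into (cdom M \<kappa>) (chart M \<kappa>)"

definition mtopology :: "('p, 'i, 'e::euclidean_space) atlas \<Rightarrow> 'p topology" where
  "mtopology M = topology (\<lambda>W. W \<subseteq> carrier M \<and> (\<forall>\<kappa>. open (chart M \<kappa> ` (W \<inter> cdom M \<kappa>))))"

definition smooth_manifold :: "('p, 'i, 'e::euclidean_space) atlas \<Rightarrow> bool" where
  "smooth_manifold M \<longleftrightarrow>
     (\<forall>\<kappa>. inj_on (chart M \<kappa>) (cdom M \<kappa>)) \<and>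
     (\<forall>\<kappa> \<kappa>'. open (chart M \<kappa> ` (cdom M \<kappa> \<inter> cdom M \<kappa>'))) \<and>
     (\<forall>\<kappa> \<kappa>'. smooth_on (chart M \<kappa> ` (cdom M \<kappa> \<inter> cdom M \<kappa>')) (chart M \<kappa>' \<circ> cinv M \<kappa>)) \<and>
     Hausdorff_space (mtopology M) \<and> second_countable (mtopology M)"

lemma openin_mtopology:
  assumes inj: "\<And>\<kappa>. inj_on (chart M \<kappa>) (cdom M \<kappa>)"
  shows "openin (mtopology M) W \<longleftrightarrow>
           W \<subseteq> carrier M \<and> (\<forall>\<kappa>. open (chart M \<kappa> ` (W \<inter> cdom M \<kappa>)))"
proof -
  let ?P = "\<lambda>W. W \<subseteq> carrier M \<and> (\<forall>\<kappa>. open (chart M \<kappa> ` (W \<inter> cdom M \<kappa>)))"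
  have "?P (S \<inter> T)" if "?P S" "?P T" for S T
  proof -
    have "chart M \<kappa> ` (S \<inter> T \<inter> cdom M \<kappa>) =
            chart M \<kappa> ` (S \<inter> cdom M \<kappa>) \<inter> chart M \<kappa> ` (T \<inter> cdom M \<kappa>)" for \<kappa>
      using inj[of \<kappa>] by (auto simp: inj_on_def)
    then show ?thesis using that by auto
  qed
  moreover have "?P (\<Union>K)" if K: "\<forall>S\<in>K. ?P S" for K
  proof -
    have "chart M \<kappa> ` (\<Union>K \<inter> cdom M \<kappa>) = (\<Union>S\<in>K. chart M \<kappa> ` (S \<inter> cdom M \<kappa>))" for \<kappa>
      by auto
    then show ?thesis using K by (auto intro!: open_UN)
  qed
  ultimately have "istopology ?P"
    unfolding istopology_def by blast
  then show ?thesis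
    unfolding mtopology_def by (simp add: topology_inverse')
qed

definition smooth_fun_on ::
  "('p, 'i, 'e::euclidean_space) atlas \<Rightarrow> 'p set \<Rightarrow> ('p \<Rightarrow> real) \<Rightarrow> bool" where
  "smooth_fun_on M W f \<longleftrightarrow> (\<forall>\<kappa>. smooth_on (chart M \<kappa> ` (W \<inter> cdom M \<kappa>)) (f \<circ> cinv M \<kappa>))"

abbreviation smooth_fun :: "('p, 'i, 'e::euclidean_space) atlas \<Rightarrow> ('p \<Rightarrow> real) \<Rightarrow> bool" where
  "smooth_fun M \<equiv> smooth_fun_on M (carrier M)"


section \<open>Tangent vectors and vector fields\<close>

text \<open>A tangent vector at \<open>p\<close> is the family of its coordinate representations in all charts around
  \<open>p\<close>, related by the derivatives of the coordinate changes. The components in charts that do not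
  contain \<open>p\<close> are set to \<open>0\<close>, so that the linear operations are pointwise.\<close>

definition tangent_space :: "('p, 'i, 'e::euclidean_space) atlas \<Rightarrow> 'p \<Rightarrow> ('i \<Rightarrow> 'e) set" where
  "tangent_space M p =
     {\<xi>. (\<forall>\<kappa>. p \<notin> cdom M \<kappa> \<longrightarrow> \<xi> \<kappa> = 0) \<and>
         (\<forall>\<kappa> \<kappa>'. p \<in> cdom M \<kappa> \<inter> cdom M \<kappa>' \<longrightarrow>
            \<xi> \<kappa>' = frechet_derivative (chart M \<kappa>' \<circ> cinv M \<kappa>) (at (chart M \<kappa> p)) (\<xi> \<kappa>))}"

definition lincomb :: "'j set \<Rightarrow> ('j \<Rightarrow> real) \<Rightarrow> ('j \<Rightarrow> 'i \<Rightarrow> 'e::real_vector) \<Rightarrow> 'i \<Rightarrow> 'e" where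
  "lincomb J c b = (\<lambda>\<kappa>. \<Sum>j\<in>J. c j *\<^sub>R b j \<kappa>)"

text \<open>\<open>\<xi>(f)\<close> for a tangent vector \<open>\<xi>\<close> at \<open>p\<close>; the value does not depend on the chart that is
  selected.\<close>

definition vec_app ::
  "('p, 'i, 'e::euclidean_space) atlas \<Rightarrow> 'p \<Rightarrow> ('i \<Rightarrow> 'e) \<Rightarrow> ('p \<Rightarrow> real) \<Rightarrow> real" where
  "vec_app M p \<xi> f =
     (let \<kappa> = (SOME \<kappa>. p \<in> cdom M \<kappa>)
      in frechet_derivative (f \<circ> cinv M \<kappa>) (at (chart M \<kappa> p)) (\<xi> \<kappa>))"

definition smooth_field_on ::
  "('p, 'i, 'e::euclidean_space) atlas \<Rightarrow> 'p set \<Rightarrow> ('p \<Rightarrow> 'i \<Rightarrow> 'e) \<Rightarrow> bool" where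
  "smooth_field_on M W Z \<longleftrightarrow>
     (\<forall>p\<in>W. Z p \<in> tangent_space M p) \<and>
     (\<forall>\<kappa>. smooth_on (chart M \<kappa> ` (W \<inter> cdom M \<kappa>)) (\<lambda>x. Z (cinv M \<kappa> x) \<kappa>))"

text \<open>Vector fields are extended by \<open>0\<close> outside the manifold, so that equality of vector fields is
  equality in HOL.\<close>

definition vector_fields :: "('p, 'i, 'e::euclidean_space) atlas \<Rightarrow> ('p \<Rightarrow> 'i \<Rightarrow> 'e) set" where
  "vector_fields M =
     {Z. smooth_field_on M (carrier M) Z \<and> (\<forall>p. p \<notin> carrier M \<longrightarrow> Z p = (\<lambda>\<kappa>. 0))}"

definition vf_app ::
  "('p, 'i, 'e::euclidean_space) atlas \<Rightarrow> ('p \<Rightarrow> 'i \<Rightarrow> 'e) \<Rightarrow> ('p \<Rightarrow> real) \<Rightarrow> 'p \<Rightarrow> real" where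
  "vf_app M Z f = (\<lambda>p. vec_app M p (Z p) f)"


section \<open>Curves\<close>

definition smooth_curve ::
  "('p, 'i, 'e::euclidean_space) atlas \<Rightarrow> real set \<Rightarrow> (real \<Rightarrow> 'p) \<Rightarrow> bool" where
  "smooth_curve M J c \<longleftrightarrow>
     c ` J \<subseteq> carrier M \<and>
     (\<forall>t\<in>J. \<forall>\<kappa>. c t \<in> cdom M \<kappa> \<longrightarrow>
        (\<exists>\<epsilon>>0. ball t \<epsilon> \<subseteq> J \<and> c ` ball t \<epsilon> \<subseteq> cdom M \<kappa> \<and> smooth_on (ball t \<epsilon>) (chart M \<kappa> \<circ> c)))"

definition velocity ::
  "('p, 'i, 'e::euclidean_space) atlas \<Rightarrow> (real \<Rightarrow> 'p) \<Rightarrow> real \<Rightarrow> 'p \<times> ('i \<Rightarrow> 'e)" where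
  "velocity M c t =
     (c t, \<lambda>\<kappa>. if c t \<in> cdom M \<kappa> then vector_derivative (chart M \<kappa> \<circ> c) (at t) else 0)"

definition integral_curve ::
  "('p, 'i, 'e::euclidean_space) atlas \<Rightarrow> ('p \<Rightarrow> 'i \<Rightarrow> 'e) \<Rightarrow> real set \<Rightarrow> (real \<Rightarrow> 'p) \<Rightarrow> bool" where
  "integral_curve M Z J \<gamma> \<longleftrightarrow>
     open J \<and> is_interval J \<and> smooth_curve M J \<gamma> \<and>
     (\<forall>t\<in>J. velocity M \<gamma> t = (\<gamma> t, Z (\<gamma> t)))"


section \<open>The tangent bundle\<close>

definition tangent_bundle ::
  "('p, 'i, 'e::euclidean_space) atlas \<Rightarrow> ('p \<times> ('i \<Rightarrow> 'e), 'i, 'e \<times> 'e) atlas" where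
  "tangent_bundle Q =
     \<lparr> cdom = (\<lambda>\<kappa>. {(q, \<xi>). q \<in> cdom Q \<kappa> \<and> \<xi> \<in> tangent_space Q q}),
       chart = (\<lambda>\<kappa> (q, \<xi>). (chart Q \<kappa> q, \<xi> \<kappa>)) \<rparr>"

text \<open>\<open>\<X>(\<tau>)\<close>: sections of \<open>\<tau>\<^sup>*TQ \<rightarrow> TQ\<close>. A vector field \<open>X\<close> on \<open>Q\<close> is regarded as the element
  \<open>X \<circ> fst\<close>.\<close>

definition fields_along_tau ::
  "('p, 'i, 'e::euclidean_space) atlas \<Rightarrow> ('p \<times> ('i \<Rightarrow> 'e) \<Rightarrow> 'i \<Rightarrow> 'e) set" where
  "fields_along_tau Q =
     {X. (\<forall>w\<in>carrier (tangent_bundle Q). X w \<in> tangent_space Q (fst w)) \<and>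
         (\<forall>\<kappa>. smooth_on (chart (tangent_bundle Q) \<kappa> ` cdom (tangent_bundle Q) \<kappa>)
                 (\<lambda>z. X (cinv (tangent_bundle Q) \<kappa> z) \<kappa>))}"

text \<open>The lifts are given by their components in the induced charts \<open>(q, \<dot>q)\<close> of the tangent
  bundle: the vertical lift has components \<open>(0, X)\<close>, the complete lift \<open>(X, DX(\<dot>q))\<close>.\<close>

definition vlift_along ::
  "('p, 'i, 'e::euclidean_space) atlas \<Rightarrow> ('p \<times> ('i \<Rightarrow> 'e) \<Rightarrow> 'i \<Rightarrow> 'e) \<Rightarrow>
     'p \<times> ('i \<Rightarrow> 'e) \<Rightarrow> 'i \<Rightarrow> 'e \<times> 'e" where
  "vlift_along Q X = (\<lambda>w \<kappa>. if w \<in> cdom (tangent_bundle Q) \<kappa> then (0, X w \<kappa>) else 0)"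

definition vlift ::
  "('p, 'i, 'e::euclidean_space) atlas \<Rightarrow> ('p \<Rightarrow> 'i \<Rightarrow> 'e) \<Rightarrow>
     'p \<times> ('i \<Rightarrow> 'e) \<Rightarrow> 'i \<Rightarrow> 'e \<times> 'e" where
  "vlift Q X = vlift_along Q (X \<circ> fst)"

definition clift ::
  "('p, 'i, 'e::euclidean_space) atlas \<Rightarrow> ('p \<Rightarrow> 'i \<Rightarrow> 'e) \<Rightarrow>
     'p \<times> ('i \<Rightarrow> 'e) \<Rightarrow> 'i \<Rightarrow> 'e \<times> 'e" where
  "clift Q X = (\<lambda>(q, \<xi>) \<kappa>.
     if (q, \<xi>) \<in> cdom (tangent_bundle Q) \<kappa>
     then (X q \<kappa>, frechet_derivative (\<lambda>x. X (cinv Q \<kappa> x) \<kappa>) (at (chart Q \<kappa> q)) (\<xi> \<kappa>))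
     else 0)"


section \<open>Distributions, frames and quasi-velocities\<close>

text \<open>A smooth distribution of rank \<open>m\<close>: locally spanned by \<open>m\<close> linearly independent smooth
  vector fields.\<close>

definition distribution ::
  "('p, 'i, 'e::euclidean_space) atlas \<Rightarrow> nat \<Rightarrow> ('p \<Rightarrow> ('i \<Rightarrow> 'e) set) \<Rightarrow> bool" where
  "distribution Q m D \<longleftrightarrow>
     (\<forall>q\<in>carrier Q. \<exists>W Y. openin (mtopology Q) W \<and> q \<in> W \<and>
        (\<forall>j<m. smooth_field_on Q W (Y j)) \<and>
        (\<forall>p\<in>W. (\<forall>c. lincomb {..<m} c (\<lambda>j. Y j p) = (\<lambda>\<kappa>. 0) \<longrightarrow> (\<forall>j<m. c j = 0)) \<and>
                D p = range (\<lambda>c. lincomb {..<m} c (\<lambda>j. Y j p))))"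

definition sections ::
  "('p, 'i, 'e::euclidean_space) atlas \<Rightarrow> ('p \<Rightarrow> ('i \<Rightarrow> 'e) set) \<Rightarrow> ('p \<Rightarrow> 'i \<Rightarrow> 'e) set" where
  "sections Q D = {X \<in> vector_fields Q. \<forall>q\<in>carrier Q. X q \<in> D q}"

definition frame ::
  "('p, 'i, 'e::euclidean_space) atlas \<Rightarrow> ('n::finite \<Rightarrow> 'p \<Rightarrow> 'i \<Rightarrow> 'e) \<Rightarrow> bool" where
  "frame Q X \<longleftrightarrow>
     (\<forall>\<alpha>. X \<alpha> \<in> vector_fields Q) \<and>
     (\<forall>q\<in>carrier Q. \<forall>\<xi>\<in>tangent_space Q q. \<exists>!c. \<xi> = lincomb UNIV c (\<lambda>\<alpha>. X \<alpha> q))"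

text \<open>The set \<open>A\<close> collects the indices \<open>a\<close> of the fields \<open>X\<^sub>a\<close> of the frame that span the
  distribution; its complement contains the indices \<open>i\<close>.\<close>

definition adapted_frame ::
  "('p, 'i, 'e::euclidean_space) atlas \<Rightarrow> ('p \<Rightarrow> ('i \<Rightarrow> 'e) set) \<Rightarrow>
     ('n::finite \<Rightarrow> 'p \<Rightarrow> 'i \<Rightarrow> 'e) \<Rightarrow> 'n set \<Rightarrow> bool" where
  "adapted_frame Q D X A \<longleftrightarrow>
     frame Q X \<and> (\<forall>q\<in>carrier Q. D q = range (\<lambda>c. lincomb A c (\<lambda>a. X a q)))"

definition frame_coeff ::
  "('n::finite \<Rightarrow> 'p \<Rightarrow> 'i \<Rightarrow> 'e::euclidean_space) \<Rightarrow> 'p \<Rightarrow> ('i \<Rightarrow> 'e) \<Rightarrow> 'n \<Rightarrow> real" where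
  "frame_coeff X q \<xi> = (THE c. \<xi> = lincomb UNIV c (\<lambda>\<alpha>. X \<alpha> q))"

definition quasi_velocity ::
  "('n::finite \<Rightarrow> 'p \<Rightarrow> 'i \<Rightarrow> 'e::euclidean_space) \<Rightarrow> 'n \<Rightarrow> 'p \<times> ('i \<Rightarrow> 'e) \<Rightarrow> real" where
  "quasi_velocity X \<alpha> w = frame_coeff X (fst w) (snd w) \<alpha>"

text \<open>The submanifold \<open>\<C>\<close> of the tangent bundle given by \<open>v\<^sup>i = 0\<close>.\<close>

definition constraint_set ::
  "('p, 'i, 'e::euclidean_space) atlas \<Rightarrow> ('n::finite \<Rightarrow> 'p \<Rightarrow> 'i \<Rightarrow> 'e) \<Rightarrow> 'n set \<Rightarrow>
     ('p \<times> ('i \<Rightarrow> 'e)) set" where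
  "constraint_set Q X A =
     {w \<in> carrier (tangent_bundle Q). \<forall>i\<in>-A. quasi_velocity X i w = 0}"

text \<open>Smoothness on the submanifold \<open>\<C>\<close>: local existence of smooth extensions.\<close>

definition smooth_fun_constraint ::
  "('p, 'i, 'e::euclidean_space) atlas \<Rightarrow> ('n::finite \<Rightarrow> 'p \<Rightarrow> 'i \<Rightarrow> 'e) \<Rightarrow> 'n set \<Rightarrow>
     ('p \<times> ('i \<Rightarrow> 'e) \<Rightarrow> real) \<Rightarrow> bool" where
  "smooth_fun_constraint Q X A f \<longleftrightarrow>
     (\<forall>w\<in>constraint_set Q X A. \<exists>W F. openin (mtopology (tangent_bundle Q)) W \<and> w \<in> W \<and>
        smooth_fun_on (tangent_bundle Q) W F \<and> (\<forall>u\<in>W \<inter> constraint_set Q X A. F u = f u))"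


section \<open>Second-order vector fields\<close>

definition sode ::
  "('p, 'i, 'e::euclidean_space) atlas \<Rightarrow> ('n::finite \<Rightarrow> 'p \<Rightarrow> 'i \<Rightarrow> 'e) \<Rightarrow>
     ('p \<times> ('i \<Rightarrow> 'e) \<Rightarrow> 'i \<Rightarrow> 'e \<times> 'e) \<Rightarrow> bool" where
  "sode Q X \<Gamma> \<longleftrightarrow>
     \<Gamma> \<in> vector_fields (tangent_bundle Q) \<and>
     (\<exists>F. (\<forall>\<alpha>. smooth_fun (tangent_bundle Q) (F \<alpha>)) \<and>
       (\<forall>w\<in>carrier (tangent_bundle Q). \<forall>\<kappa>.
          \<Gamma> w \<kappa> = (\<Sum>\<alpha>\<in>UNIV. quasi_velocity X \<alpha> w *\<^sub>R clift Q (X \<alpha>) w \<kappa>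
                           + F \<alpha> w *\<^sub>R vlift Q (X \<alpha>) w \<kappa>)))"

definition base_integral_curve ::
  "('p, 'i, 'e::euclidean_space) atlas \<Rightarrow> ('p \<times> ('i \<Rightarrow> 'e) \<Rightarrow> 'i \<Rightarrow> 'e \<times> 'e) \<Rightarrow>
     real set \<Rightarrow> (real \<Rightarrow> 'p) \<Rightarrow> bool" where
  "base_integral_curve Q \<Gamma> J c \<longleftrightarrow>
     smooth_curve Q J c \<and> integral_curve (tangent_bundle Q) \<Gamma> J (velocity Q c)"


section \<open>Lagrangians\<close>

text \<open>The matrix of second partial derivatives of \<open>L\<close> with respect to the fibre coordinates of
  the induced chart \<open>\<kappa>\<close>.\<close>

definition fibre_hessian ::
  "('p, 'i, real^'n) atlas \<Rightarrow> ('p \<times> ('i \<Rightarrow> real^'n) \<Rightarrow> real) \<Rightarrow> 'i \<Rightarrow>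
     'p \<times> ('i \<Rightarrow> real^'n) \<Rightarrow> real^'n^'n" where
  "fibre_hessian Q L \<kappa> w =
     (let (x, y) = chart (tangent_bundle Q) \<kappa> w;
          l = (\<lambda>u. L (cinv (tangent_bundle Q) \<kappa> (x, u)))
      in \<chi> \<alpha> \<beta>. frechet_derivative
                 (\<lambda>u. frechet_derivative l (at u) (axis \<beta> 1)) (at y) (axis \<alpha> 1))"

definition regular ::
  "('p, 'i, real^'n) atlas \<Rightarrow> ('p \<times> ('i \<Rightarrow> real^'n) \<Rightarrow> real) \<Rightarrow> bool" where
  "regular Q L \<longleftrightarrow>
     (\<forall>\<kappa>. \<forall>w\<in>cdom (tangent_bundle Q) \<kappa>. invertible (fibre_hessian Q L \<kappa> w))"

definition is_lagrangian_field ::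
  "('p, 'i, real^'n) atlas \<Rightarrow> ('n \<Rightarrow> 'p \<Rightarrow> 'i \<Rightarrow> real^'n) \<Rightarrow>
     ('p \<times> ('i \<Rightarrow> real^'n) \<Rightarrow> real) \<Rightarrow>
     ('p \<times> ('i \<Rightarrow> real^'n) \<Rightarrow> 'i \<Rightarrow> (real^'n) \<times> (real^'n)) \<Rightarrow> bool" where
  "is_lagrangian_field Q X L \<Gamma> \<longleftrightarrow>
     sode Q X \<Gamma> \<and>
     (\<forall>Y\<in>vector_fields Q. \<forall>w\<in>carrier (tangent_bundle Q).
        vf_app (tangent_bundle Q) \<Gamma> (vf_app (tangent_bundle Q) (vlift Q Y) L) w
        - vf_app (tangent_bundle Q) (clift Q Y) L w = 0)"

definition lagrangian_field ::
  "('p, 'i, real^'n) atlas \<Rightarrow> ('n \<Rightarrow> 'p \<Rightarrow> 'i \<Rightarrow> real^'n) \<Rightarrow>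
     ('p \<times> ('i \<Rightarrow> real^'n) \<Rightarrow> real) \<Rightarrow>
     'p \<times> ('i \<Rightarrow> real^'n) \<Rightarrow> 'i \<Rightarrow> (real^'n) \<times> (real^'n)" where
  "lagrangian_field Q X L = (THE \<Gamma>. is_lagrangian_field Q X L \<Gamma>)"

text \<open>The matrix \<open>X\<^sub>\<alpha>\<^sup>V(X\<^sub>\<beta>\<^sup>V(L))\<close> and the Hessian \<open>g\<close>, extended bilinearly over the smooth functions
  from the frame to all vector fields along \<open>\<tau>\<close>.\<close>

definition hessian_matrix ::
  "('p, 'i, real^'n) atlas \<Rightarrow> ('n \<Rightarrow> 'p \<Rightarrow> 'i \<Rightarrow> real^'n) \<Rightarrow>
     ('p \<times> ('i \<Rightarrow> real^'n) \<Rightarrow> real) \<Rightarrow> 'p \<times> ('i \<Rightarrow> real^'n) \<Rightarrow> 'n \<Rightarrow> 'n \<Rightarrow> real" where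
  "hessian_matrix Q X L w \<alpha> \<beta> =
     vf_app (tangent_bundle Q) (vlift Q (X \<alpha>))
       (vf_app (tangent_bundle Q) (vlift Q (X \<beta>)) L) w"

definition hessian ::
  "('p, 'i, real^'n) atlas \<Rightarrow> ('n \<Rightarrow> 'p \<Rightarrow> 'i \<Rightarrow> real^'n) \<Rightarrow>
     ('p \<times> ('i \<Rightarrow> real^'n) \<Rightarrow> real) \<Rightarrow>
     ('p \<times> ('i \<Rightarrow> real^'n) \<Rightarrow> 'i \<Rightarrow> real^'n) \<Rightarrow> ('p \<times> ('i \<Rightarrow> real^'n) \<Rightarrow> 'i \<Rightarrow> real^'n) \<Rightarrow>
     'p \<times> ('i \<Rightarrow> real^'n) \<Rightarrow> real" where
  "hessian Q X L Y Z w =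
     (\<Sum>\<alpha>\<in>UNIV. \<Sum>\<beta>\<in>UNIV. frame_coeff X (fst w) (Y w) \<alpha> * frame_coeff X (fst w) (Z w) \<beta>
                           * hessian_matrix Q X L w \<alpha> \<beta>)"

text \<open>Invertibility of the square matrix with rows and columns indexed by the finite set \<open>A\<close>.\<close>

definition nonsingular_on :: "'n set \<Rightarrow> ('n \<Rightarrow> 'n \<Rightarrow> real) \<Rightarrow> bool" where
  "nonsingular_on A G \<longleftrightarrow>
     (\<exists>H. \<forall>a\<in>A. \<forall>c\<in>A. (\<Sum>b\<in>A. G a b * H b c) = (if a = c then 1 else 0) \<and>
                       (\<Sum>b\<in>A. H a b * G b c) = (if a = c then 1 else 0))"

definition regular_wrt ::
  "('p, 'i, real^'n) atlas \<Rightarrow> ('n \<Rightarrow> 'p \<Rightarrow> 'i \<Rightarrow> real^'n) \<Rightarrow> 'n set \<Rightarrow>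
     ('p \<times> ('i \<Rightarrow> real^'n) \<Rightarrow> real) \<Rightarrow> bool" where
  "regular_wrt Q X A L \<longleftrightarrow>
     (\<forall>w\<in>carrier (tangent_bundle Q). nonsingular_on A (hessian_matrix Q X L w))"


section \<open>The nonholonomic vector field and its extensions\<close>

text \<open>Vector fields on \<open>\<C>\<close> are represented as maps into the tangent spaces of \<open>TQ\<close> which are
  annihilated by \<open>dv\<^sup>i\<close> and which are \<open>0\<close> outside \<open>\<C>\<close>.\<close>

definition is_nonholonomic_field ::
  "('p, 'i, real^'n) atlas \<Rightarrow> ('p \<Rightarrow> ('i \<Rightarrow> real^'n) set) \<Rightarrow> ('n \<Rightarrow> 'p \<Rightarrow> 'i \<Rightarrow> real^'n) \<Rightarrow> 'n set \<Rightarrow>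
     ('p \<times> ('i \<Rightarrow> real^'n) \<Rightarrow> real) \<Rightarrow>
     ('p \<times> ('i \<Rightarrow> real^'n) \<Rightarrow> 'i \<Rightarrow> (real^'n) \<times> (real^'n)) \<Rightarrow> bool" where
  "is_nonholonomic_field Q D X A L \<Gamma> \<longleftrightarrow>
     (\<forall>w. w \<notin> constraint_set Q X A \<longrightarrow> \<Gamma> w = (\<lambda>\<kappa>. 0)) \<and>
     (\<forall>w\<in>constraint_set Q X A. \<Gamma> w \<in> tangent_space (tangent_bundle Q) w \<and>
        (\<forall>i\<in>-A. vec_app (tangent_bundle Q) w (\<Gamma> w) (quasi_velocity X i) = 0)) \<and>
     (\<exists>f. (\<forall>a\<in>A. smooth_fun_constraint Q X A (f a)) \<and>
       (\<forall>w\<in>constraint_set Q X A. \<forall>\<kappa>.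
          \<Gamma> w \<kappa> = (\<Sum>a\<in>A. quasi_velocity X a w *\<^sub>R clift Q (X a) w \<kappa>
                        + f a w *\<^sub>R vlift Q (X a) w \<kappa>))) \<and>
     (\<forall>Y\<in>sections Q D. \<forall>w\<in>constraint_set Q X A.
        vf_app (tangent_bundle Q) \<Gamma> (vf_app (tangent_bundle Q) (vlift Q Y) L) w
        - vf_app (tangent_bundle Q) (clift Q Y) L w = 0)"

definition nonholonomic_field ::
  "('p, 'i, real^'n) atlas \<Rightarrow> ('p \<Rightarrow> ('i \<Rightarrow> real^'n) set) \<Rightarrow> ('n \<Rightarrow> 'p \<Rightarrow> 'i \<Rightarrow> real^'n) \<Rightarrow> 'n set \<Rightarrow>
     ('p \<times> ('i \<Rightarrow> real^'n) \<Rightarrow> real) \<Rightarrow>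
     'p \<times> ('i \<Rightarrow> real^'n) \<Rightarrow> 'i \<Rightarrow> (real^'n) \<times> (real^'n)" where
  "nonholonomic_field Q D X A L = (THE \<Gamma>. is_nonholonomic_field Q D X A L \<Gamma>)"

definition nonholonomic_trajectory ::
  "('p, 'i, real^'n) atlas \<Rightarrow> ('p \<Rightarrow> ('i \<Rightarrow> real^'n) set) \<Rightarrow> ('n \<Rightarrow> 'p \<Rightarrow> 'i \<Rightarrow> real^'n) \<Rightarrow> 'n set \<Rightarrow>
     ('p \<times> ('i \<Rightarrow> real^'n) \<Rightarrow> real) \<Rightarrow> real set \<Rightarrow> (real \<Rightarrow> 'p) \<Rightarrow> bool" where
  "nonholonomic_trajectory Q D X A L J c \<longleftrightarrow>
     velocity Q c ` J \<subseteq> constraint_set Q X A \<and>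
     base_integral_curve Q (nonholonomic_field Q D X A L) J c"

definition sode_extension ::
  "('p, 'i, real^'n) atlas \<Rightarrow> ('p \<Rightarrow> ('i \<Rightarrow> real^'n) set) \<Rightarrow> ('n \<Rightarrow> 'p \<Rightarrow> 'i \<Rightarrow> real^'n) \<Rightarrow> 'n set \<Rightarrow>
     ('p \<times> ('i \<Rightarrow> real^'n) \<Rightarrow> real) \<Rightarrow>
     ('p \<times> ('i \<Rightarrow> real^'n) \<Rightarrow> 'i \<Rightarrow> (real^'n) \<times> (real^'n)) \<Rightarrow> bool" where
  "sode_extension Q D X A L \<Gamma> \<longleftrightarrow>
     sode Q X \<Gamma> \<and>
     (\<forall>J c. nonholonomic_trajectory Q D X A L J c \<longrightarrow> base_integral_curve Q \<Gamma> J c)"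


section \<open>The decomposition of the vector fields on the tangent bundle\<close>

definition fields_along_tau_in ::
  "('p, 'i, real^'n) atlas \<Rightarrow> ('p \<Rightarrow> ('i \<Rightarrow> real^'n) set) \<Rightarrow>
     ('p \<times> ('i \<Rightarrow> real^'n) \<Rightarrow> 'i \<Rightarrow> real^'n) set" where
  "fields_along_tau_in Q D =
     {Y \<in> fields_along_tau Q. \<forall>w\<in>carrier (tangent_bundle Q). Y w \<in> D (fst w)}"

definition orth_fields ::
  "('p, 'i, real^'n) atlas \<Rightarrow> ('p \<Rightarrow> ('i \<Rightarrow> real^'n) set) \<Rightarrow> ('n \<Rightarrow> 'p \<Rightarrow> 'i \<Rightarrow> real^'n) \<Rightarrow>
     ('p \<times> ('i \<Rightarrow> real^'n) \<Rightarrow> real) \<Rightarrow> ('p \<times> ('i \<Rightarrow> real^'n) \<Rightarrow> 'i \<Rightarrow> real^'n) set" where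
  "orth_fields Q D X L =
     {Z \<in> fields_along_tau Q. \<forall>Y\<in>fields_along_tau_in Q D.
        \<forall>w\<in>carrier (tangent_bundle Q). hessian Q X L Z Y w = 0}"

definition orth_vertical ::
  "('p, 'i, real^'n) atlas \<Rightarrow> ('p \<Rightarrow> ('i \<Rightarrow> real^'n) set) \<Rightarrow> ('n \<Rightarrow> 'p \<Rightarrow> 'i \<Rightarrow> real^'n) \<Rightarrow>
     ('p \<times> ('i \<Rightarrow> real^'n) \<Rightarrow> real) \<Rightarrow>
     ('p \<times> ('i \<Rightarrow> real^'n) \<Rightarrow> 'i \<Rightarrow> (real^'n) \<times> (real^'n)) set" where
  "orth_vertical Q D X L = vlift_along Q ` orth_fields Q D X L"

definition tangent_fields ::
  "('p, 'i, real^'n) atlas \<Rightarrow> ('n \<Rightarrow> 'p \<Rightarrow> 'i \<Rightarrow> real^'n) \<Rightarrow> 'n set \<Rightarrow>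
     ('p \<times> ('i \<Rightarrow> real^'n) \<Rightarrow> 'i \<Rightarrow> (real^'n) \<times> (real^'n)) set" where
  "tangent_fields Q X A =
     {Z \<in> vector_fields (tangent_bundle Q). \<forall>i\<in>-A. \<forall>w\<in>carrier (tangent_bundle Q).
        vf_app (tangent_bundle Q) Z (quasi_velocity X i) w = 0}"

text \<open>The projector onto the first summand of the direct sum of \<^const>\<open>tangent_fields\<close> and
  \<^const>\<open>orth_vertical\<close>. Subtraction of vector fields is the pointwise one on functions.\<close>

definition tangent_projector ::
  "('p, 'i, real^'n) atlas \<Rightarrow> ('p \<Rightarrow> ('i \<Rightarrow> real^'n) set) \<Rightarrow> ('n \<Rightarrow> 'p \<Rightarrow> 'i \<Rightarrow> real^'n) \<Rightarrow> 'n set \<Rightarrow>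
     ('p \<times> ('i \<Rightarrow> real^'n) \<Rightarrow> real) \<Rightarrow>
     ('p \<times> ('i \<Rightarrow> real^'n) \<Rightarrow> 'i \<Rightarrow> (real^'n) \<times> (real^'n)) \<Rightarrow>
     'p \<times> ('i \<Rightarrow> real^'n) \<Rightarrow> 'i \<Rightarrow> (real^'n) \<times> (real^'n)" where
  "tangent_projector Q D X A L Z =
     (THE Y. Y \<in> tangent_fields Q X A \<and> Z - Y \<in> orth_vertical Q D X L)"

end

theory Submission
  imports Defs
begin

text \<open>In the frame, a second-order field is determined by its forces \<open>F\<^sup>\<alpha>\<close>, and two facts about it
  reduce the theorem to linear algebra. First, its derivative of the quasi-velocity \<open>v\<^sup>\<alpha>\<close> is exactly
  \<open>F\<^sup>\<alpha>\<close> (\<open>quasi_velocity_second_order_field\<close>), so it is tangent to the constraints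
  if and only if \<open>F\<^sup>i = 0\<close>. Secondly, the Euler-Lagrange expression \<open>\<Gamma>(Y\<^sup>V(L)) - Y\<^sup>C(L)\<close> is tensorial in
  \<open>Y\<close> and equals \<open>F\<^sup>\<alpha> g\<^sub>\<alpha>\<^sub>\<beta> - r\<^sub>\<beta>\<close> for \<open>Y = X\<^sub>\<beta>\<close>, where \<open>r\<^sub>\<beta>\<close> depends only on \<open>L\<close> and the frame
  (\<open>euler_lagrange_tensorial\<close>, \<open>euler_lagrange_frame\<close>).

  Hence \<open>\<Gamma>\<^sub>L\<close> is given by the solution of \<open>F\<^sup>\<alpha> g\<^sub>\<alpha>\<^sub>\<beta> = r\<^sub>\<beta>\<close> for all \<open>\<beta>\<close>. Consider on the other hand the
  forces with \<open>F\<^sup>i = 0\<close> and \<open>F\<^sup>\<alpha> g\<^sub>\<alpha>\<^sub>b = r\<^sub>b\<close> for the indices \<open>b\<close> of the distribution only. Their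
  second-order field is tangent to the constraints. Its difference from \<open>\<Gamma>\<^sub>L\<close> is the vertical lift of a
  field \<open>z\<^sup>\<alpha> X\<^sub>\<alpha>\<close> with \<open>z\<^sup>\<alpha> g\<^sub>\<alpha>\<^sub>b = r\<^sub>b - r\<^sub>b = 0\<close>, which is \<open>g\<close>-orthogonality. So it is the projection of
  \<open>\<Gamma>\<^sub>L\<close>, and on \<open>\<C>\<close> the same equations are the ones that characterise the nonholonomic
  field (\<open>projected_lagrangian_field\<close>). Uniqueness in all three places is the nonsingularity of the
  Hessian, on the whole tangent space for \<open>\<Gamma>\<^sub>L\<close> and along the distribution for the other two.

  The remaining work is differential geometry in charts: the lifts are vector fields on the tangent
  bundle, and the solutions of the linear systems are smooth by Cramer's rule.\<close>

section \<open>Calculus of smooth maps\<close>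

lemma Ck_on_cong:
  assumes "open S" "\<And>x. x \<in> S \<Longrightarrow> f x = g x" "Ck_on k S f"
  shows "Ck_on k S g"
  using assms(2,3)
proof (induction k arbitrary: f g)
  case 0
  then show ?case
    using continuous_on_cong by auto
next
  case (Suc k)
  have g: "(g has_derivative frechet_derivative f (at x)) (at x)" if "x \<in> S" for x
  proof (rule has_derivative_transform_within_open[OF _ \<open>open S\<close> that])
    show "(f has_derivative frechet_derivative f (at x)) (at x)"
      using Suc.prems(2) that by (simp add: frechet_derivative_works)
  qed (use Suc.prems(1) in simp)
  have "Ck_on k S (\<lambda>x. frechet_derivative g (at x) v)" for v
  proof (rule Suc.IH)
    show "Ck_on k S (\<lambda>x. frechet_derivative f (at x) v)"
      using Suc.prems(2) by simp
  qed (use frechet_derivative_at[OF g] in simp)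
  then show ?case
    using g by (auto simp: differentiable_def)
qed

lemma Ck_on_SucI:
  assumes "open S"
    and f': "\<And>x. x \<in> S \<Longrightarrow> (f has_derivative f' x) (at x)"
    and Ck: "\<And>v. Ck_on k S (\<lambda>x. f' x v)"
  shows "Ck_on (Suc k) S f"
proof -
  have "f' x = frechet_derivative f (at x)" if "x \<in> S" for x
    using frechet_derivative_at[OF f'[OF that]] .
  then have "Ck_on k S (\<lambda>x. frechet_derivative f (at x) v)" for v
    by (intro Ck_on_cong[OF \<open>open S\<close> _ Ck[of v]]) simp
  then show ?thesis
    using f' by (auto simp: differentiable_def)
qed

lemma has_derivative_frechet:
  "Ck_on (Suc k) S f \<Longrightarrow> x \<in> S \<Longrightarrow> (f has_derivative frechet_derivative f (at x)) (at x)"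
  by (simp add: frechet_derivative_works)

lemma Ck_on_Suc_imp: "Ck_on (Suc k) S f \<Longrightarrow> Ck_on k S f"
proof (induction k arbitrary: f)
  case 0
  then show ?case
    by (auto intro!: continuous_at_imp_continuous_on differentiable_imp_continuous_within)
next
  case (Suc k)
  then show ?case
    unfolding Ck_on.simps(2)[of "Suc k" S f] Ck_on.simps(2)[of k S f] by blast
qed

lemma Ck_on_const: "Ck_on k S (\<lambda>x. c)"
proof (induction k arbitrary: c)
  case (Suc k)
  have "frechet_derivative (\<lambda>x. c) (at x) = (\<lambda>v. 0)" for x :: 'a
    by (metis frechet_derivative_at has_derivative_const)
  then show ?case using Suc by simp
qed simp

lemma Ck_on_bounded_linear_compose:
  assumes T: "bounded_linear T" and "open S" and "Ck_on k S f"
  shows "Ck_on k S (\<lambda>x. T (f x))"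
  using assms(3)
proof (induction k arbitrary: f)
  case 0
  then show ?case
    using bounded_linear.continuous_on[OF T] by auto
next
  case (Suc k)
  show ?case
  proof (rule Ck_on_SucI[OF \<open>open S\<close>])
    show "((\<lambda>x. T (f x)) has_derivative (\<lambda>v. T (frechet_derivative f (at x) v))) (at x)"
      if "x \<in> S" for x
      using bounded_linear.has_derivative[OF T has_derivative_frechet[OF Suc.prems that]] .
    show "Ck_on k S (\<lambda>x. T (frechet_derivative f (at x) v))" for v
      using Suc by simp
  qed
qed

lemma Ck_on_bounded_linear:
  assumes T: "bounded_linear T" and "open S"
  shows "Ck_on k S T"
proof (cases k)
  case 0
  then show ?thesis using T by (simp add: linear_continuous_on)
next
  case (Suc j)
  have "Ck_on (Suc j) S T"
    by (rule Ck_on_SucI[OF \<open>open S\<close>, where f' = "\<lambda>x. T"])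
      (auto intro: bounded_linear_imp_has_derivative[OF T] Ck_on_const)
  then show ?thesis using Suc by simp
qed

lemma Ck_on_add:
  assumes "open S" "Ck_on k S f" "Ck_on k S g"
  shows "Ck_on k S (\<lambda>x. f x + g x)"
  using assms(2,3)
proof (induction k arbitrary: f g)
  case 0
  then show ?case by (auto intro: continuous_on_add)
next
  case (Suc k)
  show ?case
    by (rule Ck_on_SucI[OF \<open>open S\<close>,
          where f' = "\<lambda>x v. frechet_derivative f (at x) v + frechet_derivative g (at x) v"])
      (use Suc in \<open>auto intro!: has_derivative_add has_derivative_frechet[where k = k]\<close>)
qed

lemma Ck_on_sum:
  assumes "open S" "\<And>i. i \<in> I \<Longrightarrow> Ck_on k S (f i)"
  shows "Ck_on k S (\<lambda>x. \<Sum>i\<in>I. f i x)"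
  using assms(2)
  by (induction I rule: infinite_finite_induct) (auto intro: Ck_on_const Ck_on_add[OF \<open>open S\<close>])

lemma Ck_on_bounded_bilinear:
  assumes B: "bounded_bilinear prd" and "open S" and "Ck_on k S f" "Ck_on k S g"
  shows "Ck_on k S (\<lambda>x. prd (f x) (g x))"
  using assms(3,4)
proof (induction k arbitrary: f g)
  case 0
  then show ?case using bounded_bilinear.continuous_on[OF B] by auto
next
  case (Suc k)
  show ?case
  proof (rule Ck_on_SucI[OF \<open>open S\<close>])
    show "((\<lambda>x. prd (f x) (g x)) has_derivative
        (\<lambda>v. prd (f x) (frechet_derivative g (at x) v) + prd (frechet_derivative f (at x) v) (g x))) (at x)"
      if "x \<in> S" for x
      using bounded_bilinear.FDERIV[OF B has_derivative_frechet[OF Suc.prems(1) that]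
          has_derivative_frechet[OF Suc.prems(2) that]] .
    have "Ck_on k S f" "Ck_on k S g"
      using Suc.prems Ck_on_Suc_imp by blast+
    then show "Ck_on k S (\<lambda>x. prd (f x) (frechet_derivative g (at x) v)
        + prd (frechet_derivative f (at x) v) (g x))" for v
      using Suc by (intro Ck_on_add[OF \<open>open S\<close>] Suc.IH) auto
  qed
qed

lemma linear_euclidean_expansion:
  assumes "linear T"
  shows "T v = (\<Sum>b\<in>Basis. (v \<bullet> b) *\<^sub>R T (b::'a::euclidean_space))"
proof -
  have "T v = T (\<Sum>b\<in>Basis. (v \<bullet> b) *\<^sub>R b)"
    by (simp add: euclidean_representation)
  then show ?thesis
    using assms by (simp add: linear_sum linear_cmul)
qed

text \<open>In a chain rule \<open>D(f \<circ> g)(x) v = Df(g x) (Dg(x) v)\<close> the direction of differentiation of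
  \<open>f\<close> varies with \<open>x\<close>. Expanding it in an orthonormal basis reduces the claim to directional
  derivatives of \<open>f\<close> in fixed directions, to which the induction hypothesis applies.\<close>

lemma Ck_on_compose:
  fixes f :: "'b::euclidean_space \<Rightarrow> 'c::real_normed_vector"
    and g :: "'a::real_normed_vector \<Rightarrow> 'b"
  assumes "open S" "g ` S \<subseteq> T" "Ck_on k T f" "Ck_on k S g"
  shows "Ck_on k S (\<lambda>x. f (g x))"
  using assms(3,4)
proof (induction k arbitrary: f)
  case 0
  then show ?case
    using assms(2) continuous_on_compose2 by fastforce
next
  case (Suc k)
  have f: "(f has_derivative frechet_derivative f (at (g x))) (at (g x))" if "x \<in> S" for x
    using Suc.prems(1) assms(2) that by (intro has_derivative_frechet[where k = k and S = T]) auto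
  show ?case
  proof (rule Ck_on_SucI[OF \<open>open S\<close>])
    fix x assume x: "x \<in> S"
    have "((\<lambda>x. f (g x)) has_derivative
        (\<lambda>v. frechet_derivative f (at (g x)) (frechet_derivative g (at x) v))) (at x)"
      using has_derivative_compose[OF has_derivative_frechet[OF Suc.prems(2) x] f[OF x]] .
    then show "((\<lambda>x. f (g x)) has_derivative
        (\<lambda>v. \<Sum>b\<in>Basis. (frechet_derivative g (at x) v \<bullet> b) *\<^sub>R frechet_derivative f (at (g x)) b)) (at x)"
      by (simp add: linear_euclidean_expansion[OF has_derivative_linear[OF f[OF x]], symmetric])
  next
    fix v
    have "Ck_on k S g"
      using Suc.prems Ck_on_Suc_imp by blast
    then show "Ck_on k S (\<lambda>x. \<Sum>b\<in>Basis.
        (frechet_derivative g (at x) v \<bullet> b) *\<^sub>R frechet_derivative f (at (g x)) b)"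
      using Suc.prems
      by (intro Ck_on_sum[OF \<open>open S\<close>] Ck_on_bounded_bilinear[OF bounded_bilinear_scaleR \<open>open S\<close>]
          Ck_on_bounded_linear_compose[OF bounded_linear_inner_left \<open>open S\<close>] Suc.IH) auto
  qed
qed

lemma Ck_on_inverse:
  fixes f :: "'a::real_normed_vector \<Rightarrow> real"
  assumes "open S" "\<And>x. x \<in> S \<Longrightarrow> f x \<noteq> 0" "Ck_on k S f"
  shows "Ck_on k S (\<lambda>x. inverse (f x))"
  using assms(3)
proof (induction k)
  case 0
  then show ?case using assms(2) by (auto intro: continuous_on_inverse)
next
  case (Suc k)
  show ?case
  proof (rule Ck_on_SucI[OF \<open>open S\<close>])
    show "((\<lambda>x. inverse (f x)) has_derivative
        (\<lambda>v. (- 1) *\<^sub>R (inverse (f x) * frechet_derivative f (at x) v * inverse (f x)))) (at x)"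
      if "x \<in> S" for x
      using Deriv.has_derivative_inverse[OF assms(2)[OF that] has_derivative_frechet[OF Suc.prems that]]
      by simp
    show "Ck_on k S (\<lambda>x. (- 1) *\<^sub>R (inverse (f x) * frechet_derivative f (at x) v * inverse (f x)))" for v
      using Suc Ck_on_Suc_imp[OF Suc.prems]
      by (intro Ck_on_bounded_linear_compose[OF bounded_linear_scaleR_right \<open>open S\<close>]
          Ck_on_bounded_bilinear[OF bounded_bilinear_mult \<open>open S\<close>]) auto
  qed
qed

lemma smooth_on_cong: "smooth_on S f \<Longrightarrow> open S \<Longrightarrow> (\<And>x. x \<in> S \<Longrightarrow> f x = g x) \<Longrightarrow> smooth_on S g"
  unfolding smooth_on_def using Ck_on_cong by blast

lemma smooth_on_const: "smooth_on S (\<lambda>x. c)"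
  unfolding smooth_on_def using Ck_on_const by blast

lemma smooth_on_bounded_linear: "bounded_linear T \<Longrightarrow> open S \<Longrightarrow> smooth_on S T"
  unfolding smooth_on_def using Ck_on_bounded_linear by blast

lemma smooth_on_fst: "open S \<Longrightarrow> smooth_on S fst"
  and smooth_on_snd: "open S \<Longrightarrow> smooth_on S snd"
  by (auto intro: smooth_on_bounded_linear bounded_linear_fst bounded_linear_snd)

lemma smooth_on_bounded_linear_compose:
  "bounded_linear T \<Longrightarrow> open S \<Longrightarrow> smooth_on S f \<Longrightarrow> smooth_on S (\<lambda>x. T (f x))"
  unfolding smooth_on_def using Ck_on_bounded_linear_compose by blast

lemma smooth_on_add:
  "open S \<Longrightarrow> smooth_on S f \<Longrightarrow> smooth_on S g \<Longrightarrow> smooth_on S (\<lambda>x. f x + g x)"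
  unfolding smooth_on_def using Ck_on_add by blast

lemma smooth_on_sum:
  "open S \<Longrightarrow> (\<And>i. i \<in> I \<Longrightarrow> smooth_on S (f i)) \<Longrightarrow> smooth_on S (\<lambda>x. \<Sum>i\<in>I. f i x)"
  by (simp add: smooth_on_def Ck_on_sum)

lemma smooth_on_bounded_bilinear:
  "bounded_bilinear prd \<Longrightarrow> open S \<Longrightarrow> smooth_on S f \<Longrightarrow> smooth_on S g
    \<Longrightarrow> smooth_on S (\<lambda>x. prd (f x) (g x))"
  unfolding smooth_on_def using Ck_on_bounded_bilinear by blast

lemmas smooth_on_scaleR = smooth_on_bounded_bilinear[OF bounded_bilinear_scaleR]
lemmas smooth_on_mult = smooth_on_bounded_bilinear[OF bounded_bilinear_mult]

lemma smooth_on_diff: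
  assumes "open S" "smooth_on S f" "smooth_on S g"
  shows "smooth_on S (\<lambda>x. f x - g x)"
  using smooth_on_add[OF assms(1,2) smooth_on_bounded_linear_compose[OF
        bounded_linear_minus[OF bounded_linear_ident] assms(1,3)]]
  by simp

lemma smooth_on_compose:
  fixes f :: "'b::euclidean_space \<Rightarrow> 'c::real_normed_vector"
  assumes "open S" "smooth_on S g" "smooth_on T f" "g ` S \<subseteq> T"
  shows "smooth_on S (\<lambda>x. f (g x))"
  unfolding smooth_on_def
proof
  fix k
  have "Ck_on k T f" "Ck_on k S g"
    using assms(2,3) by (simp_all add: smooth_on_def)
  then show "Ck_on k S (\<lambda>x. f (g x))"
    by (rule Ck_on_compose[OF assms(1,4)])
qed

lemma smooth_on_inverse:
  fixes f :: "'a::real_normed_vector \<Rightarrow> real"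
  shows "open S \<Longrightarrow> smooth_on S f \<Longrightarrow> (\<And>x. x \<in> S \<Longrightarrow> f x \<noteq> 0) \<Longrightarrow> smooth_on S (\<lambda>x. inverse (f x))"
  unfolding smooth_on_def using Ck_on_inverse by blast

lemma smooth_on_prod:
  fixes f :: "'j \<Rightarrow> 'a::real_normed_vector \<Rightarrow> real"
  assumes "open S" "\<And>i. i \<in> I \<Longrightarrow> smooth_on S (f i)"
  shows "smooth_on S (\<lambda>x. \<Prod>i\<in>I. f i x)"
  using assms(2)
  by (induction I rule: infinite_finite_induct)
    (auto intro: smooth_on_const smooth_on_mult[OF \<open>open S\<close>])

lemma smooth_on_Pair:
  assumes "open S" "smooth_on S f" "smooth_on S g"
  shows "smooth_on S (\<lambda>x. (f x, g x))"
proof -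
  have "bounded_linear (\<lambda>x. (x, 0))" "bounded_linear (\<lambda>y. (0, y))"
    by (auto intro!: bounded_linear_Pair bounded_linear_ident bounded_linear_zero)
  from this[THEN smooth_on_bounded_linear_compose, OF assms(1)]
  have "smooth_on S (\<lambda>x. (f x, 0) + (0, g x))"
    using assms by (intro smooth_on_add) blast+
  then show ?thesis by simp
qed

lemma smooth_on_has_derivative:
  "smooth_on S f \<Longrightarrow> x \<in> S \<Longrightarrow> (f has_derivative frechet_derivative f (at x)) (at x)"
  unfolding smooth_on_def using has_derivative_frechet by blast

lemma smooth_on_frechet_derivative_fixed:
  "smooth_on S f \<Longrightarrow> smooth_on S (\<lambda>x. frechet_derivative f (at x) v)"
  unfolding smooth_on_def using Ck_on.simps(2)[of _ S f] by blast

lemma smooth_on_frechet_derivative: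
  fixes f :: "'b::euclidean_space \<Rightarrow> 'c::real_normed_vector"
  assumes "open S" "smooth_on T f" "smooth_on S g" "smooth_on S h" "g ` S \<subseteq> T"
  shows "smooth_on S (\<lambda>x. frechet_derivative f (at (g x)) (h x))"
proof (rule smooth_on_cong[OF _ \<open>open S\<close>])
  show "smooth_on S (\<lambda>x. \<Sum>b\<in>Basis. (h x \<bullet> b) *\<^sub>R frechet_derivative f (at (g x)) b)"
  proof (rule smooth_on_sum[OF \<open>open S\<close>], rule smooth_on_scaleR[OF \<open>open S\<close>])
    fix b :: 'b
    show "smooth_on S (\<lambda>x. h x \<bullet> b)"
      using assms by (intro smooth_on_bounded_linear_compose[OF bounded_linear_inner_left])
    show "smooth_on S (\<lambda>x. frechet_derivative f (at (g x)) b)"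
      using assms(1,3) smooth_on_frechet_derivative_fixed[OF assms(2)] assms(5)
      by (rule smooth_on_compose)
  qed
  show "(\<Sum>b\<in>Basis. (h x \<bullet> b) *\<^sub>R frechet_derivative f (at (g x)) b)
      = frechet_derivative f (at (g x)) (h x)" if "x \<in> S" for x
    by (rule linear_euclidean_expansion[symmetric], rule has_derivative_linear,
        rule smooth_on_has_derivative[OF assms(2)]) (use assms(5) that in auto)
qed

text \<open>The map \<open>(x, v) \<mapsto> Df(x) v\<close> is smooth, so its derivative is the sum of the partial ones, and the
  partial derivative in \<open>v\<close> is \<open>Df(x)\<close> itself. Composing with \<open>x \<mapsto> (x, h x)\<close> gives every derivative
  of a coordinate expression \<open>Df(x) (h x)\<close> that occurs below.\<close>

lemma has_derivative_directional:
  fixes f :: "'a::euclidean_space \<Rightarrow> 'b::real_normed_vector"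
  assumes "open S" "smooth_on S f" "x \<in> S"
  shows "((\<lambda>z. frechet_derivative f (at (fst z)) (snd z)) has_derivative
    (\<lambda>z. frechet_derivative (\<lambda>y. frechet_derivative f (at y) v) (at x) (fst z)
        + frechet_derivative f (at x) (snd z))) (at (x, v))"
proof -
  let ?F = "\<lambda>z. frechet_derivative f (at (fst z)) (snd z)"
  let ?F' = "frechet_derivative ?F (at (x, v))"
  have "smooth_on (S \<times> UNIV) ?F"
    using assms(1) by (intro smooth_on_frechet_derivative[OF _ assms(2)] smooth_on_fst smooth_on_snd)
      (auto simp: open_Times)
  then have F: "(?F has_derivative ?F') (at (x, v))"
    by (rule smooth_on_has_derivative) (use assms(3) in simp)
  have "((\<lambda>y. (y, v)) has_derivative (\<lambda>u. (u, 0))) (at x)"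
    by (auto intro!: derivative_eq_intros)
  from has_derivative_compose[OF this F]
  have "((\<lambda>y. frechet_derivative f (at y) v) has_derivative (\<lambda>u. ?F' (u, 0))) (at x)"
    by simp
  from fun_cong[OF frechet_derivative_at[OF this]]
  have 1: "?F' (u, 0) = frechet_derivative (\<lambda>y. frechet_derivative f (at y) v) (at x) u" for u .
  have "((\<lambda>w. (x, w)) has_derivative (\<lambda>u. (0, u))) (at v)"
    by (auto intro!: derivative_eq_intros)
  from has_derivative_compose[OF this F]
  have "(frechet_derivative f (at x) has_derivative (\<lambda>u. ?F' (0, u))) (at v)"
    by simp
  moreover have "(frechet_derivative f (at x) has_derivative frechet_derivative f (at x)) (at v)"
    using smooth_on_has_derivative[OF assms(2,3)]
    by (simp add: has_derivative_bounded_linear bounded_linear_imp_has_derivative)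
  ultimately have 2: "?F' (0, u) = frechet_derivative f (at x) u" for u
    by (rule fun_cong[OF has_derivative_unique])
  have "?F' z = ?F' (fst z, 0) + ?F' (0, snd z)" for z
    using linear_add[OF has_derivative_linear[OF F], of "(fst z, 0)" "(0, snd z)"] by simp
  then have "?F' = (\<lambda>z. frechet_derivative (\<lambda>y. frechet_derivative f (at y) v) (at x) (fst z)
        + frechet_derivative f (at x) (snd z))"
    using 1 2 by auto
  then show ?thesis using F by simp
qed

text \<open>By Cramer's rule the solution of a regular linear system is a rational expression in the
  coefficients. This is the source of smoothness of everything that is defined by an equation
  below: the quasi-velocities and the forces of the second-order fields.\<close>

lemma smooth_on_det:
  fixes a :: "'n::finite \<Rightarrow> 'n \<Rightarrow> 'a::real_normed_vector \<Rightarrow> real"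
  assumes "open S" "\<And>i j. smooth_on S (a i j)"
  shows "smooth_on S (\<lambda>x. det (\<chi> i j. a i j x))"
  unfolding det_def using assms
  by (intro smooth_on_sum smooth_on_mult smooth_on_prod) (auto intro: smooth_on_const)

lemma smooth_on_linear_solution:
  fixes a :: "'n::finite \<Rightarrow> 'n \<Rightarrow> 'a::real_normed_vector \<Rightarrow> real"
  assumes "open S" and a: "\<And>i j. smooth_on S (a i j)" and b: "\<And>i. smooth_on S (b i)"
    and inv: "\<And>x. x \<in> S \<Longrightarrow> invertible (\<chi> i j. a i j x)"
    and sol: "\<And>x i. x \<in> S \<Longrightarrow> (\<Sum>j\<in>UNIV. a i j x * f j x) = b i x"
  shows "smooth_on S (f k)"
proof (rule smooth_on_cong[OF _ \<open>open S\<close>])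
  let ?c = "\<lambda>i j x. if j = k then b i x else a i j x"
  have "smooth_on S (?c i j)" for i j
    using a b by (cases "j = k") auto
  then show "smooth_on S (\<lambda>x. det (\<chi> i j. ?c i j x) * inverse (det (\<chi> i j. a i j x)))"
    using assms
    by (intro smooth_on_mult smooth_on_inverse smooth_on_det) (auto simp: invertible_det_nz)
  show "det (\<chi> i j. ?c i j x) * inverse (det (\<chi> i j. a i j x)) = f k x" if "x \<in> S" for x
  proof -
    have "(\<chi> i j. a i j x) *v (\<chi> j. f j x) = (\<chi> i. b i x)"
      using sol[OF that] by (simp add: matrix_vector_mult_def)
    moreover have "det (\<chi> i j. a i j x) \<noteq> 0"
      using inv[OF that] by (simp add: invertible_det_nz)
    ultimately have "(\<chi> j. f j x) = (\<chi> k. det (\<chi> i j. if j = k then (\<chi> i. b i x) $ i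
        else (\<chi> i j. a i j x) $ i $ j) / det (\<chi> i j. a i j x))"
      using cramer by blast
    then have "f k x = det (\<chi> i j. if j = k then (\<chi> i. b i x) $ i
        else (\<chi> i j. a i j x) $ i $ j) / det (\<chi> i j. a i j x)"
      by (metis (no_types, lifting) vec_lambda_beta)
    then show ?thesis by (simp add: divide_inverse cong: if_cong)
  qed
qed

text \<open>The second difference of \<open>f\<close> over a small parallelogram is symmetric in \<open>u\<close> and \<open>v\<close>. Two
  applications of the mean value theorem turn it into a value of one mixed derivative or, with the
  directions exchanged, of the other; letting the parallelogram shrink shows that they agree.\<close>

lemma second_difference_mean_value:
  fixes f :: "'a::real_normed_vector \<Rightarrow> real"
  assumes "smooth_on S f" "h > 0"
    and S: "\<And>s t. 0 \<le> s \<Longrightarrow> s \<le> h \<Longrightarrow> 0 \<le> t \<Longrightarrow> t \<le> h \<Longrightarrow> x + s *\<^sub>R u + t *\<^sub>R v \<in> S"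
  shows "\<exists>s t. 0 < s \<and> s < h \<and> 0 < t \<and> t < h \<and>
    f (x + h *\<^sub>R u + h *\<^sub>R v) - f (x + h *\<^sub>R u) - f (x + h *\<^sub>R v) + f x
      = h * (h * frechet_derivative (\<lambda>y. frechet_derivative f (at y) u) (at (x + s *\<^sub>R u + t *\<^sub>R v)) v)"
proof -
  define g where "g = (\<lambda>y. frechet_derivative f (at y) u)"
  have f: "(f has_derivative frechet_derivative f (at y)) (at y)" if "y \<in> S" for y
    using smooth_on_has_derivative[OF assms(1) that] .
  have g: "(g has_derivative frechet_derivative g (at y)) (at y)" if "y \<in> S" for y
    unfolding g_def
    using smooth_on_has_derivative[OF smooth_on_frechet_derivative_fixed[OF assms(1)] that] .
  have fs: "((\<lambda>s. f (x + s *\<^sub>R u + t *\<^sub>R v)) has_real_derivative g (x + s *\<^sub>R u + t *\<^sub>R v)) (at s)"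
    if "0 \<le> s" "s \<le> h" "0 \<le> t" "t \<le> h" for s t
  proof -
    have "((\<lambda>s. x + s *\<^sub>R u + t *\<^sub>R v) has_derivative (\<lambda>r. r *\<^sub>R u)) (at s)"
      by (auto intro!: derivative_eq_intros)
    from has_derivative_compose[OF this f[OF S[OF that]]]
    have "((\<lambda>s. f (x + s *\<^sub>R u + t *\<^sub>R v)) has_derivative
        (\<lambda>r. frechet_derivative f (at (x + s *\<^sub>R u + t *\<^sub>R v)) (r *\<^sub>R u))) (at s)" .
    then show ?thesis
      using linear_cmul[OF has_derivative_linear[OF f[OF S[OF that]]]]
      by (simp add: has_field_derivative_def g_def mult_commute_abs)
  qed
  have gt: "((\<lambda>t. g (x + s *\<^sub>R u + t *\<^sub>R v)) has_real_derivative
      frechet_derivative g (at (x + s *\<^sub>R u + t *\<^sub>R v)) v) (at t)"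
    if "0 \<le> s" "s \<le> h" "0 \<le> t" "t \<le> h" for s t
  proof -
    have "((\<lambda>t. x + s *\<^sub>R u + t *\<^sub>R v) has_derivative (\<lambda>r. r *\<^sub>R v)) (at t)"
      by (auto intro!: derivative_eq_intros)
    from has_derivative_compose[OF this g[OF S[OF that]]]
    have "((\<lambda>t. g (x + s *\<^sub>R u + t *\<^sub>R v)) has_derivative
        (\<lambda>r. frechet_derivative g (at (x + s *\<^sub>R u + t *\<^sub>R v)) (r *\<^sub>R v))) (at t)" .
    then show ?thesis
      using linear_cmul[OF has_derivative_linear[OF g[OF S[OF that]]]]
      by (simp add: has_field_derivative_def mult_commute_abs)
  qed
  have "\<exists>s. 0 < s \<and> s < h \<and>
      (f (x + h *\<^sub>R u + h *\<^sub>R v) - f (x + h *\<^sub>R u + 0 *\<^sub>R v))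
        - (f (x + 0 *\<^sub>R u + h *\<^sub>R v) - f (x + 0 *\<^sub>R u + 0 *\<^sub>R v))
      = (h - 0) * (g (x + s *\<^sub>R u + h *\<^sub>R v) - g (x + s *\<^sub>R u + 0 *\<^sub>R v))"
    using \<open>h > 0\<close>
    by (intro MVT2[where f = "\<lambda>s. f (x + s *\<^sub>R u + h *\<^sub>R v) - f (x + s *\<^sub>R u + 0 *\<^sub>R v)"]
        DERIV_diff fs) auto
  then obtain s where s: "0 < s" "s < h" and 1: "f (x + h *\<^sub>R u + h *\<^sub>R v) - f (x + h *\<^sub>R u)
        - f (x + h *\<^sub>R v) + f x = h * (g (x + s *\<^sub>R u + h *\<^sub>R v) - g (x + s *\<^sub>R u + 0 *\<^sub>R v))"
    by auto
  have "\<exists>t. 0 < t \<and> t < h \<and> g (x + s *\<^sub>R u + h *\<^sub>R v) - g (x + s *\<^sub>R u + 0 *\<^sub>R v)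
      = (h - 0) * frechet_derivative g (at (x + s *\<^sub>R u + t *\<^sub>R v)) v"
    using \<open>h > 0\<close> s by (intro MVT2 gt) auto
  then show ?thesis
    using s 1 unfolding g_def by auto
qed

lemma second_derivative_symmetric_real:
  fixes f :: "'a::real_normed_vector \<Rightarrow> real"
  assumes "open S" "smooth_on S f" "x \<in> S"
  shows "frechet_derivative (\<lambda>y. frechet_derivative f (at y) u) (at x) v
    = frechet_derivative (\<lambda>y. frechet_derivative f (at y) v) (at x) u"
proof (rule ccontr)
  define A where "A = (\<lambda>x. frechet_derivative (\<lambda>y. frechet_derivative f (at y) u) (at x) v)"
  define B where "B = (\<lambda>x. frechet_derivative (\<lambda>y. frechet_derivative f (at y) v) (at x) u)"
  assume "\<not> ?thesis"
  then have "A x \<noteq> B x" by (simp add: A_def B_def)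
  then have e: "\<bar>A x - B x\<bar> / 2 > 0" (is "?e > 0") by simp
  have "smooth_on S A" "smooth_on S B"
    unfolding A_def B_def using assms(2) by (intro smooth_on_frechet_derivative_fixed; simp)+
  then have "continuous_on S A" "continuous_on S B"
    unfolding smooth_on_def by (metis Ck_on.simps(1))+
  then have "isCont A x" "isCont B x"
    using assms(1,3) continuous_on_eq_continuous_at by blast+
  then obtain d1 d2 where "d1 > 0" "d2 > 0"
    and d: "\<And>y. dist y x < d1 \<Longrightarrow> dist (A y) (A x) < ?e" "\<And>y. dist y x < d2 \<Longrightarrow> dist (B y) (B x) < ?e"
    using e unfolding continuous_at_eps_delta by metis
  obtain d3 where "d3 > 0" and d3: "ball x d3 \<subseteq> S"
    using assms(1,3) open_contains_ball by blast
  define d where "d = min d1 (min d2 d3)"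
  define h where "h = d / (2 * (norm u + norm v + 1))"
  have d0: "d > 0" using \<open>d1 > 0\<close> \<open>d2 > 0\<close> \<open>d3 > 0\<close> by (simp add: d_def)
  have n: "norm u + norm v + 1 > 0"
    by (simp add: add_nonneg_pos)
  then have h: "h > 0" using d0 by (simp add: h_def)
  have "h * (norm u + norm v) < d"
  proof -
    have "h * (norm u + norm v) \<le> h * (norm u + norm v + 1)"
      using h by simp
    also have "\<dots> = d / 2"
      using n by (simp add: h_def nonzero_divide_eq_eq nonzero_eq_divide_eq)
    finally show ?thesis using d0 by simp
  qed
  then have near: "dist (x + s *\<^sub>R u + t *\<^sub>R v) x < d"
    if "0 \<le> s" "s \<le> h" "0 \<le> t" "t \<le> h" for s t
  proof -
    have "norm (s *\<^sub>R u + t *\<^sub>R v) \<le> s * norm u + t * norm v"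
      using norm_triangle_ineq[of "s *\<^sub>R u" "t *\<^sub>R v"] that by simp
    also have "\<dots> \<le> h * norm u + h * norm v"
      using that by (intro add_mono mult_right_mono) auto
    finally show ?thesis
      using \<open>h * (norm u + norm v) < d\<close> by (simp add: dist_norm algebra_simps)
  qed
  have S: "x + s *\<^sub>R u + t *\<^sub>R v \<in> S" if "0 \<le> s" "s \<le> h" "0 \<le> t" "t \<le> h" for s t
    using near[OF that] d3 by (auto simp: d_def dist_commute)
  obtain s t where st: "0 < s" "s < h" "0 < t" "t < h" and A: "f (x + h *\<^sub>R u + h *\<^sub>R v)
      - f (x + h *\<^sub>R u) - f (x + h *\<^sub>R v) + f x = h * (h * A (x + s *\<^sub>R u + t *\<^sub>R v))"
    using second_difference_mean_value[OF assms(2) h S] unfolding A_def by blast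
  have S': "x + s *\<^sub>R v + t *\<^sub>R u \<in> S" if "0 \<le> s" "s \<le> h" "0 \<le> t" "t \<le> h" for s t
    using S[OF that(3,4,1,2)] by (simp add: algebra_simps)
  obtain s' t' where st': "0 < s'" "s' < h" "0 < t'" "t' < h" and B: "f (x + h *\<^sub>R v + h *\<^sub>R u)
      - f (x + h *\<^sub>R v) - f (x + h *\<^sub>R u) + f x = h * (h * B (x + s' *\<^sub>R v + t' *\<^sub>R u))"
    using second_difference_mean_value[OF assms(2) h S'] unfolding B_def by blast
  have swap: "x + h *\<^sub>R v + h *\<^sub>R u = x + h *\<^sub>R u + h *\<^sub>R v" by simp
  have "h * (h * A (x + s *\<^sub>R u + t *\<^sub>R v)) = h * (h * B (x + s' *\<^sub>R v + t' *\<^sub>R u))"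
    using A B[unfolded swap] by linarith
  then have eq: "A (x + s *\<^sub>R u + t *\<^sub>R v) = B (x + s' *\<^sub>R v + t' *\<^sub>R u)"
    using h by simp
  have "dist (A (x + s *\<^sub>R u + t *\<^sub>R v)) (A x) < ?e"
    using near[of s t] st by (intro d(1)) (simp add: d_def)
  moreover have "dist (B (x + s' *\<^sub>R v + t' *\<^sub>R u)) (B x) < ?e"
    using near[of t' s'] st' by (intro d(2)) (simp add: d_def algebra_simps)
  ultimately show False
    unfolding eq dist_real_def by argo
qed

lemma second_derivative_symmetric:
  fixes f :: "'a::real_normed_vector \<Rightarrow> 'b::euclidean_space"
  assumes "open S" "smooth_on S f" "x \<in> S"
  shows "frechet_derivative (\<lambda>y. frechet_derivative f (at y) u) (at x) v
    = frechet_derivative (\<lambda>y. frechet_derivative f (at y) v) (at x) u"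
proof (rule euclidean_eqI)
  fix b :: 'b
  have first: "frechet_derivative (\<lambda>z. f z \<bullet> b) (at y) w = frechet_derivative f (at y) w \<bullet> b"
    if "y \<in> S" for y w
    using has_derivative_inner_left[OF smooth_on_has_derivative[OF assms(2) that]]
    by (metis frechet_derivative_at)
  have second: "frechet_derivative (\<lambda>y. frechet_derivative (\<lambda>z. f z \<bullet> b) (at y) w) (at x) w'
    = frechet_derivative (\<lambda>y. frechet_derivative f (at y) w) (at x) w' \<bullet> b" for w w'
  proof -
    have "((\<lambda>y. frechet_derivative f (at y) w \<bullet> b) has_derivative
        (\<lambda>w'. frechet_derivative (\<lambda>y. frechet_derivative f (at y) w) (at x) w' \<bullet> b)) (at x)"
      using has_derivative_inner_left[OF smooth_on_has_derivative[OF
            smooth_on_frechet_derivative_fixed[OF assms(2)] assms(3)]] .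
    then have "((\<lambda>y. frechet_derivative (\<lambda>z. f z \<bullet> b) (at y) w) has_derivative
        (\<lambda>w'. frechet_derivative (\<lambda>y. frechet_derivative f (at y) w) (at x) w' \<bullet> b)) (at x)"
      by (rule has_derivative_transform_within_open[OF _ assms(1,3)]) (simp add: first)
    then show ?thesis by (metis frechet_derivative_at)
  qed
  have "smooth_on S (\<lambda>z. f z \<bullet> b)"
    using smooth_on_bounded_linear_compose[OF bounded_linear_inner_left assms(1,2)] .
  from second_derivative_symmetric_real[OF assms(1) this assms(3), of u v]
  show "frechet_derivative (\<lambda>y. frechet_derivative f (at y) u) (at x) v \<bullet> b
    = frechet_derivative (\<lambda>y. frechet_derivative f (at y) v) (at x) u \<bullet> b"
    by (simp add: second)
qed

section \<open>Tangent vectors and smooth functions in charts\<close>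

locale smooth_atlas =
  fixes M :: "('p, 'i, 'e::euclidean_space) atlas"
  assumes chart_inj: "inj_on (chart M \<kappa>) (cdom M \<kappa>)"
    and open_overlap: "open (chart M \<kappa> ` (cdom M \<kappa> \<inter> cdom M \<kappa>'))"
    and smooth_transition:
      "smooth_on (chart M \<kappa> ` (cdom M \<kappa> \<inter> cdom M \<kappa>')) (chart M \<kappa>' \<circ> cinv M \<kappa>)"
begin

abbreviation cimage :: "'i \<Rightarrow> 'e set" where
  "cimage \<kappa> \<equiv> chart M \<kappa> ` cdom M \<kappa>"

abbreviation dtrans :: "'i \<Rightarrow> 'i \<Rightarrow> 'e \<Rightarrow> 'e \<Rightarrow> 'e" where
  "dtrans \<kappa> \<kappa>' x \<equiv> frechet_derivative (chart M \<kappa>' \<circ> cinv M \<kappa>) (at x)"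

lemma open_cimage: "open (cimage \<kappa>)"
  using open_overlap[of \<kappa> \<kappa>] by simp

lemma carrierI: "p \<in> cdom M \<kappa> \<Longrightarrow> p \<in> carrier M"
  unfolding carrier_def by auto

lemma carrierE: "p \<in> carrier M \<Longrightarrow> (\<And>\<kappa>. p \<in> cdom M \<kappa> \<Longrightarrow> thesis) \<Longrightarrow> thesis"
  unfolding carrier_def by auto

lemma carrier_Int_cdom [simp]: "carrier M \<inter> cdom M \<kappa> = cdom M \<kappa>"
  unfolding carrier_def by auto

lemma cinv_chart [simp]: "p \<in> cdom M \<kappa> \<Longrightarrow> cinv M \<kappa> (chart M \<kappa> p) = p"
  unfolding cinv_def using chart_inj by (rule inv_into_f_f)

lemma chart_cinv: "x \<in> cimage \<kappa> \<Longrightarrow> chart M \<kappa> (cinv M \<kappa> x) = x"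
  and cinv_cdom: "x \<in> cimage \<kappa> \<Longrightarrow> cinv M \<kappa> x \<in> cdom M \<kappa>"
  by auto

lemma has_derivative_transition:
  "p \<in> cdom M \<kappa> \<Longrightarrow> p \<in> cdom M \<kappa>' \<Longrightarrow>
    (chart M \<kappa>' \<circ> cinv M \<kappa> has_derivative dtrans \<kappa> \<kappa>' (chart M \<kappa> p)) (at (chart M \<kappa> p))"
  by (rule smooth_on_has_derivative[OF smooth_transition]) auto

text \<open>With a chart for \<open>f\<close> this is the cocycle property of the derivatives of the coordinate changes;
  with a function on the manifold it makes \<open>vec_app\<close> independent of the selected chart.\<close>

lemma frechet_derivative_change_chart:
  assumes "p \<in> cdom M \<kappa>" "p \<in> cdom M \<kappa>'"
    and "(f \<circ> cinv M \<kappa>' has_derivative F) (at (chart M \<kappa>' p))"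
  shows "(f \<circ> cinv M \<kappa> has_derivative (\<lambda>v. F (dtrans \<kappa> \<kappa>' (chart M \<kappa> p) v))) (at (chart M \<kappa> p))"
proof -
  have "(f \<circ> cinv M \<kappa>' has_derivative F) (at ((chart M \<kappa>' \<circ> cinv M \<kappa>) (chart M \<kappa> p)))"
    by (simp add: assms)
  from has_derivative_compose[OF has_derivative_transition[OF assms(1,2)] this]
  show ?thesis
    by (rule has_derivative_transform_within_open[OF _ open_overlap[of \<kappa> \<kappa>']])
      (use assms in auto)
qed

lemma dtrans_comp:
  assumes "p \<in> cdom M \<kappa>" "p \<in> cdom M \<kappa>'" "p \<in> cdom M \<kappa>''"
  shows "dtrans \<kappa> \<kappa>'' (chart M \<kappa> p) v = dtrans \<kappa>' \<kappa>'' (chart M \<kappa>' p) (dtrans \<kappa> \<kappa>' (chart M \<kappa> p) v)"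
  using fun_cong[OF frechet_derivative_at[OF frechet_derivative_change_chart[OF assms(1,2)
        has_derivative_transition[OF assms(2,3)]]], symmetric] .

lemma dtrans_same:
  assumes "p \<in> cdom M \<kappa>"
  shows "dtrans \<kappa> \<kappa> (chart M \<kappa> p) v = v"
proof -
  have "((\<lambda>x. x) has_derivative (\<lambda>v. v)) (at (chart M \<kappa> p))"
    by simp
  then have "(chart M \<kappa> \<circ> cinv M \<kappa> has_derivative (\<lambda>v. v)) (at (chart M \<kappa> p))"
    by (rule has_derivative_transform_within_open[OF _ open_cimage[of \<kappa>]]) (use assms in auto)
  from fun_cong[OF frechet_derivative_at[OF this], symmetric] show ?thesis .
qed

lemma linear_dtrans: "p \<in> cdom M \<kappa> \<Longrightarrow> p \<in> cdom M \<kappa>' \<Longrightarrow> linear (dtrans \<kappa> \<kappa>' (chart M \<kappa> p))"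
  using has_derivative_linear[OF has_derivative_transition] .

text \<open>The vector at \<open>p\<close> with component \<open>v\<close> in the chart \<open>\<kappa>\<close>; its transformation law is the cocycle
  property.\<close>

definition tangent_vector :: "'i \<Rightarrow> 'p \<Rightarrow> 'e \<Rightarrow> 'i \<Rightarrow> 'e" where
  "tangent_vector \<kappa> p v = (\<lambda>\<kappa>'. if p \<in> cdom M \<kappa>' then dtrans \<kappa> \<kappa>' (chart M \<kappa> p) v else 0)"

lemma tangent_vector_in_tangent_space:
  "p \<in> cdom M \<kappa> \<Longrightarrow> tangent_vector \<kappa> p v \<in> tangent_space M p"
  unfolding tangent_space_def tangent_vector_def
  by (simp add: dtrans_comp[of p \<kappa> _ _ v, symmetric])

lemma tangent_vector_component: "p \<in> cdom M \<kappa> \<Longrightarrow> tangent_vector \<kappa> p v \<kappa> = v"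
  by (simp add: tangent_vector_def dtrans_same)

lemma tangent_space_outside: "\<xi> \<in> tangent_space M p \<Longrightarrow> p \<notin> cdom M \<kappa> \<Longrightarrow> \<xi> \<kappa> = 0"
  by (simp add: tangent_space_def)

lemma tangent_space_transform:
  "\<xi> \<in> tangent_space M p \<Longrightarrow> p \<in> cdom M \<kappa> \<Longrightarrow> p \<in> cdom M \<kappa>' \<Longrightarrow>
    \<xi> \<kappa>' = dtrans \<kappa> \<kappa>' (chart M \<kappa> p) (\<xi> \<kappa>)"
  unfolding tangent_space_def by blast

lemma tangent_space_eqI:
  assumes "\<xi> \<in> tangent_space M p" "\<eta> \<in> tangent_space M p" "p \<in> cdom M \<kappa>" "\<xi> \<kappa> = \<eta> \<kappa>"
  shows "\<xi> = \<eta>"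
proof
  fix \<kappa>'
  show "\<xi> \<kappa>' = \<eta> \<kappa>'"
  proof (cases "p \<in> cdom M \<kappa>'")
    case True
    then show ?thesis
      using assms by (simp add: tangent_space_transform[of _ p \<kappa> \<kappa>'])
  next
    case False
    then show ?thesis
      using assms tangent_space_outside by metis
  qed
qed

lemma tangent_spaceI:
  assumes "\<And>\<kappa>. p \<notin> cdom M \<kappa> \<Longrightarrow> \<xi> \<kappa> = 0"
    and "\<And>\<kappa> \<kappa>'. p \<in> cdom M \<kappa> \<Longrightarrow> p \<in> cdom M \<kappa>' \<Longrightarrow> \<xi> \<kappa>' = dtrans \<kappa> \<kappa>' (chart M \<kappa> p) (\<xi> \<kappa>)"
  shows "\<xi> \<in> tangent_space M p"
  unfolding tangent_space_def using assms by blast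

lemma tangent_space_zero: "(\<lambda>\<kappa>. 0) \<in> tangent_space M p"
  by (rule tangent_spaceI) (simp_all add: linear_0[OF linear_dtrans])

lemma tangent_space_add:
  assumes "\<xi> \<in> tangent_space M p" "\<eta> \<in> tangent_space M p"
  shows "(\<lambda>\<kappa>. \<xi> \<kappa> + \<eta> \<kappa>) \<in> tangent_space M p"
  by (rule tangent_spaceI)
    (simp_all add: linear_add[OF linear_dtrans] tangent_space_outside[OF assms(1)]
      tangent_space_outside[OF assms(2)] tangent_space_transform[OF assms(1), symmetric]
      tangent_space_transform[OF assms(2), symmetric])

lemma tangent_space_scaleR:
  assumes "\<xi> \<in> tangent_space M p"
  shows "(\<lambda>\<kappa>. c *\<^sub>R \<xi> \<kappa>) \<in> tangent_space M p"
  by (rule tangent_spaceI)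
    (simp_all add: linear_cmul[OF linear_dtrans] tangent_space_outside[OF assms]
      tangent_space_transform[OF assms, symmetric])

lemma tangent_space_sum:
  "(\<And>j. j \<in> J \<Longrightarrow> \<xi> j \<in> tangent_space M p) \<Longrightarrow> (\<lambda>\<kappa>. \<Sum>j\<in>J. \<xi> j \<kappa>) \<in> tangent_space M p"
  by (induction J rule: infinite_finite_induct) (auto intro: tangent_space_zero tangent_space_add)

lemma lincomb_in_tangent_space:
  "(\<And>j. j \<in> J \<Longrightarrow> b j \<in> tangent_space M p) \<Longrightarrow> lincomb J c b \<in> tangent_space M p"
  unfolding lincomb_def by (intro tangent_space_sum tangent_space_scaleR)

lemma vec_app_chart:
  assumes "p \<in> cdom M \<kappa>" "\<xi> \<in> tangent_space M p"
    and f: "(f \<circ> cinv M \<kappa> has_derivative F) (at (chart M \<kappa> p))"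
  shows "vec_app M p \<xi> f = F (\<xi> \<kappa>)"
proof -
  define \<kappa>0 where "\<kappa>0 = (SOME \<kappa>. p \<in> cdom M \<kappa>)"
  have p: "p \<in> cdom M \<kappa>0"
    unfolding \<kappa>0_def using assms(1) by (rule someI)
  have "vec_app M p \<xi> f = frechet_derivative (f \<circ> cinv M \<kappa>0) (at (chart M \<kappa>0 p)) (\<xi> \<kappa>0)"
    by (simp add: vec_app_def \<kappa>0_def Let_def)
  also have "\<dots> = F (dtrans \<kappa>0 \<kappa> (chart M \<kappa>0 p) (\<xi> \<kappa>0))"
    by (simp only: frechet_derivative_at[OF frechet_derivative_change_chart[OF p assms(1) f], symmetric])
  finally show ?thesis
    by (simp only: tangent_space_transform[OF assms(2) p assms(1), symmetric])
qed

lemma smooth_fun_iff: "smooth_fun M f \<longleftrightarrow> (\<forall>\<kappa>. smooth_on (cimage \<kappa>) (\<lambda>x. f (cinv M \<kappa> x)))"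
  by (simp add: smooth_fun_on_def comp_def)

lemma smooth_fun_has_derivative:
  "smooth_fun M f \<Longrightarrow> p \<in> cdom M \<kappa> \<Longrightarrow>
    (f \<circ> cinv M \<kappa> has_derivative frechet_derivative (f \<circ> cinv M \<kappa>) (at (chart M \<kappa> p))) (at (chart M \<kappa> p))"
  by (rule smooth_on_has_derivative[of "cimage \<kappa>"]) (auto simp: smooth_fun_iff comp_def)

lemma smooth_fun_const: "smooth_fun M (\<lambda>p. c)"
  by (simp add: smooth_fun_iff smooth_on_const)

lemma smooth_fun_diff: "smooth_fun M f \<Longrightarrow> smooth_fun M g \<Longrightarrow> smooth_fun M (\<lambda>p. f p - g p)"
  by (simp add: smooth_fun_iff smooth_on_diff open_cimage)

lemma smooth_fun_cong:
  assumes "smooth_fun M f" "\<And>p. p \<in> carrier M \<Longrightarrow> f p = g p"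
  shows "smooth_fun M g"
  unfolding smooth_fun_iff
proof
  fix \<kappa>
  have "smooth_on (cimage \<kappa>) (\<lambda>x. f (cinv M \<kappa> x))"
    using assms(1) by (simp add: smooth_fun_iff)
  then show "smooth_on (cimage \<kappa>) (\<lambda>x. g (cinv M \<kappa> x))"
    by (rule smooth_on_cong[OF _ open_cimage]) (rule assms(2), auto intro: carrierI)
qed

lemma smooth_fun_linear_solution:
  fixes a :: "'n::finite \<Rightarrow> 'n \<Rightarrow> 'p \<Rightarrow> real"
  assumes "\<And>i j. smooth_fun M (a i j)" "\<And>i. smooth_fun M (b i)"
    and "\<And>p. p \<in> carrier M \<Longrightarrow> invertible (\<chi> i j. a i j p)"
    and "\<And>p i. p \<in> carrier M \<Longrightarrow> (\<Sum>j\<in>UNIV. a i j p * f j p) = b i p"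
  shows "smooth_fun M (f k)"
  unfolding smooth_fun_iff
proof
  fix \<kappa>
  show "smooth_on (cimage \<kappa>) (\<lambda>x. f k (cinv M \<kappa> x))"
    using assms
    by (intro smooth_on_linear_solution[where a = "\<lambda>i j x. a i j (cinv M \<kappa> x)"
          and b = "\<lambda>i x. b i (cinv M \<kappa> x)" and f = "\<lambda>i x. f i (cinv M \<kappa> x)"])
      (auto simp: smooth_fun_iff open_cimage carrierI)
qed

text \<open>Solutions chosen point by point are automatically smooth.\<close>

lemma smooth_fun_solve:
  fixes a :: "'n::finite \<Rightarrow> 'n \<Rightarrow> 'p \<Rightarrow> real"
  assumes "\<And>i j. smooth_fun M (a i j)" "\<And>i. smooth_fun M (b i)"
    and inv: "\<And>p. p \<in> carrier M \<Longrightarrow> invertible (\<chi> i j. a i j p)"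
  obtains f where "\<And>k. smooth_fun M (f k)"
    and "\<And>p i. p \<in> carrier M \<Longrightarrow> (\<Sum>j\<in>UNIV. a i j p * f j p) = b i p"
proof -
  have "\<exists>y. (\<chi> i j. a i j p) *v y = (\<chi> i. b i p)" if p: "p \<in> carrier M" for p
  proof -
    obtain B where "(\<chi> i j. a i j p) ** B = mat 1"
      using inv[OF p] unfolding invertible_def by blast
    then have "(\<chi> i j. a i j p) *v (B *v (\<chi> i. b i p)) = (\<chi> i. b i p)"
      by (simp add: matrix_vector_mul_assoc)
    then show ?thesis by blast
  qed
  then obtain y where y: "\<And>p. p \<in> carrier M \<Longrightarrow> (\<chi> i j. a i j p) *v y p = (\<chi> i. b i p)"
    by metis
  define f where "f j p = y p $ j" for j p
  have sol: "(\<Sum>j\<in>UNIV. a i j p * f j p) = b i p" if "p \<in> carrier M" for p i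
    using arg_cong[OF y[OF that], of "\<lambda>v. v $ i"] by (simp add: f_def matrix_vector_mult_def)
  then have "smooth_fun M (f k)" for k
    using smooth_fun_linear_solution[OF assms sol] by blast
  then show thesis using that sol by blast
qed

lemma linear_vec_app:
  assumes p: "p \<in> carrier M" and f: "smooth_fun M f"
  shows vec_app_add: "\<xi> \<in> tangent_space M p \<Longrightarrow> \<eta> \<in> tangent_space M p \<Longrightarrow>
      vec_app M p (\<lambda>\<kappa>. \<xi> \<kappa> + \<eta> \<kappa>) f = vec_app M p \<xi> f + vec_app M p \<eta> f"
    and vec_app_lincomb: "(\<And>j. j \<in> J \<Longrightarrow> b j \<in> tangent_space M p) \<Longrightarrow>
      vec_app M p (lincomb J c b) f = (\<Sum>j\<in>J. c j * vec_app M p (b j) f)"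
proof -
  obtain \<kappa> where \<kappa>: "p \<in> cdom M \<kappa>" using p by (rule carrierE)
  let ?D = "frechet_derivative (f \<circ> cinv M \<kappa>) (at (chart M \<kappa> p))"
  note D = smooth_fun_has_derivative[OF f \<kappa>]
  note lin = has_derivative_linear[OF D]
  note app = vec_app_chart[OF \<kappa> _ D]
  show "vec_app M p (\<lambda>\<kappa>. \<xi> \<kappa> + \<eta> \<kappa>) f = vec_app M p \<xi> f + vec_app M p \<eta> f"
    if "\<xi> \<in> tangent_space M p" "\<eta> \<in> tangent_space M p"
    using that by (simp add: app tangent_space_add linear_add[OF lin])
  show "vec_app M p (lincomb J c b) f = (\<Sum>j\<in>J. c j * vec_app M p (b j) f)"
    if b: "\<And>j. j \<in> J \<Longrightarrow> b j \<in> tangent_space M p"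
  proof -
    have "vec_app M p (lincomb J c b) f = ?D (lincomb J c b \<kappa>)"
      by (rule app[OF lincomb_in_tangent_space[OF b]])
    also have "\<dots> = (\<Sum>j\<in>J. c j * ?D (b j \<kappa>))"
      by (simp add: lincomb_def linear_sum[OF lin] linear_cmul[OF lin])
    also have "\<dots> = (\<Sum>j\<in>J. c j * vec_app M p (b j) f)"
      by (rule sum.cong) (simp_all add: app b)
    finally show ?thesis .
  qed
qed

lemma openin_carrier: "openin (mtopology M) (carrier M)"
  by (simp add: openin_mtopology[OF chart_inj] open_cimage)

lemma vector_fieldsD:
  assumes "Z \<in> vector_fields M"
  shows "p \<in> carrier M \<Longrightarrow> Z p \<in> tangent_space M p"
    and "smooth_on (cimage \<kappa>) (\<lambda>x. Z (cinv M \<kappa> x) \<kappa>)"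
    and "p \<notin> carrier M \<Longrightarrow> Z p = (\<lambda>\<kappa>. 0)"
  using assms unfolding vector_fields_def smooth_field_on_def by auto

lemma vector_fieldsI:
  assumes "\<And>p. p \<in> carrier M \<Longrightarrow> Z p \<in> tangent_space M p"
    and "\<And>\<kappa>. smooth_on (cimage \<kappa>) (\<lambda>x. Z (cinv M \<kappa> x) \<kappa>)"
    and "\<And>p. p \<notin> carrier M \<Longrightarrow> Z p = (\<lambda>\<kappa>. 0)"
  shows "Z \<in> vector_fields M"
  using assms unfolding vector_fields_def smooth_field_on_def by auto

lemma vf_app_chart:
  assumes "Z \<in> vector_fields M" "smooth_fun M f" "x \<in> cimage \<kappa>"
  shows "vf_app M Z f (cinv M \<kappa> x) = frechet_derivative (f \<circ> cinv M \<kappa>) (at x) (Z (cinv M \<kappa> x) \<kappa>)"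
  unfolding vf_app_def
  using vec_app_chart[OF cinv_cdom[OF assms(3)] _ smooth_fun_has_derivative[OF assms(2) cinv_cdom[OF assms(3)]]]
    vector_fieldsD(1)[OF assms(1) carrierI[OF cinv_cdom[OF assms(3)]]] chart_cinv[OF assms(3)]
  by simp

lemma smooth_fun_vf_app:
  assumes "Z \<in> vector_fields M" "smooth_fun M f"
  shows "smooth_fun M (vf_app M Z f)"
  unfolding smooth_fun_iff
proof
  fix \<kappa>
  have "smooth_on (cimage \<kappa>)
      (\<lambda>x. frechet_derivative (f \<circ> cinv M \<kappa>) (at x) (Z (cinv M \<kappa> x) \<kappa>))"
    using assms by (intro smooth_on_frechet_derivative[where T = "cimage \<kappa>"])
      (auto simp: smooth_fun_iff comp_def open_cimage vector_fieldsD(2)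
        intro: smooth_on_bounded_linear[OF bounded_linear_ident])
  then show "smooth_on (cimage \<kappa>) (\<lambda>x. vf_app M Z f (cinv M \<kappa> x))"
    by (rule smooth_on_cong[OF _ open_cimage]) (simp add: vf_app_chart[OF assms])
qed

end

lemma smooth_manifold_imp_smooth_atlas: "smooth_manifold M \<Longrightarrow> smooth_atlas M"
  unfolding smooth_manifold_def smooth_atlas_def by blast

section \<open>The tangent bundle and the lifts\<close>

context smooth_atlas
begin

lemma cdom_tangent_bundle: "w \<in> cdom (tangent_bundle M) \<kappa> \<longleftrightarrow>
    fst w \<in> cdom M \<kappa> \<and> snd w \<in> tangent_space M (fst w)"
  by (cases w) (simp add: tangent_bundle_def)

lemma chart_tangent_bundle:
  "chart (tangent_bundle M) \<kappa> w = (chart M \<kappa> (fst w), snd w \<kappa>)"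
  by (cases w) (simp add: tangent_bundle_def)

lemma chart_tangent_bundle_inj:
  "inj_on (chart (tangent_bundle M) \<kappa>) (cdom (tangent_bundle M) \<kappa>)"
proof (rule inj_onI)
  fix w w' assume w: "w \<in> cdom (tangent_bundle M) \<kappa>" "w' \<in> cdom (tangent_bundle M) \<kappa>"
    and eq: "chart (tangent_bundle M) \<kappa> w = chart (tangent_bundle M) \<kappa> w'"
  have "fst w = fst w'"
    using w eq inj_onD[OF chart_inj] by (auto simp: cdom_tangent_bundle chart_tangent_bundle)
  moreover have "snd w = snd w'"
    using w eq calculation
    by (intro tangent_space_eqI[of _ "fst w" _ \<kappa>]) (auto simp: cdom_tangent_bundle chart_tangent_bundle)
  ultimately show "w = w'" by (simp add: prod_eq_iff)
qed

text \<open>In the induced charts the fibre coordinate ranges over the whole model space, because every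
  vector of it is the component of some tangent vector.\<close>

lemma tangent_bundle_overlap_image:
  "chart (tangent_bundle M) \<kappa> ` (cdom (tangent_bundle M) \<kappa> \<inter> cdom (tangent_bundle M) \<kappa>')
    = chart M \<kappa> ` (cdom M \<kappa> \<inter> cdom M \<kappa>') \<times> UNIV" (is "?l = ?r")
proof
  show "?l \<subseteq> ?r"
    by (auto simp: cdom_tangent_bundle chart_tangent_bundle)
  show "?r \<subseteq> ?l"
  proof (clarify)
    fix p v assume "p \<in> cdom M \<kappa>" "p \<in> cdom M \<kappa>'"
    then show "(chart M \<kappa> p, v) \<in> ?l"
      by (intro image_eqI[of _ _ "(p, tangent_vector \<kappa> p v)"])
        (auto simp: cdom_tangent_bundle chart_tangent_bundle tangent_vector_component
          tangent_vector_in_tangent_space)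
  qed
qed

lemma cinv_tangent_bundle:
  assumes "x \<in> cimage \<kappa>"
  shows "cinv (tangent_bundle M) \<kappa> (x, v) = (cinv M \<kappa> x, tangent_vector \<kappa> (cinv M \<kappa> x) v)"
  unfolding cinv_def[of "tangent_bundle M"]
proof (rule inv_into_f_eq[OF chart_tangent_bundle_inj])
  note x = cinv_cdom[OF assms]
  show "(cinv M \<kappa> x, tangent_vector \<kappa> (cinv M \<kappa> x) v) \<in> cdom (tangent_bundle M) \<kappa>"
    using x by (simp add: cdom_tangent_bundle tangent_vector_in_tangent_space)
  show "chart (tangent_bundle M) \<kappa> (cinv M \<kappa> x, tangent_vector \<kappa> (cinv M \<kappa> x) v) = (x, v)"
    using x by (simp add: chart_tangent_bundle tangent_vector_component chart_cinv[OF assms])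
qed

lemma tangent_bundle_transition:
  assumes "x \<in> chart M \<kappa> ` (cdom M \<kappa> \<inter> cdom M \<kappa>')"
  shows "(chart (tangent_bundle M) \<kappa>' \<circ> cinv (tangent_bundle M) \<kappa>) (x, v)
    = ((chart M \<kappa>' \<circ> cinv M \<kappa>) x, dtrans \<kappa> \<kappa>' x v)"
proof -
  obtain p where p: "p \<in> cdom M \<kappa>" "p \<in> cdom M \<kappa>'" "x = chart M \<kappa> p"
    using assms by auto
  then have "x \<in> cimage \<kappa>" by simp
  from cinv_tangent_bundle[OF this] show ?thesis
    by (simp add: chart_tangent_bundle p tangent_vector_def)
qed

lemma smooth_atlas_tangent_bundle: "smooth_atlas (tangent_bundle M)"
proof
  fix \<kappa> \<kappa>'
  let ?S = "chart M \<kappa> ` (cdom M \<kappa> \<inter> cdom M \<kappa>') \<times> (UNIV :: 'e set)"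
  show "inj_on (chart (tangent_bundle M) \<kappa>) (cdom (tangent_bundle M) \<kappa>)"
    by (rule chart_tangent_bundle_inj)
  have S: "open ?S"
    by (intro open_Times open_overlap open_UNIV)
  then show "open (chart (tangent_bundle M) \<kappa> ` (cdom (tangent_bundle M) \<kappa> \<inter> cdom (tangent_bundle M) \<kappa>'))"
    by (simp only: tangent_bundle_overlap_image)
  have "smooth_on ?S (\<lambda>z. ((chart M \<kappa>' \<circ> cinv M \<kappa>) (fst z), dtrans \<kappa> \<kappa>' (fst z) (snd z)))"
  proof (rule smooth_on_Pair[OF S])
    show "smooth_on ?S (\<lambda>z. (chart M \<kappa>' \<circ> cinv M \<kappa>) (fst z))"
      by (rule smooth_on_compose[OF S smooth_on_fst[OF S] smooth_transition]) auto
    show "smooth_on ?S (\<lambda>z. dtrans \<kappa> \<kappa>' (fst z) (snd z))"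
      by (rule smooth_on_frechet_derivative[OF S smooth_transition smooth_on_fst[OF S]
            smooth_on_snd[OF S]]) auto
  qed
  then have "smooth_on ?S (chart (tangent_bundle M) \<kappa>' \<circ> cinv (tangent_bundle M) \<kappa>)"
  proof (rule smooth_on_cong[OF _ S])
    fix z assume "z \<in> ?S"
    then show "((chart M \<kappa>' \<circ> cinv M \<kappa>) (fst z), dtrans \<kappa> \<kappa>' (fst z) (snd z))
        = (chart (tangent_bundle M) \<kappa>' \<circ> cinv (tangent_bundle M) \<kappa>) z"
      using tangent_bundle_transition[of "fst z" \<kappa> \<kappa>' "snd z"] by (simp add: mem_Times_iff)
  qed
  then show "smooth_on (chart (tangent_bundle M) \<kappa> `
      (cdom (tangent_bundle M) \<kappa> \<inter> cdom (tangent_bundle M) \<kappa>'))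
      (chart (tangent_bundle M) \<kappa>' \<circ> cinv (tangent_bundle M) \<kappa>)"
    by (simp only: tangent_bundle_overlap_image)
qed

end

locale tangent_atlas = smooth_atlas Q
  for Q :: "('p, 'i, 'e::euclidean_space) atlas"

sublocale tangent_atlas \<subseteq> TQ: smooth_atlas "tangent_bundle Q"
  by (rule smooth_atlas_tangent_bundle)

context tangent_atlas
begin

lemma carrier_tangent_bundle: "w \<in> carrier (tangent_bundle Q) \<longleftrightarrow>
    fst w \<in> carrier Q \<and> snd w \<in> tangent_space Q (fst w)"
  unfolding carrier_def by (auto simp: cdom_tangent_bundle)

lemma cimage_tangent_bundle: "TQ.cimage \<kappa> = cimage \<kappa> \<times> UNIV"
  using tangent_bundle_overlap_image[of \<kappa> \<kappa>] by simp

lemma dtrans_tangent_bundle: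
  assumes q: "q \<in> cdom Q \<kappa>" "q \<in> cdom Q \<kappa>'"
  shows "TQ.dtrans \<kappa> \<kappa>' (chart Q \<kappa> q, v) z =
    (dtrans \<kappa> \<kappa>' (chart Q \<kappa> q) (fst z),
     frechet_derivative (\<lambda>x. dtrans \<kappa> \<kappa>' x v) (at (chart Q \<kappa> q)) (fst z)
       + dtrans \<kappa> \<kappa>' (chart Q \<kappa> q) (snd z))"
proof -
  let ?U = "chart Q \<kappa> ` (cdom Q \<kappa> \<inter> cdom Q \<kappa>')"
  let ?x = "chart Q \<kappa> q"
  have x: "?x \<in> ?U" using q by simp
  have "((chart Q \<kappa>' \<circ> cinv Q \<kappa>) has_derivative dtrans \<kappa> \<kappa>' ?x) (at (fst (?x, v)))"
    using has_derivative_transition[OF q] by simp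
  from has_derivative_compose[OF has_derivative_fst[OF has_derivative_ident] this]
  have "((\<lambda>z. (chart Q \<kappa>' \<circ> cinv Q \<kappa>) (fst z)) has_derivative (\<lambda>z. dtrans \<kappa> \<kappa>' ?x (fst z))) (at (?x, v))"
    by simp
  from has_derivative_Pair[OF this has_derivative_directional[OF open_overlap smooth_transition x]]
  have "(chart (tangent_bundle Q) \<kappa>' \<circ> cinv (tangent_bundle Q) \<kappa> has_derivative
      (\<lambda>z. (dtrans \<kappa> \<kappa>' ?x (fst z),
        frechet_derivative (\<lambda>x. dtrans \<kappa> \<kappa>' x v) (at ?x) (fst z) + dtrans \<kappa> \<kappa>' ?x (snd z)))) (at (?x, v))"
  proof (rule has_derivative_transform_within_open)
    show "open (?U \<times> (UNIV :: 'e set))"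
      by (intro open_Times open_overlap open_UNIV)
    show "(?x, v) \<in> ?U \<times> UNIV" using x by simp
    fix z :: "'e \<times> 'e" assume "z \<in> ?U \<times> UNIV"
    then show "((chart Q \<kappa>' \<circ> cinv Q \<kappa>) (fst z), dtrans \<kappa> \<kappa>' (fst z) (snd z))
        = (chart (tangent_bundle Q) \<kappa>' \<circ> cinv (tangent_bundle Q) \<kappa>) z"
      using tangent_bundle_transition[of "fst z" \<kappa> \<kappa>' "snd z"] by (simp add: mem_Times_iff)
  qed
  from fun_cong[OF frechet_derivative_at[OF this], symmetric] show ?thesis .
qed

lemma vlift_along_outside: "w \<notin> carrier (tangent_bundle Q) \<Longrightarrow> vlift_along Q X w = (\<lambda>\<kappa>. 0)"
  using TQ.carrierI[of w] unfolding vlift_along_def by (intro ext) auto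

lemma clift_outside: "w \<notin> carrier (tangent_bundle Q) \<Longrightarrow> clift Q X w = (\<lambda>\<kappa>. 0)"
  using TQ.carrierI[of w] unfolding clift_def by (intro ext) (auto simp: case_prod_beta)

lemma vlift_along_in_tangent_space:
  assumes w: "w \<in> carrier (tangent_bundle Q)" and X: "X w \<in> tangent_space Q (fst w)"
  shows "vlift_along Q X w \<in> tangent_space (tangent_bundle Q) w"
proof (rule TQ.tangent_spaceI)
  fix \<kappa> \<kappa>'
  assume *: "w \<in> cdom (tangent_bundle Q) \<kappa>" "w \<in> cdom (tangent_bundle Q) \<kappa>'"
  then have q: "fst w \<in> cdom Q \<kappa>" "fst w \<in> cdom Q \<kappa>'"
    by (simp_all add: cdom_tangent_bundle)
  have "linear (frechet_derivative (\<lambda>x. dtrans \<kappa> \<kappa>' x (snd w \<kappa>)) (at (chart Q \<kappa> (fst w))))"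
    by (rule has_derivative_linear[OF smooth_on_has_derivative[OF
            smooth_on_frechet_derivative_fixed[OF smooth_transition]]]) (use q in simp)
  then show "vlift_along Q X w \<kappa>'
      = TQ.dtrans \<kappa> \<kappa>' (chart (tangent_bundle Q) \<kappa> w) (vlift_along Q X w \<kappa>)"
    using * tangent_space_transform[OF X q, symmetric]
    by (simp add: vlift_along_def chart_tangent_bundle dtrans_tangent_bundle[OF q]
        linear_0[OF linear_dtrans[OF q]] linear_0)
qed (simp add: vlift_along_def)

text \<open>The second component of the complete lift transforms correctly because the second derivative
  of a coordinate change is symmetric: differentiating \<open>X' (\<phi> x) = D\<phi>(x) (X x)\<close> in the direction
  \<open>v\<close> produces \<open>D\<^sup>2\<phi>(v, X)\<close>, whereas the transition of the tangent bundle contributes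
  \<open>D\<^sup>2\<phi>(X, v)\<close>.\<close>

lemma clift_in_tangent_space:
  assumes w: "w \<in> carrier (tangent_bundle Q)" and X: "X \<in> vector_fields Q"
  shows "clift Q X w \<in> tangent_space (tangent_bundle Q) w"
proof (rule TQ.tangent_spaceI)
  fix \<kappa>
  assume "w \<notin> cdom (tangent_bundle Q) \<kappa>"
  then show "clift Q X w \<kappa> = 0" by (cases w) (simp add: clift_def)
next
  fix \<kappa> \<kappa>'
  assume *: "w \<in> cdom (tangent_bundle Q) \<kappa>" "w \<in> cdom (tangent_bundle Q) \<kappa>'"
  obtain q \<xi> where w_eq: "w = (q, \<xi>)" by (cases w)
  have q: "q \<in> cdom Q \<kappa>" "q \<in> cdom Q \<kappa>'" and \<xi>: "\<xi> \<in> tangent_space Q q"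
    using * by (simp_all add: w_eq cdom_tangent_bundle)
  let ?U = "chart Q \<kappa> ` (cdom Q \<kappa> \<inter> cdom Q \<kappa>')"
  let ?x = "chart Q \<kappa> q"
  let ?X = "\<lambda>\<kappa> x. X (cinv Q \<kappa> x) \<kappa>"
  let ?D = "\<lambda>\<kappa>. frechet_derivative (?X \<kappa>) (at (chart Q \<kappa> q))"
  have x: "?x \<in> ?U" using q by simp
  have DX: "(?X \<kappa> has_derivative ?D \<kappa>) (at (chart Q \<kappa> q))" if "q \<in> cdom Q \<kappa>" for \<kappa>
    by (rule smooth_on_has_derivative[OF vector_fieldsD(2)[OF X]]) (use that in simp)
  have "((\<lambda>x. (x, ?X \<kappa> x)) has_derivative (\<lambda>u. (u, ?D \<kappa> u))) (at ?x)"
    by (rule has_derivative_Pair[OF has_derivative_ident DX[OF q(1)]])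
  from has_derivative_compose[OF this has_derivative_directional[OF open_overlap smooth_transition x]]
  have "((\<lambda>x. dtrans \<kappa> \<kappa>' x (?X \<kappa> x)) has_derivative
      (\<lambda>u. frechet_derivative (\<lambda>y. dtrans \<kappa> \<kappa>' y (?X \<kappa> ?x)) (at ?x) u
         + dtrans \<kappa> \<kappa>' ?x (?D \<kappa> u))) (at ?x)"
    by simp
  then have "((\<lambda>x. ?X \<kappa>' ((chart Q \<kappa>' \<circ> cinv Q \<kappa>) x)) has_derivative
      (\<lambda>u. frechet_derivative (\<lambda>y. dtrans \<kappa> \<kappa>' y (?X \<kappa> ?x)) (at ?x) u
         + dtrans \<kappa> \<kappa>' ?x (?D \<kappa> u))) (at ?x)"
  proof (rule has_derivative_transform_within_open[OF _ open_overlap x])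
    fix y assume "y \<in> ?U"
    then obtain p where p: "p \<in> cdom Q \<kappa>" "p \<in> cdom Q \<kappa>'" "y = chart Q \<kappa> p" by auto
    show "dtrans \<kappa> \<kappa>' y (?X \<kappa> y) = ?X \<kappa>' ((chart Q \<kappa>' \<circ> cinv Q \<kappa>) y)"
      using tangent_space_transform[OF vector_fieldsD(1)[OF X carrierI[OF p(1)]] p(1,2), symmetric]
      by (simp add: p)
  qed
  moreover have "(?X \<kappa>' has_derivative ?D \<kappa>') (at ((chart Q \<kappa>' \<circ> cinv Q \<kappa>) ?x))"
    using DX[OF q(2)] q by simp
  note has_derivative_compose[OF has_derivative_transition[OF q] this]
  ultimately have chain: "?D \<kappa>' (dtrans \<kappa> \<kappa>' ?x u)
      = frechet_derivative (\<lambda>y. dtrans \<kappa> \<kappa>' y (?X \<kappa> ?x)) (at ?x) u + dtrans \<kappa> \<kappa>' ?x (?D \<kappa> u)" for u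
    by (rule fun_cong[OF has_derivative_unique, rotated])
  have "?D \<kappa>' (\<xi> \<kappa>') = frechet_derivative (\<lambda>y. dtrans \<kappa> \<kappa>' y (\<xi> \<kappa>)) (at ?x) (X q \<kappa>)
      + dtrans \<kappa> \<kappa>' ?x (?D \<kappa> (\<xi> \<kappa>))"
    using chain[of "\<xi> \<kappa>"] q
      second_derivative_symmetric[OF open_overlap smooth_transition x, of "\<xi> \<kappa>" "X q \<kappa>"]
    by (simp add: tangent_space_transform[OF \<xi> q, symmetric])
  then show "clift Q X w \<kappa>' = TQ.dtrans \<kappa> \<kappa>' (chart (tangent_bundle Q) \<kappa> w) (clift Q X w \<kappa>)"
    using * tangent_space_transform[OF vector_fieldsD(1)[OF X carrierI[OF q(1)]] q, symmetric]
    by (simp add: clift_def w_eq chart_tangent_bundle dtrans_tangent_bundle[OF q])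
qed

lemma fst_cinv_tangent_bundle: "z \<in> TQ.cimage \<kappa> \<Longrightarrow> fst (cinv (tangent_bundle Q) \<kappa> z) = cinv Q \<kappa> (fst z)"
  and snd_cinv_tangent_bundle: "z \<in> TQ.cimage \<kappa> \<Longrightarrow> snd (cinv (tangent_bundle Q) \<kappa> z) \<kappa> = snd z"
  by (auto simp: cimage_tangent_bundle cinv_tangent_bundle tangent_vector_component cinv_cdom)

lemma vlift_along_chart:
  "z \<in> TQ.cimage \<kappa> \<Longrightarrow> vlift_along Q X (cinv (tangent_bundle Q) \<kappa> z) \<kappa>
    = (0, X (cinv (tangent_bundle Q) \<kappa> z) \<kappa>)"
  using TQ.cinv_cdom by (simp add: vlift_along_def)

lemma vlift_chart:
  "z \<in> TQ.cimage \<kappa> \<Longrightarrow> vlift Q X (cinv (tangent_bundle Q) \<kappa> z) \<kappa> = (0, X (cinv Q \<kappa> (fst z)) \<kappa>)"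
  by (simp add: vlift_def vlift_along_chart fst_cinv_tangent_bundle)

lemma clift_chart:
  assumes "z \<in> TQ.cimage \<kappa>"
  shows "clift Q X (cinv (tangent_bundle Q) \<kappa> z) \<kappa>
    = (X (cinv Q \<kappa> (fst z)) \<kappa>, frechet_derivative (\<lambda>x. X (cinv Q \<kappa> x) \<kappa>) (at (fst z)) (snd z))"
proof -
  have "fst z \<in> cimage \<kappa>"
    using assms by (auto simp: cimage_tangent_bundle)
  then show ?thesis
    using TQ.cinv_cdom[OF assms] fst_cinv_tangent_bundle[OF assms] snd_cinv_tangent_bundle[OF assms]
    by (simp add: clift_def case_prod_beta chart_cinv cdom_tangent_bundle)
qed

lemma vlift_along_vector_field:
  assumes "X \<in> fields_along_tau Q"
  shows "vlift_along Q X \<in> vector_fields (tangent_bundle Q)"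
proof (rule TQ.vector_fieldsI)
  show "vlift_along Q X w \<in> tangent_space (tangent_bundle Q) w"
    if "w \<in> carrier (tangent_bundle Q)" for w
    using assms that by (intro vlift_along_in_tangent_space) (auto simp: fields_along_tau_def)
  fix \<kappa>
  have "smooth_on (TQ.cimage \<kappa>) (\<lambda>z. (0, X (cinv (tangent_bundle Q) \<kappa> z) \<kappa>))"
    using assms by (intro smooth_on_Pair TQ.open_cimage smooth_on_const) (simp add: fields_along_tau_def)
  then show "smooth_on (TQ.cimage \<kappa>) (\<lambda>z. vlift_along Q X (cinv (tangent_bundle Q) \<kappa> z) \<kappa>)"
    by (rule smooth_on_cong[OF _ TQ.open_cimage]) (simp only: vlift_along_chart)
qed (rule vlift_along_outside)

lemma smooth_on_base_field:
  assumes "X \<in> vector_fields Q"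
  shows "smooth_on (TQ.cimage \<kappa>) (\<lambda>z. X (cinv Q \<kappa> (fst z)) \<kappa>)"
  by (rule smooth_on_compose[OF TQ.open_cimage smooth_on_fst[OF TQ.open_cimage] vector_fieldsD(2)[OF assms]])
    (auto simp: cimage_tangent_bundle)

lemma base_field_along_tau:
  assumes "X \<in> vector_fields Q"
  shows "X \<circ> fst \<in> fields_along_tau Q"
proof -
  have "smooth_on (TQ.cimage \<kappa>) (\<lambda>z. (X \<circ> fst) (cinv (tangent_bundle Q) \<kappa> z) \<kappa>)" for \<kappa>
    by (rule smooth_on_cong[OF smooth_on_base_field[OF assms] TQ.open_cimage])
      (simp add: fst_cinv_tangent_bundle)
  then show ?thesis
    using vector_fieldsD(1)[OF assms] by (simp add: fields_along_tau_def carrier_tangent_bundle)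
qed

lemma vlift_vector_field: "X \<in> vector_fields Q \<Longrightarrow> vlift Q X \<in> vector_fields (tangent_bundle Q)"
  unfolding vlift_def by (rule vlift_along_vector_field[OF base_field_along_tau])

lemma clift_vector_field:
  assumes "X \<in> vector_fields Q"
  shows "clift Q X \<in> vector_fields (tangent_bundle Q)"
proof (rule TQ.vector_fieldsI)
  fix \<kappa>
  have "smooth_on (TQ.cimage \<kappa>)
      (\<lambda>z. frechet_derivative (\<lambda>x. X (cinv Q \<kappa> x) \<kappa>) (at (fst z)) (snd z))"
    by (rule smooth_on_frechet_derivative[OF TQ.open_cimage vector_fieldsD(2)[OF assms]
          smooth_on_fst[OF TQ.open_cimage] smooth_on_snd[OF TQ.open_cimage]])
      (auto simp: cimage_tangent_bundle)
  from smooth_on_Pair[OF TQ.open_cimage smooth_on_base_field[OF assms] this]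
  show "smooth_on (TQ.cimage \<kappa>) (\<lambda>z. clift Q X (cinv (tangent_bundle Q) \<kappa> z) \<kappa>)"
    by (rule smooth_on_cong[OF _ TQ.open_cimage]) (simp only: clift_chart)
qed (auto intro: clift_in_tangent_space[OF _ assms] simp: clift_outside)

end

section \<open>Frames, quasi-velocities and second-order fields\<close>

locale framed_manifold = tangent_atlas Q
  for Q :: "('p, 'i, real^'n) atlas" +
  fixes X :: "'n \<Rightarrow> 'p \<Rightarrow> 'i \<Rightarrow> real^'n"
  assumes frame: "frame Q X"
begin

abbreviation qv :: "'n \<Rightarrow> 'p \<times> ('i \<Rightarrow> real^'n) \<Rightarrow> real" where
  "qv \<equiv> quasi_velocity X"

lemma frame_vector_field: "X \<alpha> \<in> vector_fields Q"
  using frame by (simp add: frame_def)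

lemma frame_tangent: "q \<in> carrier Q \<Longrightarrow> X \<alpha> q \<in> tangent_space Q q"
  using vector_fieldsD(1)[OF frame_vector_field] .

lemma frame_unique:
  "q \<in> carrier Q \<Longrightarrow> \<xi> \<in> tangent_space Q q \<Longrightarrow> \<exists>!c. \<xi> = lincomb UNIV c (\<lambda>\<alpha>. X \<alpha> q)"
  using frame by (simp add: frame_def)

lemma frame_expansion:
  "q \<in> carrier Q \<Longrightarrow> \<xi> \<in> tangent_space Q q \<Longrightarrow>
    lincomb UNIV (frame_coeff X q \<xi>) (\<lambda>\<alpha>. X \<alpha> q) = \<xi>"
  unfolding frame_coeff_def using theI'[OF frame_unique] by simp

lemma frame_coeff_lincomb:
  assumes "q \<in> carrier Q"
  shows "frame_coeff X q (lincomb UNIV c (\<lambda>\<alpha>. X \<alpha> q)) = c"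
  unfolding frame_coeff_def
  using frame_unique[OF assms lincomb_in_tangent_space, of UNIV "\<lambda>\<alpha>. X \<alpha> q" c] frame_tangent[OF assms]
  by (intro the1_equality) auto

lemma lincomb_subset:
  fixes J :: "'n set"
  shows "lincomb J c b = lincomb UNIV (\<lambda>\<alpha>. if \<alpha> \<in> J then c \<alpha> else 0) b"
proof
  fix \<kappa>
  have "(\<Sum>\<alpha>\<in>J. c \<alpha> *\<^sub>R b \<alpha> \<kappa>) = (\<Sum>\<alpha>\<in>UNIV. (if \<alpha> \<in> J then c \<alpha> else 0) *\<^sub>R b \<alpha> \<kappa>)"
    by (rule sum.mono_neutral_cong_left) auto
  then show "lincomb J c b \<kappa> = lincomb UNIV (\<lambda>\<alpha>. if \<alpha> \<in> J then c \<alpha> else 0) b \<kappa>"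
    by (simp add: lincomb_def)
qed

lemma frame_independent_chart:
  assumes q: "q \<in> cdom Q \<kappa>"
    and eq: "(\<Sum>\<alpha>\<in>UNIV. c \<alpha> *\<^sub>R X \<alpha> q \<kappa>) = (\<Sum>\<alpha>\<in>UNIV. d \<alpha> *\<^sub>R X \<alpha> q \<kappa>)"
  shows "c = d"
proof -
  note q' = carrierI[OF q]
  have "lincomb UNIV c (\<lambda>\<alpha>. X \<alpha> q) = lincomb UNIV d (\<lambda>\<alpha>. X \<alpha> q)"
    using eq
    by (intro tangent_space_eqI[OF lincomb_in_tangent_space lincomb_in_tangent_space q] frame_tangent[OF q'])
      (simp add: lincomb_def)
  from arg_cong[OF this, of "frame_coeff X q"] show ?thesis
    by (simp only: frame_coeff_lincomb[OF q'])
qed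

lemma frame_matrix_invertible:
  assumes q: "q \<in> cdom Q \<kappa>"
  shows "invertible (\<chi> i \<alpha>. X \<alpha> q \<kappa> $ i)"
proof -
  have "\<exists>c. (\<chi> i \<alpha>. X \<alpha> q \<kappa> $ i) *v c = y" for y
  proof
    let ?\<xi> = "tangent_vector \<kappa> q y"
    have "lincomb UNIV (frame_coeff X q ?\<xi>) (\<lambda>\<alpha>. X \<alpha> q) \<kappa> = ?\<xi> \<kappa>"
      using frame_expansion[OF carrierI[OF q] tangent_vector_in_tangent_space[OF q]] by simp
    then have "(\<Sum>\<alpha>\<in>UNIV. frame_coeff X q ?\<xi> \<alpha> *\<^sub>R X \<alpha> q \<kappa>) $ i = y $ i" for i
      by (simp add: lincomb_def tangent_vector_component[OF q])
    then show "(\<chi> i \<alpha>. X \<alpha> q \<kappa> $ i) *v (\<chi> \<alpha>. frame_coeff X q ?\<xi> \<alpha>) = y"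
      by (simp add: vec_eq_iff matrix_vector_mult_def mult.commute)
  qed
  then show ?thesis
    unfolding invertible_right_inverse matrix_right_invertible_surjective surj_def by metis
qed

lemma velocity_expansion:
  assumes "w \<in> cdom (tangent_bundle Q) \<kappa>"
  shows "snd w \<kappa> = (\<Sum>\<alpha>\<in>UNIV. qv \<alpha> w *\<^sub>R X \<alpha> (fst w) \<kappa>)"
proof -
  have "fst w \<in> carrier Q" "snd w \<in> tangent_space Q (fst w)"
    using assms by (auto simp: cdom_tangent_bundle intro: carrierI)
  then have "lincomb UNIV (frame_coeff X (fst w) (snd w)) (\<lambda>\<alpha>. X \<alpha> (fst w)) \<kappa> = snd w \<kappa>"
    by (simp only: frame_expansion)
  then show ?thesis by (simp add: lincomb_def quasi_velocity_def)
qed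

lemma velocity_expansion_chart:
  assumes "z \<in> TQ.cimage \<kappa>"
  shows "snd z = (\<Sum>\<alpha>\<in>UNIV. qv \<alpha> (cinv (tangent_bundle Q) \<kappa> z) *\<^sub>R X \<alpha> (cinv Q \<kappa> (fst z)) \<kappa>)"
  using velocity_expansion[OF TQ.cinv_cdom[OF assms]]
  by (simp add: fst_cinv_tangent_bundle[OF assms] snd_cinv_tangent_bundle[OF assms])

lemma smooth_quasi_velocity: "smooth_fun (tangent_bundle Q) (qv \<alpha>)"
  unfolding TQ.smooth_fun_iff
proof
  fix \<kappa>
  let ?v = "\<lambda>\<alpha> z. qv \<alpha> (cinv (tangent_bundle Q) \<kappa> z)"
  let ?a = "\<lambda>i \<alpha> z. X \<alpha> (cinv Q \<kappa> (fst z)) \<kappa> $ i"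
  note op = TQ.open_cimage[of \<kappa>]
  show "smooth_on (TQ.cimage \<kappa>) (?v \<alpha>)"
  proof (rule smooth_on_linear_solution[OF op, where a = ?a and b = "\<lambda>i z. snd z $ i" and f = ?v])
    show "smooth_on (TQ.cimage \<kappa>) (?a i j)" for i j
      by (rule smooth_on_bounded_linear_compose[OF bounded_linear_vec_nth op
            smooth_on_base_field[OF frame_vector_field]])
    show "smooth_on (TQ.cimage \<kappa>) (\<lambda>z. snd z $ i)" for i
      by (rule smooth_on_bounded_linear_compose[OF bounded_linear_vec_nth op smooth_on_snd[OF op]])
    show "invertible (\<chi> i j. ?a i j z)" if "z \<in> TQ.cimage \<kappa>" for z
      by (rule frame_matrix_invertible) (use that in \<open>auto simp: cimage_tangent_bundle cinv_cdom\<close>)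
    show "(\<Sum>j\<in>UNIV. ?a i j z * ?v j z) = snd z $ i" if "z \<in> TQ.cimage \<kappa>" for z i
      using arg_cong[OF velocity_expansion_chart[OF that], of "\<lambda>v. v $ i"] by (simp add: mult.commute)
  qed
qed

text \<open>Obtained by differentiating \<open>v = v\<^sup>\<gamma> X\<^sub>\<gamma>\<close> along a tangent vector of the tangent bundle. For a
  second-order field the terms with derivatives of the \<open>X\<^sub>\<gamma>\<close> are exactly the ones that the complete
  lifts contribute to the left-hand side; what is left identifies the derivative of \<open>v\<^sup>\<gamma>\<close> with the
  force \<open>F\<^sup>\<gamma>\<close>.\<close>

lemma derivative_velocity_expansion:
  assumes w: "w \<in> cdom (tangent_bundle Q) \<kappa>" and \<zeta>: "\<zeta> \<in> tangent_space (tangent_bundle Q) w"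
  shows "snd (\<zeta> \<kappa>) = (\<Sum>\<gamma>\<in>UNIV.
      qv \<gamma> w *\<^sub>R frechet_derivative (\<lambda>x. X \<gamma> (cinv Q \<kappa> x) \<kappa>) (at (chart Q \<kappa> (fst w))) (fst (\<zeta> \<kappa>))
      + vec_app (tangent_bundle Q) w \<zeta> (qv \<gamma>) *\<^sub>R X \<gamma> (fst w) \<kappa>)"
proof -
  let ?z = "chart (tangent_bundle Q) \<kappa> w"
  let ?v = "\<lambda>\<gamma>. qv \<gamma> \<circ> cinv (tangent_bundle Q) \<kappa>"
  let ?X = "\<lambda>\<gamma> x. X \<gamma> (cinv Q \<kappa> x) \<kappa>"
  have z: "?z \<in> TQ.cimage \<kappa>" using w by simp
  have fz: "fst ?z = chart Q \<kappa> (fst w)" by (simp add: chart_tangent_bundle)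
  have q: "fst w \<in> cdom Q \<kappa>" using w by (simp add: cdom_tangent_bundle)
  have v: "(?v \<gamma> has_derivative frechet_derivative (?v \<gamma>) (at ?z)) (at ?z)" for \<gamma>
    by (rule TQ.smooth_fun_has_derivative[OF smooth_quasi_velocity w])
  have "(?X \<gamma> has_derivative frechet_derivative (?X \<gamma>) (at (fst ?z))) (at (fst ?z))" for \<gamma>
    unfolding fz by (rule smooth_on_has_derivative[OF vector_fieldsD(2)[OF frame_vector_field]]) (use q in simp)
  from has_derivative_compose[OF has_derivative_fst[OF has_derivative_ident] this]
  have X: "((\<lambda>z. ?X \<gamma> (fst z)) has_derivative
      (\<lambda>h. frechet_derivative (?X \<gamma>) (at (fst ?z)) (fst h))) (at ?z)" for \<gamma> .
  have "((\<lambda>z. \<Sum>\<gamma>\<in>UNIV. ?v \<gamma> z *\<^sub>R ?X \<gamma> (fst z)) has_derivative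
      (\<lambda>h. \<Sum>\<gamma>\<in>UNIV. ?v \<gamma> ?z *\<^sub>R frechet_derivative (?X \<gamma>) (at (fst ?z)) (fst h)
        + frechet_derivative (?v \<gamma>) (at ?z) h *\<^sub>R ?X \<gamma> (fst ?z))) (at ?z)"
    by (intro has_derivative_sum has_derivative_scaleR v X)
  then have "(snd has_derivative
      (\<lambda>h. \<Sum>\<gamma>\<in>UNIV. ?v \<gamma> ?z *\<^sub>R frechet_derivative (?X \<gamma>) (at (fst ?z)) (fst h)
        + frechet_derivative (?v \<gamma>) (at ?z) h *\<^sub>R ?X \<gamma> (fst ?z))) (at ?z)"
    by (rule has_derivative_transform_within_open[OF _ TQ.open_cimage z])
      (simp add: velocity_expansion_chart[symmetric])
  from fun_cong[OF has_derivative_unique[OF has_derivative_snd[OF has_derivative_ident] this]]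
  have "snd (\<zeta> \<kappa>) = (\<Sum>\<gamma>\<in>UNIV. ?v \<gamma> ?z *\<^sub>R frechet_derivative (?X \<gamma>) (at (fst ?z)) (fst (\<zeta> \<kappa>))
        + frechet_derivative (?v \<gamma>) (at ?z) (\<zeta> \<kappa>) *\<^sub>R ?X \<gamma> (fst ?z))" .
  then show ?thesis
    using w q by (simp add: fz TQ.vec_app_chart[OF w \<zeta> v])
qed

definition second_order_field ::
  "('n \<Rightarrow> 'p \<times> ('i \<Rightarrow> real^'n) \<Rightarrow> real) \<Rightarrow> 'p \<times> ('i \<Rightarrow> real^'n) \<Rightarrow> 'i \<Rightarrow> (real^'n) \<times> (real^'n)" where
  "second_order_field F = (\<lambda>w \<kappa>. \<Sum>\<alpha>\<in>UNIV. qv \<alpha> w *\<^sub>R clift Q (X \<alpha>) w \<kappa> + F \<alpha> w *\<^sub>R vlift Q (X \<alpha>) w \<kappa>)"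

lemma vlift_tangent: "w \<in> carrier (tangent_bundle Q) \<Longrightarrow> vlift Q (X \<alpha>) w \<in> tangent_space (tangent_bundle Q) w"
  using TQ.vector_fieldsD(1)[OF vlift_vector_field[OF frame_vector_field]] .

lemma clift_tangent: "w \<in> carrier (tangent_bundle Q) \<Longrightarrow> clift Q (X \<alpha>) w \<in> tangent_space (tangent_bundle Q) w"
  using TQ.vector_fieldsD(1)[OF clift_vector_field[OF frame_vector_field]] .

lemma second_order_field_tangent:
  "w \<in> carrier (tangent_bundle Q) \<Longrightarrow> second_order_field F w \<in> tangent_space (tangent_bundle Q) w"
  unfolding second_order_field_def
  by (intro TQ.tangent_space_sum TQ.tangent_space_add TQ.tangent_space_scaleR vlift_tangent clift_tangent)

lemma second_order_field_cong:
  "(\<And>\<alpha>. F \<alpha> w = F' \<alpha> w) \<Longrightarrow> second_order_field F w = second_order_field F' w"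
  by (simp add: second_order_field_def)

lemma second_order_field_outside:
  "w \<notin> carrier (tangent_bundle Q) \<Longrightarrow> second_order_field F w = (\<lambda>\<kappa>. 0)"
  by (simp add: second_order_field_def clift_outside vlift_def vlift_along_outside)

lemma second_order_field_component:
  assumes w: "w \<in> cdom (tangent_bundle Q) \<kappa>"
  shows "second_order_field F w \<kappa> = (snd w \<kappa>, \<Sum>\<alpha>\<in>UNIV.
      qv \<alpha> w *\<^sub>R frechet_derivative (\<lambda>x. X \<alpha> (cinv Q \<kappa> x) \<kappa>) (at (chart Q \<kappa> (fst w))) (snd w \<kappa>)
      + F \<alpha> w *\<^sub>R X \<alpha> (fst w) \<kappa>)"
  using w
  by (simp add: second_order_field_def vlift_def vlift_along_def clift_def case_prod_beta
      prod_eq_iff fst_sum snd_sum velocity_expansion[OF w])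

lemma quasi_velocity_second_order_field:
  assumes w: "w \<in> carrier (tangent_bundle Q)"
  shows "vec_app (tangent_bundle Q) w (second_order_field F w) (qv \<gamma>) = F \<gamma> w"
proof -
  obtain \<kappa> where \<kappa>: "w \<in> cdom (tangent_bundle Q) \<kappa>" using w by (rule TQ.carrierE)
  then have q: "fst w \<in> cdom Q \<kappa>" by (simp add: cdom_tangent_bundle)
  have "(\<lambda>\<gamma>. vec_app (tangent_bundle Q) w (second_order_field F w) (qv \<gamma>)) = (\<lambda>\<gamma>. F \<gamma> w)"
    using derivative_velocity_expansion[OF \<kappa> second_order_field_tangent[OF w, of F]]
    by (intro frame_independent_chart[OF q])
      (simp add: second_order_field_component[OF \<kappa>] sum.distrib)
  then show ?thesis by (rule fun_cong)
qed

lemma quasi_velocity_vlift_along: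
  assumes w: "w \<in> carrier (tangent_bundle Q)" and Z: "Z w \<in> tangent_space Q (fst w)"
  shows "vec_app (tangent_bundle Q) w (vlift_along Q Z w) (qv \<gamma>) = frame_coeff X (fst w) (Z w) \<gamma>"
proof -
  obtain \<kappa> where \<kappa>: "w \<in> cdom (tangent_bundle Q) \<kappa>" using w by (rule TQ.carrierE)
  then have q: "fst w \<in> cdom Q \<kappa>" by (simp add: cdom_tangent_bundle)
  have D: "frechet_derivative (\<lambda>x. X \<gamma> (cinv Q \<kappa> x) \<kappa>) (at (chart Q \<kappa> (fst w))) 0 = 0" for \<gamma>
    by (rule linear_0[OF has_derivative_linear[OF smooth_on_has_derivative[OF
              vector_fieldsD(2)[OF frame_vector_field]]]]) (use q in simp)
  have "lincomb UNIV (frame_coeff X (fst w) (Z w)) (\<lambda>\<alpha>. X \<alpha> (fst w)) \<kappa> = Z w \<kappa>"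
    using frame_expansion[OF carrierI[OF q] Z] by simp
  then have "(\<lambda>\<gamma>. vec_app (tangent_bundle Q) w (vlift_along Q Z w) (qv \<gamma>)) = frame_coeff X (fst w) (Z w)"
    using derivative_velocity_expansion[OF \<kappa> vlift_along_in_tangent_space[of w Z, OF w Z]]
    by (intro frame_independent_chart[OF q]) (simp add: vlift_along_def \<kappa> D lincomb_def)
  then show ?thesis by (rule fun_cong)
qed

lemma second_order_field_vector_field:
  assumes F: "\<And>\<alpha>. smooth_fun (tangent_bundle Q) (F \<alpha>)"
  shows "second_order_field F \<in> vector_fields (tangent_bundle Q)"
proof (rule TQ.vector_fieldsI[OF second_order_field_tangent _ second_order_field_outside])
  fix \<kappa>
  have "smooth_on (TQ.cimage \<kappa>) (\<lambda>z. f (cinv (tangent_bundle Q) \<kappa> z))"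
    if "smooth_fun (tangent_bundle Q) f" for f
    using that by (simp add: TQ.smooth_fun_iff)
  then show "smooth_on (TQ.cimage \<kappa>) (\<lambda>z. second_order_field F (cinv (tangent_bundle Q) \<kappa> z) \<kappa>)"
    unfolding second_order_field_def
    using TQ.vector_fieldsD(2)[OF vlift_vector_field[OF frame_vector_field]]
      TQ.vector_fieldsD(2)[OF clift_vector_field[OF frame_vector_field]]
    by (intro smooth_on_sum[OF TQ.open_cimage] smooth_on_add[OF TQ.open_cimage]
        smooth_on_scaleR[OF TQ.open_cimage]) (simp_all add: F smooth_quasi_velocity)
qed

lemma sode_iff:
  "sode Q X \<Gamma> \<longleftrightarrow> (\<exists>F. (\<forall>\<alpha>. smooth_fun (tangent_bundle Q) (F \<alpha>)) \<and> \<Gamma> = second_order_field F)"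
proof
  assume "sode Q X \<Gamma>"
  then obtain F where \<Gamma>: "\<Gamma> \<in> vector_fields (tangent_bundle Q)"
    and F: "\<forall>\<alpha>. smooth_fun (tangent_bundle Q) (F \<alpha>)"
    and eq: "\<And>w \<kappa>. w \<in> carrier (tangent_bundle Q) \<Longrightarrow> \<Gamma> w \<kappa> = second_order_field F w \<kappa>"
    unfolding sode_def second_order_field_def by blast
  have "\<Gamma> w = second_order_field F w" for w
    using TQ.vector_fieldsD(3)[OF \<Gamma>, of w] second_order_field_outside[of w F] eq[of w] by fastforce
  then show "\<exists>F. (\<forall>\<alpha>. smooth_fun (tangent_bundle Q) (F \<alpha>)) \<and> \<Gamma> = second_order_field F"
    using F by blast
next
  assume "\<exists>F. (\<forall>\<alpha>. smooth_fun (tangent_bundle Q) (F \<alpha>)) \<and> \<Gamma> = second_order_field F"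
  then show "sode Q X \<Gamma>"
    using second_order_field_vector_field unfolding sode_def second_order_field_def by blast
qed

end

section \<open>The Euler-Lagrange operator\<close>

locale lagrangian_manifold = framed_manifold Q X
  for Q :: "('p, 'i, real^'n) atlas" and X :: "'n \<Rightarrow> 'p \<Rightarrow> 'i \<Rightarrow> real^'n" +
  fixes L :: "'p \<times> ('i \<Rightarrow> real^'n) \<Rightarrow> real"
  assumes smooth_L: "smooth_fun (tangent_bundle Q) L"
begin

abbreviation G :: "'p \<times> ('i \<Rightarrow> real^'n) \<Rightarrow> 'n \<Rightarrow> 'n \<Rightarrow> real" where
  "G \<equiv> hessian_matrix Q X L"

abbreviation momentum :: "('p \<Rightarrow> 'i \<Rightarrow> real^'n) \<Rightarrow> 'p \<times> ('i \<Rightarrow> real^'n) \<Rightarrow> real" where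
  "momentum Y \<equiv> vf_app (tangent_bundle Q) (vlift Q Y) L"

definition euler_lagrange ::
  "('p \<times> ('i \<Rightarrow> real^'n) \<Rightarrow> 'i \<Rightarrow> (real^'n) \<times> (real^'n)) \<Rightarrow> ('p \<Rightarrow> 'i \<Rightarrow> real^'n) \<Rightarrow>
    'p \<times> ('i \<Rightarrow> real^'n) \<Rightarrow> real" where
  "euler_lagrange \<Gamma> Y w =
     vf_app (tangent_bundle Q) \<Gamma> (momentum Y) w - vf_app (tangent_bundle Q) (clift Q Y) L w"

text \<open>The right-hand sides \<open>r\<^sub>\<beta>\<close> of the force equations \<open>F\<^sup>\<alpha> g\<^sub>\<alpha>\<^sub>\<beta> = r\<^sub>\<beta>\<close>, read off from the second-order
  field with vanishing forces.\<close>

definition lagrangian_force :: "'n \<Rightarrow> 'p \<times> ('i \<Rightarrow> real^'n) \<Rightarrow> real" where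
  "lagrangian_force \<beta> w = - euler_lagrange (second_order_field (\<lambda>\<alpha> w. 0)) (X \<beta>) w"

abbreviation chart_L :: "'i \<Rightarrow> (real^'n) \<times> (real^'n) \<Rightarrow> real" where
  "chart_L \<kappa> \<equiv> L \<circ> cinv (tangent_bundle Q) \<kappa>"

abbreviation chart_second_derivative ::
  "'i \<Rightarrow> (real^'n) \<times> (real^'n) \<Rightarrow> (real^'n) \<times> (real^'n) \<Rightarrow> (real^'n) \<times> (real^'n) \<Rightarrow> real" where
  "chart_second_derivative \<kappa> z a b \<equiv>
     frechet_derivative (\<lambda>z. frechet_derivative (chart_L \<kappa>) (at z) b) (at z) a"

lemma smooth_momentum: "Y \<in> vector_fields Q \<Longrightarrow> smooth_fun (tangent_bundle Q) (momentum Y)"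
  by (rule TQ.smooth_fun_vf_app[OF vlift_vector_field smooth_L])

lemma smooth_hessian_matrix: "smooth_fun (tangent_bundle Q) (\<lambda>w. G w \<alpha> \<beta>)"
  unfolding hessian_matrix_def
  by (rule TQ.smooth_fun_vf_app[OF vlift_vector_field smooth_momentum]) (rule frame_vector_field)+

lemma smooth_lagrangian_force: "smooth_fun (tangent_bundle Q) (lagrangian_force \<beta>)"
proof -
  have "smooth_fun (tangent_bundle Q) (\<lambda>w. vf_app (tangent_bundle Q) (clift Q (X \<beta>)) L w
      - vf_app (tangent_bundle Q) (second_order_field (\<lambda>\<alpha> w. 0)) (momentum (X \<beta>)) w)"
    by (intro TQ.smooth_fun_diff TQ.smooth_fun_vf_app clift_vector_field frame_vector_field smooth_L
        second_order_field_vector_field smooth_momentum TQ.smooth_fun_const)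
  then show ?thesis
    by (rule TQ.smooth_fun_cong) (simp add: lagrangian_force_def euler_lagrange_def)
qed

lemma smooth_chart_L: "smooth_on (TQ.cimage \<kappa>) (chart_L \<kappa>)"
  using smooth_L by (simp add: TQ.smooth_fun_iff comp_def)

lemma linear_chart_L:
  "z \<in> TQ.cimage \<kappa> \<Longrightarrow> linear (frechet_derivative (chart_L \<kappa>) (at z))"
  by (rule has_derivative_linear[OF smooth_on_has_derivative[OF smooth_chart_L]])

text \<open>Linearity in the direction \<open>b\<close> of the inner derivative follows from linearity in the direction \<open>a\<close>
  of the outer one by symmetry.\<close>

lemma chart_second_derivative_linear:
  assumes "z \<in> TQ.cimage \<kappa>"
  shows "linear (\<lambda>a. chart_second_derivative \<kappa> z a b)" and "linear (chart_second_derivative \<kappa> z a)"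
proof -
  show 1: "linear (\<lambda>a. chart_second_derivative \<kappa> z a b)" for b
    by (rule has_derivative_linear[OF smooth_on_has_derivative[OF
            smooth_on_frechet_derivative_fixed[OF smooth_chart_L] assms]])
  have "chart_second_derivative \<kappa> z a = (\<lambda>b. chart_second_derivative \<kappa> z b a)"
    using second_derivative_symmetric[OF TQ.open_cimage smooth_chart_L assms] by (intro ext)
  then show "linear (chart_second_derivative \<kappa> z a)"
    using 1[of a] by simp
qed

lemma momentum_chart:
  assumes "Y \<in> vector_fields Q" "z \<in> TQ.cimage \<kappa>"
  shows "momentum Y (cinv (tangent_bundle Q) \<kappa> z)
    = frechet_derivative (chart_L \<kappa>) (at z) (0, Y (cinv Q \<kappa> (fst z)) \<kappa>)"
  using TQ.vf_app_chart[OF vlift_vector_field[OF assms(1)] smooth_L assms(2)]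
  by (simp add: vlift_chart[OF assms(2)])

lemma vec_app_momentum:
  assumes w: "w \<in> cdom (tangent_bundle Q) \<kappa>" and \<zeta>: "\<zeta> \<in> tangent_space (tangent_bundle Q) w"
    and Y: "Y \<in> vector_fields Q"
  shows "vec_app (tangent_bundle Q) w \<zeta> (momentum Y)
    = chart_second_derivative \<kappa> (chart (tangent_bundle Q) \<kappa> w) (\<zeta> \<kappa>) (0, Y (fst w) \<kappa>)
      + frechet_derivative (chart_L \<kappa>) (at (chart (tangent_bundle Q) \<kappa> w))
         (0, frechet_derivative (\<lambda>x. Y (cinv Q \<kappa> x) \<kappa>) (at (chart Q \<kappa> (fst w))) (fst (\<zeta> \<kappa>)))"
proof -
  let ?z = "chart (tangent_bundle Q) \<kappa> w"
  let ?Y = "\<lambda>x. Y (cinv Q \<kappa> x) \<kappa>"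
  have z: "?z \<in> TQ.cimage \<kappa>" using w by simp
  have fz: "fst ?z = chart Q \<kappa> (fst w)" by (simp add: chart_tangent_bundle)
  have q: "fst w \<in> cdom Q \<kappa>" using w by (simp add: cdom_tangent_bundle)
  have "(?Y has_derivative frechet_derivative ?Y (at (fst ?z))) (at (fst ?z))"
    unfolding fz by (rule smooth_on_has_derivative[OF vector_fieldsD(2)[OF Y]]) (use q in simp)
  from has_derivative_compose[OF has_derivative_fst[OF has_derivative_ident] this]
  have "((\<lambda>z. ?Y (fst z)) has_derivative (\<lambda>h. frechet_derivative ?Y (at (fst ?z)) (fst h))) (at ?z)" .
  from has_derivative_Pair[OF has_derivative_ident has_derivative_Pair[OF has_derivative_const this]]
  have "((\<lambda>z. (z, (0, ?Y (fst z)))) has_derivative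
      (\<lambda>h. (h, (0, frechet_derivative ?Y (at (fst ?z)) (fst h))))) (at ?z)" .
  from has_derivative_compose[OF this has_derivative_directional[OF TQ.open_cimage smooth_chart_L z]]
  have "((\<lambda>z. frechet_derivative (chart_L \<kappa>) (at z) (0, ?Y (fst z))) has_derivative
      (\<lambda>h. chart_second_derivative \<kappa> ?z h (0, ?Y (fst ?z))
        + frechet_derivative (chart_L \<kappa>) (at ?z) (0, frechet_derivative ?Y (at (fst ?z)) (fst h)))) (at ?z)"
    by simp
  then have "(momentum Y \<circ> cinv (tangent_bundle Q) \<kappa> has_derivative
      (\<lambda>h. chart_second_derivative \<kappa> ?z h (0, ?Y (fst ?z))
        + frechet_derivative (chart_L \<kappa>) (at ?z) (0, frechet_derivative ?Y (at (fst ?z)) (fst h)))) (at ?z)"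
    by (rule has_derivative_transform_within_open[OF _ TQ.open_cimage z]) (simp add: momentum_chart[OF Y])
  from TQ.vec_app_chart[OF w \<zeta> this] show ?thesis
    using q by (simp add: fz)
qed

text \<open>The derivatives of \<open>Y\<close> in \<open>\<Gamma>(Y\<^sup>V(L))\<close> and in \<open>Y\<^sup>C(L)\<close> cancel because a second-order field
  projects to the velocity. What remains is tensorial in \<open>Y\<close>.\<close>

lemma euler_lagrange_chart:
  assumes w: "w \<in> cdom (tangent_bundle Q) \<kappa>" and Y: "Y \<in> vector_fields Q"
  shows "euler_lagrange (second_order_field F) Y w
    = chart_second_derivative \<kappa> (chart (tangent_bundle Q) \<kappa> w) (second_order_field F w \<kappa>) (0, Y (fst w) \<kappa>)
      - frechet_derivative (chart_L \<kappa>) (at (chart (tangent_bundle Q) \<kappa> w)) (Y (fst w) \<kappa>, 0)"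
proof -
  let ?z = "chart (tangent_bundle Q) \<kappa> w"
  let ?DY = "frechet_derivative (\<lambda>x. Y (cinv Q \<kappa> x) \<kappa>) (at (chart Q \<kappa> (fst w))) (snd w \<kappa>)"
  have z: "?z \<in> TQ.cimage \<kappa>" using w by simp
  have "vf_app (tangent_bundle Q) (clift Q Y) L w
      = frechet_derivative (chart_L \<kappa>) (at ?z) (Y (fst w) \<kappa>, ?DY)"
    using TQ.vf_app_chart[OF clift_vector_field[OF Y] smooth_L z] w
    by (simp add: clift_def case_prod_beta)
  also have "\<dots> = frechet_derivative (chart_L \<kappa>) (at ?z) (Y (fst w) \<kappa>, 0)
      + frechet_derivative (chart_L \<kappa>) (at ?z) (0, ?DY)"
    using linear_add[OF linear_chart_L[OF z], of "(Y (fst w) \<kappa>, 0)" "(0, ?DY)"] by simp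
  finally show ?thesis
    using vec_app_momentum[OF w second_order_field_tangent[OF TQ.carrierI[OF w], of F] Y]
    by (simp add: euler_lagrange_def vf_app_def second_order_field_component[OF w])
qed

lemma euler_lagrange_tensorial:
  assumes w: "w \<in> carrier (tangent_bundle Q)" and Y: "Y \<in> vector_fields Q"
  shows "euler_lagrange (second_order_field F) Y w
    = (\<Sum>\<beta>\<in>UNIV. frame_coeff X (fst w) (Y (fst w)) \<beta> * euler_lagrange (second_order_field F) (X \<beta>) w)"
proof -
  obtain \<kappa> where \<kappa>: "w \<in> cdom (tangent_bundle Q) \<kappa>" using w by (rule TQ.carrierE)
  let ?z = "chart (tangent_bundle Q) \<kappa> w"
  have z: "?z \<in> TQ.cimage \<kappa>" using \<kappa> by simp
  let ?c = "frame_coeff X (fst w) (Y (fst w))"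
  let ?T = "\<lambda>y. chart_second_derivative \<kappa> ?z (second_order_field F w \<kappa>) (0, y)
      - frechet_derivative (chart_L \<kappa>) (at ?z) (y, 0)"
  have "linear (\<lambda>y::real^'n. (0::real^'n, y))" "linear (\<lambda>y::real^'n. (y, 0::real^'n))"
    by (auto intro!: linearI)
  from linear_compose[OF this(1) chart_second_derivative_linear(2)[OF z]]
    linear_compose[OF this(2) linear_chart_L[OF z]]
  have T: "linear ?T"
    unfolding comp_def by (rule linear_compose_sub)
  have q: "fst w \<in> cdom Q \<kappa>" using \<kappa> by (simp add: cdom_tangent_bundle)
  have "lincomb UNIV ?c (\<lambda>\<alpha>. X \<alpha> (fst w)) \<kappa> = Y (fst w) \<kappa>"
    using frame_expansion[OF carrierI[OF q] vector_fieldsD(1)[OF Y carrierI[OF q]]] by simp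
  then have "?T (Y (fst w) \<kappa>) = ?T (\<Sum>\<beta>\<in>UNIV. ?c \<beta> *\<^sub>R X \<beta> (fst w) \<kappa>)"
    by (simp add: lincomb_def)
  also have "\<dots> = (\<Sum>\<beta>\<in>UNIV. ?c \<beta> * ?T (X \<beta> (fst w) \<kappa>))"
    using linear_sum[OF T, of "\<lambda>\<beta>. ?c \<beta> *\<^sub>R X \<beta> (fst w) \<kappa>" UNIV] linear_cmul[OF T] by simp
  finally show ?thesis
    by (simp only: euler_lagrange_chart[OF \<kappa> Y] euler_lagrange_chart[OF \<kappa> frame_vector_field])
qed

lemma euler_lagrange_frame:
  assumes w: "w \<in> carrier (tangent_bundle Q)"
  shows "euler_lagrange (second_order_field F) (X \<beta>) w
    = (\<Sum>\<alpha>\<in>UNIV. F \<alpha> w * G w \<alpha> \<beta>) - lagrangian_force \<beta> w"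
proof -
  let ?V = "lincomb UNIV (\<lambda>\<alpha>. F \<alpha> w) (\<lambda>\<alpha>. vlift Q (X \<alpha>) w)"
  note sm = smooth_momentum[OF frame_vector_field[of \<beta>]]
  have "second_order_field F w = (\<lambda>\<kappa>. second_order_field (\<lambda>\<alpha> w. 0) w \<kappa> + ?V \<kappa>)"
    by (simp add: second_order_field_def lincomb_def sum.distrib)
  then have "vec_app (tangent_bundle Q) w (second_order_field F w) (momentum (X \<beta>))
      = vec_app (tangent_bundle Q) w (second_order_field (\<lambda>\<alpha> w. 0) w) (momentum (X \<beta>))
        + vec_app (tangent_bundle Q) w ?V (momentum (X \<beta>))"
    using TQ.vec_app_add[OF w sm second_order_field_tangent[OF w] TQ.lincomb_in_tangent_space[OF vlift_tangent[OF w]]]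
    by simp
  also have "vec_app (tangent_bundle Q) w ?V (momentum (X \<beta>)) = (\<Sum>\<alpha>\<in>UNIV. F \<alpha> w * G w \<alpha> \<beta>)"
    using TQ.vec_app_lincomb[OF w sm vlift_tangent[OF w]]
    by (simp add: hessian_matrix_def vf_app_def)
  finally show ?thesis
    by (simp add: lagrangian_force_def euler_lagrange_def vf_app_def)
qed

lemma hessian_matrix_chart:
  assumes w: "w \<in> cdom (tangent_bundle Q) \<kappa>"
  shows "G w \<alpha> \<beta> = chart_second_derivative \<kappa> (chart (tangent_bundle Q) \<kappa> w)
    (0, X \<alpha> (fst w) \<kappa>) (0, X \<beta> (fst w) \<kappa>)"
proof -
  have q: "fst w \<in> cdom Q \<kappa>" using w by (simp add: cdom_tangent_bundle)
  have z: "chart (tangent_bundle Q) \<kappa> w \<in> TQ.cimage \<kappa>" using w by simp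
  have D: "frechet_derivative (\<lambda>x. X \<beta> (cinv Q \<kappa> x) \<kappa>) (at (chart Q \<kappa> (fst w))) 0 = 0"
    by (rule linear_0[OF has_derivative_linear[OF smooth_on_has_derivative[OF
              vector_fieldsD(2)[OF frame_vector_field]]]]) (use q in simp)
  have "vlift Q (X \<alpha>) w \<kappa> = (0, X \<alpha> (fst w) \<kappa>)"
    using w by (simp add: vlift_def vlift_along_def)
  then show ?thesis
    using vec_app_momentum[OF w vlift_tangent[OF TQ.carrierI[OF w]] frame_vector_field, of \<alpha> \<beta>]
      linear_0[OF linear_chart_L[OF z]]
    by (simp add: hessian_matrix_def vf_app_def D zero_prod_def)
qed

lemma fibre_hessian_chart:
  assumes w: "w \<in> cdom (tangent_bundle Q) \<kappa>"
  shows "fibre_hessian Q L \<kappa> w $ i $ j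
    = chart_second_derivative \<kappa> (chart (tangent_bundle Q) \<kappa> w) (0, axis i 1) (0, axis j 1)"
proof -
  let ?x = "chart Q \<kappa> (fst w)" and ?y = "snd w \<kappa>"
  have cw: "chart (tangent_bundle Q) \<kappa> w = (?x, ?y)" by (simp add: chart_tangent_bundle)
  have z: "(?x, u) \<in> TQ.cimage \<kappa>" for u
    using w by (simp add: cimage_tangent_bundle cdom_tangent_bundle)
  have incl: "((\<lambda>u. (?x, u)) has_derivative (\<lambda>h. (0, h))) (at u)" for u :: "real^'n"
    by (auto intro!: derivative_eq_intros)
  have "((\<lambda>u. L (cinv (tangent_bundle Q) \<kappa> (?x, u))) has_derivative
      (\<lambda>h. frechet_derivative (chart_L \<kappa>) (at (?x, u)) (0, h))) (at u)" for u
    using has_derivative_compose[OF incl smooth_on_has_derivative[OF smooth_chart_L z]]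
    by (simp add: comp_def)
  note first = fun_cong[OF frechet_derivative_at[OF this], symmetric]
  have "((\<lambda>u. frechet_derivative (chart_L \<kappa>) (at (?x, u)) b) has_derivative
      (\<lambda>h. chart_second_derivative \<kappa> (?x, u) (0, h) b)) (at u)" for u b
    using has_derivative_compose[OF incl smooth_on_has_derivative[OF
          smooth_on_frechet_derivative_fixed[OF smooth_chart_L] z]] .
  note second = fun_cong[OF frechet_derivative_at[OF this], symmetric]
  show ?thesis
    by (simp add: fibre_hessian_def cw first second)
qed

text \<open>The matrix of the Hessian in the frame is congruent to the fibre Hessian in any chart.\<close>

lemma hessian_matrix_invertible:
  assumes w: "w \<in> cdom (tangent_bundle Q) \<kappa>" and inv: "invertible (fibre_hessian Q L \<kappa> w)"
  shows "invertible (\<chi> \<beta> \<alpha>. G w \<alpha> \<beta>)"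
proof -
  let ?B = "\<chi> i \<alpha>. X \<alpha> (fst w) \<kappa> $ i"
  let ?H = "fibre_hessian Q L \<kappa> w"
  let ?z = "chart (tangent_bundle Q) \<kappa> w"
  have z: "?z \<in> TQ.cimage \<kappa>" using w by simp
  have q: "fst w \<in> cdom Q \<kappa>" using w by (simp add: cdom_tangent_bundle)
  have vec: "(0::real^'n, x) = (\<Sum>i\<in>UNIV. (x $ i) *\<^sub>R (0, axis i 1))" for x :: "real^'n"
    by (simp add: prod_eq_iff fst_sum snd_sum basis_expansion scalar_mult_eq_scaleR[symmetric])
  have S: "chart_second_derivative \<kappa> ?z (0, x) (0, y) = (\<Sum>i\<in>UNIV. \<Sum>j\<in>UNIV. x $ i * ?H $ i $ j * y $ j)"
    for x y :: "real^'n"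
  proof -
    note l1 = chart_second_derivative_linear(1)[OF z] and l2 = chart_second_derivative_linear(2)[OF z]
    have e1: "chart_second_derivative \<kappa> ?z (0, x) b
        = (\<Sum>i\<in>UNIV. x $ i * chart_second_derivative \<kappa> ?z (0, axis i 1) b)" for b
      unfolding vec[of x] linear_sum[OF l1] linear_cmul[OF l1] real_scaleR_def ..
    have e2: "chart_second_derivative \<kappa> ?z a (0, y)
        = (\<Sum>j\<in>UNIV. y $ j * chart_second_derivative \<kappa> ?z a (0, axis j 1))" for a
      unfolding vec[of y] linear_sum[OF l2] linear_cmul[OF l2] real_scaleR_def ..
    show ?thesis
      unfolding e1[of "(0, y)"] unfolding e2 by (simp add: fibre_hessian_chart[OF w] sum_distrib_left mult_ac)
  qed
  have "transpose (\<chi> \<beta> \<alpha>. G w \<alpha> \<beta>) = transpose ?B ** (?H ** ?B)"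
    by (simp add: vec_eq_iff matrix_matrix_mult_def transpose_def hessian_matrix_chart[OF w] S
        sum_distrib_left mult_ac)
  moreover have "invertible (transpose ?B ** (?H ** ?B))"
    using frame_matrix_invertible[OF q] inv by (intro invertible_mult transpose_invertible)
  ultimately have "invertible (transpose (transpose (\<chi> \<beta> \<alpha>. G w \<alpha> \<beta>)))"
    by (simp only: transpose_invertible)
  then show ?thesis by simp
qed

end

section \<open>The Lagrangian field, its projection and the nonholonomic field\<close>

text \<open>Completing the block indexed by \<open>A\<close> with the identity turns the constrained equations
  \<open>F\<^sup>a g\<^sub>a\<^sub>b = r\<^sub>b\<close>, \<open>F\<^sup>i = 0\<close> into one square linear system.\<close>

lemma nonsingular_on_imp_invertible:
  fixes g :: "'n::finite \<Rightarrow> 'n \<Rightarrow> real"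
  assumes "nonsingular_on A g"
  shows "invertible (\<chi> i j. if i \<in> A \<and> j \<in> A then g j i else if i = j then 1 else 0)"
proof -
  obtain H where H: "\<And>a c. a \<in> A \<Longrightarrow> c \<in> A \<Longrightarrow> (\<Sum>b\<in>A. H a b * g b c) = (if a = c then 1 else 0)"
    using assms unfolding nonsingular_on_def by blast
  let ?M = "\<chi> i j. if i \<in> A \<and> j \<in> A then g j i else if i = j then 1 else 0"
  let ?N = "\<chi> i j. if i \<in> A \<and> j \<in> A then H j i else if i = j then 1 else 0"
  have "(\<Sum>j\<in>UNIV. ?M $ i $ j * ?N $ j $ k) = (if i = k then 1 else 0)" for i k
  proof (cases "i \<in> A")
    case True
    have "(\<Sum>j\<in>UNIV. ?M $ i $ j * ?N $ j $ k) = (\<Sum>j\<in>A. ?M $ i $ j * ?N $ j $ k)"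
      by (rule sum.mono_neutral_right) (use True in auto)
    also have "\<dots> = (\<Sum>j\<in>A. if k \<in> A then H k j * g j i else 0)"
      by (rule sum.cong) (use True in auto)
    also have "\<dots> = (if i = k then 1 else 0)"
      using H[of k i] True by (cases "k \<in> A") auto
    finally show ?thesis .
  next
    case False
    have "(\<Sum>j\<in>UNIV. ?M $ i $ j * ?N $ j $ k) = (\<Sum>j\<in>UNIV. if i = j then ?N $ i $ k else 0)"
      by (rule sum.cong) (use False in auto)
    then show ?thesis using False by simp
  qed
  then have "?M ** ?N = mat 1"
    by (simp add: matrix_matrix_mult_def mat_def vec_eq_iff)
  then show ?thesis
    unfolding invertible_right_inverse by blast
qed

lemma nonsingular_on_solution_unique:
  fixes g :: "'n::finite \<Rightarrow> 'n \<Rightarrow> real"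
  assumes "nonsingular_on A g"
    and off: "\<And>i. i \<notin> A \<Longrightarrow> f i = f' i"
    and eq: "\<And>b. b \<in> A \<Longrightarrow> (\<Sum>a\<in>UNIV. f a * g a b) = (\<Sum>a\<in>UNIV. f' a * g a b)"
  shows "f = f'"
proof
  fix c
  obtain H where H: "\<And>a c. a \<in> A \<Longrightarrow> c \<in> A \<Longrightarrow> (\<Sum>b\<in>A. g a b * H b c) = (if a = c then 1 else 0)"
    using assms(1) unfolding nonsingular_on_def by blast
  define d where "d a = f a - f' a" for a
  have zero: "(\<Sum>a\<in>A. d a * g a b) = 0" if "b \<in> A" for b
  proof -
    have "(\<Sum>a\<in>UNIV. d a * g a b) = 0"
      using eq[OF that] by (simp add: d_def left_diff_distrib sum_subtractf)
    moreover have "(\<Sum>a\<in>UNIV. d a * g a b) = (\<Sum>a\<in>A. d a * g a b)"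
      by (rule sum.mono_neutral_right) (use off in \<open>auto simp: d_def\<close>)
    ultimately show ?thesis by simp
  qed
  show "f c = f' c"
  proof (cases "c \<in> A")
    case True
    have "d c = (\<Sum>a\<in>A. d a * (\<Sum>b\<in>A. g a b * H b c))"
      using True by (simp add: H if_distrib cong: if_cong)
    also have "\<dots> = (\<Sum>a\<in>A. \<Sum>b\<in>A. d a * g a b * H b c)"
      by (simp add: sum_distrib_left mult.assoc)
    also have "\<dots> = (\<Sum>b\<in>A. \<Sum>a\<in>A. d a * g a b * H b c)"
      by (rule sum.swap)
    also have "\<dots> = (\<Sum>b\<in>A. (\<Sum>a\<in>A. d a * g a b) * H b c)"
      by (simp add: sum_distrib_right)
    also have "\<dots> = 0"
      by (simp add: zero)
    finally show ?thesis by (simp add: d_def)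
  qed (rule off)
qed

locale nonholonomic_system = lagrangian_manifold Q X L
  for Q :: "('p, 'i, real^'n) atlas" and X :: "'n \<Rightarrow> 'p \<Rightarrow> 'i \<Rightarrow> real^'n"
    and L :: "'p \<times> ('i \<Rightarrow> real^'n) \<Rightarrow> real" +
  fixes A :: "'n set" and D :: "'p \<Rightarrow> ('i \<Rightarrow> real^'n) set"
  assumes adapted: "q \<in> carrier Q \<Longrightarrow> D q = range (\<lambda>c. lincomb A c (\<lambda>a. X a q))"
    and regular: "regular Q L"
    and regular_wrt: "regular_wrt Q X A L"
begin

lemma hessian_nonsingular_on: "w \<in> carrier (tangent_bundle Q) \<Longrightarrow> nonsingular_on A (G w)"
  using regular_wrt by (simp add: regular_wrt_def)

lemma hessian_invertible:
  assumes "w \<in> carrier (tangent_bundle Q)"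
  shows "invertible (\<chi> \<beta> \<alpha>. G w \<alpha> \<beta>)"
proof -
  obtain \<kappa> where \<kappa>: "w \<in> cdom (tangent_bundle Q) \<kappa>" using assms by (rule TQ.carrierE)
  then show ?thesis
    using regular by (intro hessian_matrix_invertible) (auto simp: regular_def)
qed

lemma hessian_nonsingular_on_UNIV:
  assumes "w \<in> carrier (tangent_bundle Q)"
    and eq: "\<And>\<beta>. (\<Sum>\<alpha>\<in>UNIV. f \<alpha> * G w \<alpha> \<beta>) = (\<Sum>\<alpha>\<in>UNIV. f' \<alpha> * G w \<alpha> \<beta>)"
  shows "f = f'"
proof -
  let ?M = "\<chi> \<beta> \<alpha>. G w \<alpha> \<beta>"
  obtain B where B: "B ** ?M = mat 1"
    using hessian_invertible[OF assms(1)] unfolding invertible_def by blast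
  have "?M *v (\<chi> \<alpha>. f \<alpha>) = ?M *v (\<chi> \<alpha>. f' \<alpha>)"
    using eq by (simp add: matrix_vector_mult_def mult.commute)
  then have "B *v (?M *v (\<chi> \<alpha>. f \<alpha>)) = B *v (?M *v (\<chi> \<alpha>. f' \<alpha>))"
    by (rule arg_cong)
  then have "(\<chi> \<alpha>. f \<alpha>) = (\<chi> \<alpha>. f' \<alpha>)"
    by (simp add: matrix_vector_mul_assoc B)
  then show ?thesis
    by (simp add: vec_eq_iff fun_eq_iff)
qed

lemma frame_coeff_frame: "q \<in> carrier Q \<Longrightarrow> frame_coeff X q (X \<beta> q) = (\<lambda>\<alpha>. if \<alpha> = \<beta> then 1 else 0)"
proof -
  assume q: "q \<in> carrier Q"
  have "X \<beta> q = lincomb UNIV (\<lambda>\<alpha>. if \<alpha> = \<beta> then 1 else 0) (\<lambda>\<alpha>. X \<alpha> q)"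
    by (simp add: lincomb_def if_distrib[of "\<lambda>c. c *\<^sub>R _"] cong: if_cong)
  then show ?thesis
    using frame_coeff_lincomb[OF q] by metis
qed

lemma frame_coeff_distribution:
  assumes "q \<in> carrier Q" "\<xi> \<in> D q" "i \<notin> A"
  shows "frame_coeff X q \<xi> i = 0"
proof -
  obtain c where "\<xi> = lincomb A c (\<lambda>a. X a q)"
    using assms adapted by blast
  then show ?thesis
    using assms(3) by (simp add: lincomb_subset[of A] frame_coeff_lincomb[OF assms(1)])
qed

lemma frame_in_distribution:
  assumes "q \<in> carrier Q" "b \<in> A"
  shows "X b q \<in> D q"
proof -
  have "X b q = lincomb A (\<lambda>\<alpha>. if \<alpha> = b then 1 else 0) (\<lambda>\<alpha>. X \<alpha> q)"
    using assms(2) by (simp add: lincomb_def if_distrib[of "\<lambda>c. c *\<^sub>R _"] cong: if_cong)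
  then show ?thesis
    using adapted[OF assms(1)] by blast
qed

lemma is_lagrangian_field_iff:
  assumes F: "\<And>\<alpha>. smooth_fun (tangent_bundle Q) (F \<alpha>)"
  shows "is_lagrangian_field Q X L (second_order_field F) \<longleftrightarrow>
    (\<forall>w\<in>carrier (tangent_bundle Q). \<forall>\<beta>. (\<Sum>\<alpha>\<in>UNIV. F \<alpha> w * G w \<alpha> \<beta>) = lagrangian_force \<beta> w)"
    (is "_ \<longleftrightarrow> ?eq")
proof -
  have "is_lagrangian_field Q X L (second_order_field F) \<longleftrightarrow>
    (\<forall>Y\<in>vector_fields Q. \<forall>w\<in>carrier (tangent_bundle Q). euler_lagrange (second_order_field F) Y w = 0)"
    using F unfolding is_lagrangian_field_def euler_lagrange_def sode_iff by blast
  also have "\<dots> \<longleftrightarrow> ?eq"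
  proof
    assume E: "\<forall>Y\<in>vector_fields Q. \<forall>w\<in>carrier (tangent_bundle Q). euler_lagrange (second_order_field F) Y w = 0"
    show ?eq
    proof (intro ballI allI)
      fix w \<beta> assume w: "w \<in> carrier (tangent_bundle Q)"
      then have "euler_lagrange (second_order_field F) (X \<beta>) w = 0"
        using E frame_vector_field by blast
      then show "(\<Sum>\<alpha>\<in>UNIV. F \<alpha> w * G w \<alpha> \<beta>) = lagrangian_force \<beta> w"
        by (simp add: euler_lagrange_frame[OF w])
    qed
  next
    assume ?eq
    then show "\<forall>Y\<in>vector_fields Q. \<forall>w\<in>carrier (tangent_bundle Q). euler_lagrange (second_order_field F) Y w = 0"
      by (simp add: euler_lagrange_tensorial euler_lagrange_frame)
  qed
  finally show ?thesis .
qed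

lemma lagrangian_field_exists:
  obtains F where "\<And>\<alpha>. smooth_fun (tangent_bundle Q) (F \<alpha>)"
    and "\<And>w \<beta>. w \<in> carrier (tangent_bundle Q) \<Longrightarrow> (\<Sum>\<alpha>\<in>UNIV. F \<alpha> w * G w \<alpha> \<beta>) = lagrangian_force \<beta> w"
    and "lagrangian_field Q X L = second_order_field F"
proof -
  obtain F where F: "\<And>\<alpha>. smooth_fun (tangent_bundle Q) (F \<alpha>)"
    and "\<And>w \<beta>. w \<in> carrier (tangent_bundle Q) \<Longrightarrow> (\<Sum>\<alpha>\<in>UNIV. G w \<alpha> \<beta> * F \<alpha> w) = lagrangian_force \<beta> w"
    by (rule TQ.smooth_fun_solve[where a = "\<lambda>\<beta> \<alpha> w. G w \<alpha> \<beta>" and b = lagrangian_force,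
          OF smooth_hessian_matrix smooth_lagrangian_force hessian_invertible]) (assumption | rule that)+
  then have sol: "(\<Sum>\<alpha>\<in>UNIV. F \<alpha> w * G w \<alpha> \<beta>) = lagrangian_force \<beta> w" if "w \<in> carrier (tangent_bundle Q)" for w \<beta>
    using that by (simp add: mult.commute)
  have "lagrangian_field Q X L = second_order_field F"
    unfolding lagrangian_field_def
  proof (rule the_equality)
    show "is_lagrangian_field Q X L (second_order_field F)"
      using is_lagrangian_field_iff[of F, OF F] sol by blast
    fix \<Gamma> assume \<Gamma>: "is_lagrangian_field Q X L \<Gamma>"
    then obtain F' where F': "\<And>\<alpha>. smooth_fun (tangent_bundle Q) (F' \<alpha>)" and eq: "\<Gamma> = second_order_field F'"
      unfolding is_lagrangian_field_def sode_iff by blast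
    show "\<Gamma> = second_order_field F"
    proof
      fix w
      show "\<Gamma> w = second_order_field F w"
      proof (cases "w \<in> carrier (tangent_bundle Q)")
        case True
        then have "(\<Sum>\<alpha>\<in>UNIV. F' \<alpha> w * G w \<alpha> \<beta>) = lagrangian_force \<beta> w" for \<beta>
          using \<Gamma> is_lagrangian_field_iff[of F', OF F'] unfolding eq by blast
        then have "(\<lambda>\<alpha>. F' \<alpha> w) = (\<lambda>\<alpha>. F \<alpha> w)"
          using sol[OF True] by (intro hessian_nonsingular_on_UNIV[OF True]) simp
        then show ?thesis
          unfolding eq by (intro second_order_field_cong) (rule fun_cong)
      qed (simp add: eq second_order_field_outside)
    qed
  qed
  then show thesis using that F sol by blast
qed

lemma constrained_force_exists:
  obtains F where "\<And>\<alpha>. smooth_fun (tangent_bundle Q) (F \<alpha>)"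
    and "\<And>w i. w \<in> carrier (tangent_bundle Q) \<Longrightarrow> i \<notin> A \<Longrightarrow> F i w = 0"
    and "\<And>w b. w \<in> carrier (tangent_bundle Q) \<Longrightarrow> b \<in> A \<Longrightarrow>
      (\<Sum>\<alpha>\<in>UNIV. F \<alpha> w * G w \<alpha> b) = lagrangian_force b w"
proof -
  let ?a = "\<lambda>i j w. if i \<in> A \<and> j \<in> A then G w j i else if i = j then 1 else 0"
  let ?b = "\<lambda>i w. if i \<in> A then lagrangian_force i w else 0"
  have a: "smooth_fun (tangent_bundle Q) (?a i j)" for i j
    by (cases "i \<in> A \<and> j \<in> A"; cases "i = j") (auto simp: smooth_hessian_matrix TQ.smooth_fun_const)
  have b: "smooth_fun (tangent_bundle Q) (?b i)" for i
    by (cases "i \<in> A") (simp_all add: smooth_lagrangian_force TQ.smooth_fun_const)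
  have inv: "invertible (\<chi> i j. ?a i j w)" if "w \<in> carrier (tangent_bundle Q)" for w
    by (rule nonsingular_on_imp_invertible[OF hessian_nonsingular_on[OF that]])
  obtain F where F: "\<And>\<alpha>. smooth_fun (tangent_bundle Q) (F \<alpha>)"
    and sol: "\<And>w i. w \<in> carrier (tangent_bundle Q) \<Longrightarrow> (\<Sum>j\<in>UNIV. ?a i j w * F j w) = ?b i w"
    by (rule TQ.smooth_fun_solve[where a = ?a and b = ?b, OF a b inv]) (assumption | rule that)+
  have off: "F i w = 0" if w: "w \<in> carrier (tangent_bundle Q)" and i: "i \<notin> A" for w i
  proof -
    have "(\<Sum>j\<in>UNIV. ?a i j w * F j w) = (\<Sum>j\<in>UNIV. if i = j then F j w else 0)"
      by (rule sum.cong) (use i in auto)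
    then show ?thesis using sol[OF w, of i] i by simp
  qed
  have "(\<Sum>\<alpha>\<in>UNIV. F \<alpha> w * G w \<alpha> b) = lagrangian_force b w"
    if w: "w \<in> carrier (tangent_bundle Q)" and b: "b \<in> A" for w b
  proof -
    have "(\<Sum>j\<in>UNIV. ?a b j w * F j w) = (\<Sum>\<alpha>\<in>UNIV. F \<alpha> w * G w \<alpha> b)"
      by (rule sum.cong) (use b off[OF w] in auto)
    then show ?thesis using sol[OF w, of b] b by simp
  qed
  then show thesis using that F off by blast
qed

lemma constraint_set_carrier: "w \<in> constraint_set Q X A \<Longrightarrow> w \<in> carrier (tangent_bundle Q)"
  by (simp add: constraint_set_def)

lemma second_order_field_on_constraint:
  assumes w: "w \<in> constraint_set Q X A" and F: "\<And>i. i \<notin> A \<Longrightarrow> F i w = 0"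
  shows "second_order_field F w \<kappa> =
    (\<Sum>a\<in>A. qv a w *\<^sub>R clift Q (X a) w \<kappa> + F a w *\<^sub>R vlift Q (X a) w \<kappa>)"
  unfolding second_order_field_def
  by (rule sum.mono_neutral_right) (use w F in \<open>auto simp: constraint_set_def\<close>)

lemma second_order_field_tangent_fields:
  assumes "\<And>\<alpha>. smooth_fun (tangent_bundle Q) (F \<alpha>)"
    and "\<And>w i. w \<in> carrier (tangent_bundle Q) \<Longrightarrow> i \<notin> A \<Longrightarrow> F i w = 0"
  shows "second_order_field F \<in> tangent_fields Q X A"
  using assms second_order_field_vector_field[of F]
  by (simp add: tangent_fields_def vf_app_def quasi_velocity_second_order_field)

lemma second_order_field_difference:
  "second_order_field F - second_order_field F'
    = vlift_along Q (\<lambda>w. lincomb UNIV (\<lambda>\<alpha>. F \<alpha> w - F' \<alpha> w) (\<lambda>\<alpha>. X \<alpha> (fst w)))"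
proof (intro ext)
  fix w \<kappa>
  have "(second_order_field F - second_order_field F') w \<kappa>
      = (\<Sum>\<alpha>\<in>UNIV. (F \<alpha> w - F' \<alpha> w) *\<^sub>R vlift Q (X \<alpha>) w \<kappa>)"
    by (simp add: second_order_field_def sum_subtractf[symmetric] scaleR_diff_left)
  then show "(second_order_field F - second_order_field F') w \<kappa>
      = vlift_along Q (\<lambda>w. lincomb UNIV (\<lambda>\<alpha>. F \<alpha> w - F' \<alpha> w) (\<lambda>\<alpha>. X \<alpha> (fst w))) w \<kappa>"
    by (simp add: vlift_def vlift_along_def lincomb_def prod_eq_iff fst_sum snd_sum)
qed

lemma lincomb_fields_along_tau:
  assumes "\<And>\<alpha>. smooth_fun (tangent_bundle Q) (d \<alpha>)"
  shows "(\<lambda>w. lincomb UNIV (\<lambda>\<alpha>. d \<alpha> w) (\<lambda>\<alpha>. X \<alpha> (fst w))) \<in> fields_along_tau Q"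
proof -
  have "lincomb UNIV (\<lambda>\<alpha>. d \<alpha> w) (\<lambda>\<alpha>. X \<alpha> (fst w)) \<in> tangent_space Q (fst w)"
    if "w \<in> carrier (tangent_bundle Q)" for w
    using that by (intro lincomb_in_tangent_space frame_tangent) (simp add: carrier_tangent_bundle)
  moreover have "smooth_on (TQ.cimage \<kappa>) (\<lambda>z. lincomb UNIV (\<lambda>\<alpha>. d \<alpha> (cinv (tangent_bundle Q) \<kappa> z))
      (\<lambda>\<alpha>. X \<alpha> (fst (cinv (tangent_bundle Q) \<kappa> z))) \<kappa>)" for \<kappa>
  proof -
    have "smooth_on (TQ.cimage \<kappa>) (\<lambda>z. X \<alpha> (fst (cinv (tangent_bundle Q) \<kappa> z)) \<kappa>)" for \<alpha>
      using base_field_along_tau[OF frame_vector_field[of \<alpha>]] by (simp add: fields_along_tau_def)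
    moreover have "smooth_on (TQ.cimage \<kappa>) (\<lambda>z. d \<alpha> (cinv (tangent_bundle Q) \<kappa> z))" for \<alpha>
      using assms by (simp add: TQ.smooth_fun_iff)
    ultimately show ?thesis
      unfolding lincomb_def
      by (intro smooth_on_sum[OF TQ.open_cimage] smooth_on_scaleR[OF TQ.open_cimage])
  qed
  ultimately show ?thesis
    by (simp add: fields_along_tau_def)
qed

text \<open>Orthogonality at a point has to be tested only against the frame fields of the distribution,
  since the coefficients of a field in the distribution vanish for all other indices.\<close>

lemma orth_fields_iff:
  assumes "Z \<in> fields_along_tau Q"
  shows "Z \<in> orth_fields Q D X L \<longleftrightarrow> (\<forall>w\<in>carrier (tangent_bundle Q). \<forall>b\<in>A.
    (\<Sum>\<alpha>\<in>UNIV. frame_coeff X (fst w) (Z w) \<alpha> * G w \<alpha> b) = 0)" (is "_ \<longleftrightarrow> ?R")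
proof
  assume Z: "Z \<in> orth_fields Q D X L"
  show ?R
  proof (intro ballI)
    fix w b assume w: "w \<in> carrier (tangent_bundle Q)" and b: "b \<in> A"
    have "X b \<circ> fst \<in> fields_along_tau_in Q D"
      using base_field_along_tau[OF frame_vector_field] frame_in_distribution[OF _ b]
      by (simp add: fields_along_tau_in_def carrier_tangent_bundle)
    then have "hessian Q X L Z (X b \<circ> fst) w = 0"
      using Z w by (simp add: orth_fields_def)
    then show "(\<Sum>\<alpha>\<in>UNIV. frame_coeff X (fst w) (Z w) \<alpha> * G w \<alpha> b) = 0"
      using w by (simp add: hessian_def frame_coeff_frame carrier_tangent_bundle
          if_distrib[of "\<lambda>c. _ * c"] if_distrib[of "\<lambda>c. c * _"] cong: if_cong)
  qed
next
  assume R: ?R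
  have "hessian Q X L Z Y w = 0" if Y: "Y \<in> fields_along_tau_in Q D" and w: "w \<in> carrier (tangent_bundle Q)" for Y w
  proof -
    let ?z = "frame_coeff X (fst w) (Z w)" and ?y = "frame_coeff X (fst w) (Y w)"
    have "hessian Q X L Z Y w = (\<Sum>\<beta>\<in>UNIV. \<Sum>\<alpha>\<in>UNIV. ?z \<alpha> * ?y \<beta> * G w \<alpha> \<beta>)"
      unfolding hessian_def by (rule sum.swap)
    also have "\<dots> = (\<Sum>\<beta>\<in>UNIV. ?y \<beta> * (\<Sum>\<alpha>\<in>UNIV. ?z \<alpha> * G w \<alpha> \<beta>))"
      by (simp add: sum_distrib_left mult_ac)
    also have "\<dots> = 0"
    proof (rule sum.neutral, rule ballI)
      fix \<beta>
      have "?y \<beta> = 0" if "\<beta> \<notin> A"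
        using Y w that by (intro frame_coeff_distribution) (auto simp: fields_along_tau_in_def carrier_tangent_bundle)
      then show "?y \<beta> * (\<Sum>\<alpha>\<in>UNIV. ?z \<alpha> * G w \<alpha> \<beta>) = 0"
        using R w by (cases "\<beta> \<in> A") auto
    qed
    finally show ?thesis .
  qed
  then show "Z \<in> orth_fields Q D X L"
    using assms by (simp add: orth_fields_def)
qed

lemma orth_fields_uminus:
  assumes "Z \<in> orth_fields Q D X L"
  shows "- Z \<in> orth_fields Q D X L"
proof -
  have Z: "Z \<in> fields_along_tau Q" using assms by (simp add: orth_fields_def)
  have neg: "(- Z) w = lincomb UNIV (\<lambda>\<alpha>. - frame_coeff X (fst w) (Z w) \<alpha>) (\<lambda>\<alpha>. X \<alpha> (fst w))"
    if "w \<in> carrier (tangent_bundle Q)" for w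
  proof -
    have "lincomb UNIV (frame_coeff X (fst w) (Z w)) (\<lambda>\<alpha>. X \<alpha> (fst w)) = Z w"
      using that Z by (intro frame_expansion) (auto simp: carrier_tangent_bundle fields_along_tau_def)
    then show ?thesis
      by (simp add: lincomb_def fun_eq_iff sum_negf)
  qed
  have "- Z \<in> fields_along_tau Q"
  proof -
    have "(- Z) w \<in> tangent_space Q (fst w)" if "w \<in> carrier (tangent_bundle Q)" for w
      unfolding neg[OF that] using that
      by (intro lincomb_in_tangent_space frame_tangent) (simp add: carrier_tangent_bundle)
    moreover have "smooth_on (TQ.cimage \<kappa>) (\<lambda>z. - Z (cinv (tangent_bundle Q) \<kappa> z) \<kappa>)" for \<kappa>
      using Z by (intro smooth_on_bounded_linear_compose[OF bounded_linear_minus[OF bounded_linear_ident]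
            TQ.open_cimage]) (simp add: fields_along_tau_def)
    ultimately show ?thesis by (simp add: fields_along_tau_def)
  qed
  moreover have "frame_coeff X (fst w) ((- Z) w) \<alpha> = - frame_coeff X (fst w) (Z w) \<alpha>"
    if "w \<in> carrier (tangent_bundle Q)" for w \<alpha>
    unfolding neg[OF that] using that by (simp add: frame_coeff_lincomb carrier_tangent_bundle)
  ultimately show ?thesis
    using assms orth_fields_iff[OF Z] by (simp only: orth_fields_iff) (simp add: sum_negf)
qed

lemma orth_vertical_minus_commute:
  assumes "\<Gamma> - \<Gamma>' \<in> orth_vertical Q D X L"
  shows "\<Gamma>' - \<Gamma> \<in> orth_vertical Q D X L"
proof -
  obtain Z where Z: "Z \<in> orth_fields Q D X L" "\<Gamma> - \<Gamma>' = vlift_along Q Z"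
    using assms unfolding orth_vertical_def by blast
  have "\<Gamma>' - \<Gamma> = - (\<Gamma> - \<Gamma>')" by (simp add: fun_eq_iff)
  also have "\<dots> = vlift_along Q (- Z)"
    unfolding Z(2) by (auto simp: vlift_along_def fun_eq_iff)
  finally show ?thesis
    using orth_fields_uminus[OF Z(1)] unfolding orth_vertical_def by blast
qed

text \<open>The sum of tangent and \<open>g\<close>-orthogonal vertical fields is direct: the component transversal to
  the distribution of the vertical part is forced by \<open>Z(v\<^sup>i)\<close>, and then orthogonality determines the
  component along the distribution because \<open>g\<close> is nonsingular there.\<close>

lemma tangent_orth_decomposition_unique:
  assumes Y: "Y \<in> tangent_fields Q X A" "\<Gamma> - Y \<in> orth_vertical Q D X L"
    and Y': "Y' \<in> tangent_fields Q X A" "\<Gamma> - Y' \<in> orth_vertical Q D X L"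
  shows "Y = Y'"
proof
  fix w
  obtain Z where Z: "Z \<in> orth_fields Q D X L" and \<Gamma>: "\<Gamma> - Y = vlift_along Q Z"
    using Y(2) unfolding orth_vertical_def by blast
  obtain Z' where Z': "Z' \<in> orth_fields Q D X L" and \<Gamma>': "\<Gamma> - Y' = vlift_along Q Z'"
    using Y'(2) unfolding orth_vertical_def by blast
  have vf: "Y \<in> vector_fields (tangent_bundle Q)" "Y' \<in> vector_fields (tangent_bundle Q)"
    using Y(1) Y'(1) by (simp_all add: tangent_fields_def)
  show "Y w = Y' w"
  proof (cases "w \<in> carrier (tangent_bundle Q)")
    case w: True
    have along: "Z \<in> fields_along_tau Q" "Z' \<in> fields_along_tau Q"
      using Z Z' by (simp_all add: orth_fields_def)
    then have tan: "Z w \<in> tangent_space Q (fst w)" "Z' w \<in> tangent_space Q (fst w)"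
      using w by (simp_all add: fields_along_tau_def)
    have q: "fst w \<in> carrier Q" using w by (simp add: carrier_tangent_bundle)
    have eq: "\<Gamma> w = (\<lambda>\<kappa>. Y w \<kappa> + vlift_along Q Z w \<kappa>)" "\<Gamma> w = (\<lambda>\<kappa>. Y' w \<kappa> + vlift_along Q Z' w \<kappa>)"
      using fun_cong[OF \<Gamma>, of w] fun_cong[OF \<Gamma>', of w]
      by (simp_all add: fun_eq_iff diff_eq_eq add.commute)
    have "vec_app (tangent_bundle Q) w (\<Gamma> w) (qv i) = frame_coeff X (fst w) (Z w) i" if "i \<notin> A" for i
      using TQ.vec_app_add[OF w smooth_quasi_velocity TQ.vector_fieldsD(1)[OF vf(1) w]
          vlift_along_in_tangent_space[of w Z, OF w tan(1)], of i] Y(1) that w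
      by (simp add: eq(1) tangent_fields_def vf_app_def quasi_velocity_vlift_along[of w Z, OF w tan(1)])
    moreover have "vec_app (tangent_bundle Q) w (\<Gamma> w) (qv i) = frame_coeff X (fst w) (Z' w) i" if "i \<notin> A" for i
      using TQ.vec_app_add[OF w smooth_quasi_velocity TQ.vector_fieldsD(1)[OF vf(2) w]
          vlift_along_in_tangent_space[of w Z', OF w tan(2)], of i] Y'(1) that w
      by (simp add: eq(2) tangent_fields_def vf_app_def quasi_velocity_vlift_along[of w Z', OF w tan(2)])
    ultimately have "frame_coeff X (fst w) (Z w) = frame_coeff X (fst w) (Z' w)"
      using Z Z' w orth_fields_iff[OF along(1)] orth_fields_iff[OF along(2)]
      by (intro nonsingular_on_solution_unique[OF hessian_nonsingular_on[OF w]]) simp_all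
    from arg_cong[OF this, of "\<lambda>c. lincomb UNIV c (\<lambda>\<alpha>. X \<alpha> (fst w))"] have "Z w = Z' w"
      by (simp only: frame_expansion[OF q tan(1)] frame_expansion[OF q tan(2)])
    then have "vlift_along Q Z w = vlift_along Q Z' w"
      by (simp add: vlift_along_def cong: if_cong)
    moreover have "(\<lambda>\<kappa>. Y w \<kappa> + vlift_along Q Z w \<kappa>) = (\<lambda>\<kappa>. Y' w \<kappa> + vlift_along Q Z' w \<kappa>)"
      by (rule trans[OF eq(1)[symmetric] eq(2)])
    ultimately show ?thesis
      by (simp add: fun_eq_iff)
  next
    case False
    then show ?thesis
      using TQ.vector_fieldsD(3)[OF vf(1)] TQ.vector_fieldsD(3)[OF vf(2)] by simp
  qed
qed

text \<open>The forces in the hypotheses are defined on the whole tangent bundle, so they provide the smooth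
  extensions required of a field on \<open>\<C>\<close>. Conversely the coefficients \<open>f\<^sup>a\<close> of any nonholonomic field,
  continued by \<open>f\<^sup>i = 0\<close>, satisfy the same pointwise linear system.\<close>

lemma nonholonomic_field_eq:
  assumes F: "\<And>\<alpha>. smooth_fun (tangent_bundle Q) (F \<alpha>)"
    and off: "\<And>w i. w \<in> carrier (tangent_bundle Q) \<Longrightarrow> i \<notin> A \<Longrightarrow> F i w = 0"
    and sol: "\<And>w b. w \<in> carrier (tangent_bundle Q) \<Longrightarrow> b \<in> A \<Longrightarrow>
      (\<Sum>\<alpha>\<in>UNIV. F \<alpha> w * G w \<alpha> b) = lagrangian_force b w"
  shows "nonholonomic_field Q D X A L =
    (\<lambda>w. if w \<in> constraint_set Q X A then second_order_field F w else (\<lambda>\<kappa>. 0))" (is "_ = ?N")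
  unfolding nonholonomic_field_def
proof (rule the_equality)
  note C = constraint_set_carrier
  have smooth: "smooth_fun_constraint Q X A (F a)" for a
    unfolding smooth_fun_constraint_def
  proof
    fix w assume "w \<in> constraint_set Q X A"
    then show "\<exists>W f. openin (mtopology (tangent_bundle Q)) W \<and> w \<in> W \<and>
        smooth_fun_on (tangent_bundle Q) W f \<and> (\<forall>u\<in>W \<inter> constraint_set Q X A. f u = F a u)"
      using TQ.openin_carrier C F by blast
  qed
  have EL: "vf_app (tangent_bundle Q) ?N (momentum Y) w - vf_app (tangent_bundle Q) (clift Q Y) L w = 0"
    if Y: "Y \<in> sections Q D" and w: "w \<in> constraint_set Q X A" for Y w
  proof -
    have vf: "Y \<in> vector_fields Q" and YD: "Y (fst w) \<in> D (fst w)" and q: "fst w \<in> carrier Q"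
      using Y C[OF w] by (auto simp: sections_def carrier_tangent_bundle)
    have "frame_coeff X (fst w) (Y (fst w)) \<beta> * euler_lagrange (second_order_field F) (X \<beta>) w = 0" for \<beta>
      using frame_coeff_distribution[OF q YD, of \<beta>] sol[OF C[OF w], of \<beta>]
      by (cases "\<beta> \<in> A") (simp_all add: euler_lagrange_frame[OF C[OF w]])
    then have "euler_lagrange (second_order_field F) Y w = 0"
      by (simp only: euler_lagrange_tensorial[OF C[OF w] vf] sum.neutral_const)
    then show ?thesis
      using w by (simp add: euler_lagrange_def vf_app_def)
  qed
  show "is_nonholonomic_field Q D X A L ?N"
    unfolding is_nonholonomic_field_def
  proof (intro conjI exI[of _ F] ballI allI impI)
    fix w \<kappa> assume w: "w \<in> constraint_set Q X A"
    show "?N w \<in> tangent_space (tangent_bundle Q) w"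
      using w by (simp add: second_order_field_tangent[OF C[OF w]])
    show "?N w \<kappa> = (\<Sum>a\<in>A. qv a w *\<^sub>R clift Q (X a) w \<kappa> + F a w *\<^sub>R vlift Q (X a) w \<kappa>)"
      using w by (simp add: second_order_field_on_constraint[of w F, OF w off[OF C[OF w]]])
    show "vec_app (tangent_bundle Q) w (?N w) (qv i) = 0" if "i \<in> - A" for i
      using w that by (simp add: quasi_velocity_second_order_field[OF C[OF w]] off[OF C[OF w]])
  qed (use smooth EL in simp_all)
  fix \<Gamma> assume \<Gamma>: "is_nonholonomic_field Q D X A L \<Gamma>"
  then obtain f where f: "\<And>w \<kappa>. w \<in> constraint_set Q X A \<Longrightarrow>
      \<Gamma> w \<kappa> = (\<Sum>a\<in>A. qv a w *\<^sub>R clift Q (X a) w \<kappa> + f a w *\<^sub>R vlift Q (X a) w \<kappa>)"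
    unfolding is_nonholonomic_field_def by blast
  define f' where "f' \<alpha> w = (if \<alpha> \<in> A then f \<alpha> w else 0)" for \<alpha> w
  show "\<Gamma> = ?N"
  proof
    fix w
    show "\<Gamma> w = ?N w"
    proof (cases "w \<in> constraint_set Q X A")
      case w: True
      have eq: "\<Gamma> w = second_order_field f' w"
      proof
        fix \<kappa>
        show "\<Gamma> w \<kappa> = second_order_field f' w \<kappa>"
          using second_order_field_on_constraint[OF w, of f' \<kappa>] f[OF w, of \<kappa>] by (simp add: f'_def)
      qed
      have "(\<Sum>\<alpha>\<in>UNIV. f' \<alpha> w * G w \<alpha> b) = lagrangian_force b w" if b: "b \<in> A" for b
      proof -
        have "X b \<in> sections Q D"
          using frame_vector_field frame_in_distribution[OF _ b] by (simp add: sections_def)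
        then have "euler_lagrange \<Gamma> (X b) w = 0"
          using \<Gamma> w by (simp add: is_nonholonomic_field_def euler_lagrange_def)
        then have "euler_lagrange (second_order_field f') (X b) w = 0"
          by (simp add: euler_lagrange_def vf_app_def eq)
        then show ?thesis
          by (simp add: euler_lagrange_frame[OF C[OF w]])
      qed
      then have "(\<lambda>\<alpha>. f' \<alpha> w) = (\<lambda>\<alpha>. F \<alpha> w)"
        using off[OF C[OF w]] sol[OF C[OF w]]
        by (intro nonsingular_on_solution_unique[OF hessian_nonsingular_on[OF C[OF w]]]) (simp_all add: f'_def)
      then have "second_order_field f' w = second_order_field F w"
        by (intro second_order_field_cong) (rule fun_cong)
      then show ?thesis
        using w eq by simp
    next
      case False
      then have "\<Gamma> w = (\<lambda>\<kappa>. 0)"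
        using \<Gamma> unfolding is_nonholonomic_field_def by blast
      with False show ?thesis by simp
    qed
  qed
qed

text \<open>The field \<open>\<Gamma>\<^sub>L\<close> satisfies the force equations for all indices and the constrained one those for
  the indices in \<open>A\<close>; on these the right-hand sides agree, which makes the difference orthogonal.\<close>

lemma projected_lagrangian_field:
  defines "\<Gamma>\<^sub>L \<equiv> lagrangian_field Q X L"
  defines "\<Gamma>1 \<equiv> tangent_projector Q D X A L \<Gamma>\<^sub>L"
  shows "sode Q X \<Gamma>1"
    and "\<And>w. w \<in> constraint_set Q X A \<Longrightarrow> \<Gamma>1 w = nonholonomic_field Q D X A L w"
    and "\<And>\<Gamma>. \<Gamma> \<in> tangent_fields Q X A \<and> \<Gamma> - \<Gamma>\<^sub>L \<in> orth_vertical Q D X L \<longleftrightarrow> \<Gamma> = \<Gamma>1"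
proof -
  obtain F where F: "\<And>\<alpha>. smooth_fun (tangent_bundle Q) (F \<alpha>)"
    and solF: "\<And>w \<beta>. w \<in> carrier (tangent_bundle Q) \<Longrightarrow> (\<Sum>\<alpha>\<in>UNIV. F \<alpha> w * G w \<alpha> \<beta>) = lagrangian_force \<beta> w"
    and \<Gamma>\<^sub>L: "\<Gamma>\<^sub>L = second_order_field F"
    unfolding \<Gamma>\<^sub>L_def by (rule lagrangian_field_exists) blast
  obtain F1 where F1: "\<And>\<alpha>. smooth_fun (tangent_bundle Q) (F1 \<alpha>)"
    and off: "\<And>w i. w \<in> carrier (tangent_bundle Q) \<Longrightarrow> i \<notin> A \<Longrightarrow> F1 i w = 0"
    and sol: "\<And>w b. w \<in> carrier (tangent_bundle Q) \<Longrightarrow> b \<in> A \<Longrightarrow>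
      (\<Sum>\<alpha>\<in>UNIV. F1 \<alpha> w * G w \<alpha> b) = lagrangian_force b w"
    by (rule constrained_force_exists) blast
  let ?Z = "\<lambda>w. lincomb UNIV (\<lambda>\<alpha>. F \<alpha> w - F1 \<alpha> w) (\<lambda>\<alpha>. X \<alpha> (fst w))"
  have tan: "second_order_field F1 \<in> tangent_fields Q X A"
    using F1 off by (rule second_order_field_tangent_fields)
  have along: "?Z \<in> fields_along_tau Q"
    by (rule lincomb_fields_along_tau) (intro TQ.smooth_fun_diff F F1)
  have "(\<Sum>\<alpha>\<in>UNIV. frame_coeff X (fst w) (?Z w) \<alpha> * G w \<alpha> b) = 0"
    if w: "w \<in> carrier (tangent_bundle Q)" and b: "b \<in> A" for w b
    using w solF[OF w, of b] sol[OF w b]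
    by (simp add: frame_coeff_lincomb carrier_tangent_bundle left_diff_distrib sum_subtractf)
  then have "?Z \<in> orth_fields Q D X L"
    by (simp only: orth_fields_iff[OF along]) blast
  then have orth: "\<Gamma>\<^sub>L - second_order_field F1 \<in> orth_vertical Q D X L"
    unfolding \<Gamma>\<^sub>L second_order_field_difference orth_vertical_def by (rule imageI)
  have \<Gamma>1: "\<Gamma>1 = second_order_field F1"
    unfolding \<Gamma>1_def tangent_projector_def
    using tan orth tangent_orth_decomposition_unique by (intro the_equality) blast+
  show "sode Q X \<Gamma>1"
    unfolding \<Gamma>1 sode_iff using F1 by blast
  show "\<Gamma>1 w = nonholonomic_field Q D X A L w" if "w \<in> constraint_set Q X A" for w
    using that nonholonomic_field_eq[OF F1 off sol] by (simp add: \<Gamma>1)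
  show "\<Gamma> \<in> tangent_fields Q X A \<and> \<Gamma> - \<Gamma>\<^sub>L \<in> orth_vertical Q D X L \<longleftrightarrow> \<Gamma> = \<Gamma>1" for \<Gamma>
    using tan orth orth_vertical_minus_commute tangent_orth_decomposition_unique[OF _ _ tan orth, of \<Gamma>]
    unfolding \<Gamma>1 by blast
qed

end

text \<open>Only the values of the field along the velocity curve matter, which for a nonholonomic trajectory
  lies in \<open>\<C>\<close>.\<close>

lemma base_integral_curve_cong:
  assumes "base_integral_curve Q \<Gamma> J c" "\<And>t. t \<in> J \<Longrightarrow> \<Gamma> (velocity Q c t) = \<Gamma>' (velocity Q c t)"
  shows "base_integral_curve Q \<Gamma>' J c"
  using assms by (simp add: base_integral_curve_def integral_curve_def)

theorem proposition1:
  fixes Q :: "('p, 'i, real^'n) atlas"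
    and D :: "'p \<Rightarrow> ('i \<Rightarrow> real^'n) set"
    and m :: nat
    and X :: "'n \<Rightarrow> 'p \<Rightarrow> 'i \<Rightarrow> real^'n"
    and A :: "'n set"
    and L :: "'p \<times> ('i \<Rightarrow> real^'n) \<Rightarrow> real"
  assumes "smooth_manifold Q"
    and "distribution Q m D"
    and "card A = m"
    and "adapted_frame Q D X A"
    and "smooth_fun (tangent_bundle Q) L"
    and "regular Q L"
    and "regular_wrt Q X A L"
  defines "\<Gamma>\<^sub>L \<equiv> lagrangian_field Q X L"
  defines "\<Gamma>1 \<equiv> tangent_projector Q D X A L \<Gamma>\<^sub>L"
  shows "sode_extension Q D X A L \<Gamma>1
    \<and> (\<forall>w\<in>constraint_set Q X A. \<Gamma>1 w = nonholonomic_field Q D X A L w)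
    \<and> (\<forall>\<Gamma>. (sode Q X \<Gamma> \<and> \<Gamma> \<in> tangent_fields Q X A \<and> \<Gamma> - \<Gamma>\<^sub>L \<in> orth_vertical Q D X L)
           \<longleftrightarrow> \<Gamma> = \<Gamma>1)"
proof -
  interpret smooth_atlas Q
    by (rule smooth_manifold_imp_smooth_atlas) fact
  interpret nonholonomic_system Q X L A D
    using assms(4-7) by unfold_locales (simp_all add: adapted_frame_def)
  note result = projected_lagrangian_field[folded \<Gamma>\<^sub>L_def, folded \<Gamma>1_def]
  have "sode_extension Q D X A L \<Gamma>1"
    unfolding sode_extension_def
  proof (intro conjI allI impI)
    fix J c assume "nonholonomic_trajectory Q D X A L J c"
    then have "velocity Q c ` J \<subseteq> constraint_set Q X A"
      and "base_integral_curve Q (nonholonomic_field Q D X A L) J c"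
      by (simp_all add: nonholonomic_trajectory_def)
    then show "base_integral_curve Q \<Gamma>1 J c"
      using result(2) by (elim base_integral_curve_cong) (auto simp: image_subset_iff)
  qed (rule result(1))
  then show ?thesis
    using result by blast
qed

end
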